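(* Let $\Lambda$ be a full rank lattice in $\mathbb{R}^d\times\widehat{\mathbb{R}}^d$, let $S\in\mathcal{HS}(\mathbb{R}^d)$ be such that $\{\alpha_\lambda(S)\}_{\lambda\in\Lambda}$ is a Riesz sequence in $\mathcal{HS}(\mathbb{R}^d)$, and let $$V_S^2=\Big\{\sum_{\lambda\in\Lambda}c(\lambda)\,\alpha_\lambda(S)\,:\,\{c(\lambda)\}_{\lambda\in\Lambda}\in\ell^2(\Lambda)\Big\}.$$ Let $\mathbf{q}\in\ell^2(\Lambda)$, and for each $T=\sum_{\lambda\in\Lambda}c(\lambda)\,\alpha_\lambda(S)\in V_S^2$, with coefficient sequence $\mathbf{c}=\{c(\lambda)\}_{\lambda\in\Lambda}\in\ell^2(\Lambda)$, put $s_T(\lambda):=(\mathbf{c}\ast_\Lambda\mathbf{q})(\lambda)$, $\lambda\in\Lambda$. Consider the condition $$(\mathrm{R})\qquad 0<\operatorname*{ess\,inf}_{\xi\in\widehat{\Lambda}}|\mathcal{F}_\sigma^\Lambda(\mathbf{q})(\xi)|\le\operatorname*{ess\,sup}_{\xi\in\widehat{\Lambda}}|\mathcal{F}_\sigma^\Lambda(\mathbf{q})(\xi)|<\infty .$$ (a) If (R) holds (so that $s_T\in\ell^2(\Lambda)$ for every $T\in V_S^2$), then there exists a unique Hilbert-Schmidt operator $H\in V_S^2$ such that $$T=\sum_{\lambda\in\Lambda}s_T(\lambda)\,\alpha_\lambda(H)\quad\text{in Hilbert-Schmidt norm, for every } T\in V_S^2,$$ and the convergence of the series is unconditional in Hilbert-Schmidt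 norm. (b) Conversely, if there exists $H\in V_S^2$ such that $\{\alpha_\lambda(H)\}_{\lambda\in\Lambda}$ is a Riesz basis for $V_S^2$ and $T=\sum_{\lambda\in\Lambda}s_T(\lambda)\,\alpha_\lambda(H)$ in Hilbert-Schmidt norm for every $T\in V_S^2$, then (R) holds.
   Context: $\mathcal{HS}(\mathbb{R}^d)$ is the Hilbert space of Hilbert-Schmidt operators on $L^2(\mathbb{R}^d)$ with inner product $\langle S,T\rangle_{\mathcal{HS}}=\mathrm{tr}(ST^* )$. For $z=(x,\omega)\in\mathbb{R}^d\times\widehat{\mathbb{R}}^d\cong\mathbb{R}^{2d}$, the time-frequency shift is the unitary operator $\pi(z)f(t)=e^{2\pi i\omega\cdot t}f(t-x)$ on $L^2(\mathbb{R}^d)$, and the translation of an operator $S$ by $z$ is $\alpha_z(S)=\pi(z)S\pi(z)^*$. A full rank lattice is $\Lambda=B\mathbb{Z}^{2d}$ with $B\in GL(2d,\mathbb{R})$. A Riesz sequence in a Hilbert space is a sequence which is a Riesz basis for its closed linear span; when $\{\alpha_\lambda(S)\}_{\lambda\in\Lambda}$ is a Riesz sequence, $V_S^2$ is the closed linear span of $\{\alpha_\lambda(S)\}_{\lambda\in\Lambda}$ and each $T\in V_S^2$ has a unique coefficient sequence $\mathbf{c}\in\ell^2(\Lambda)$. The convolution of sequences on $\Lambda$ is $(c\ast_\Lambda d)(\lambda)=\sum_{\lambda'\in\Lambda}c(\lambda')\,d(\lambda-\lambda')$. The standard symplectic form is $\sigma(z,z')=\omega\cdot x'-\omega'\cdot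 x$ for $z=(x,\omega)$, $z'=(x',\omega')$. The dual group $\widehat{\Lambda}$ is identified with the compact group $(\mathbb{R}^d\times\widehat{\mathbb{R}}^d)/\Lambda^\circ$, where $\Lambda^\circ=\{\lambda^\circ: e^{2\pi i\sigma(\lambda^\circ,\lambda)}=1\ \text{for all }\lambda\in\Lambda\}$, equipped with its normalized Haar measure. The symplectic Fourier series of $c\in\ell^1(\Lambda)$ is $\mathcal{F}_\sigma^\Lambda(c)(\dot z)=\sum_{\lambda\in\Lambda}c(\lambda)e^{2\pi i\sigma(\lambda,z)}$, where $\dot z$ is the class of $z$ modulo $\Lambda^\circ$; it extends to a unitary map $\mathcal{F}_\sigma^\Lambda:\ell^2(\Lambda)\to L^2(\widehat{\Lambda})$. Essential infima and suprema are with respect to Haar measure on $\widehat{\Lambda}$. *)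

theory Defs
  imports "HOL-Analysis.Analysis" "HOL-Probability.Essential_Supremum"
begin

section \<open>The Hilbert space of square-integrable functions\<close>

definition square_integrable :: "(real ^ 'n \<Rightarrow> complex) \<Rightarrow> bool" where
  "square_integrable f \<longleftrightarrow>
     f \<in> borel_measurable lborel \<and> integrable lborel (\<lambda>t. (cmod (f t))\<^sup>2)"

definition ae_equal :: "(real ^ 'n \<Rightarrow> complex) \<Rightarrow> (real ^ 'n \<Rightarrow> complex) \<Rightarrow> bool" where
  "ae_equal f g \<longleftrightarrow>
     square_integrable f \<and> square_integrable g \<and> (AE t in lborel. f t = g t)"

lemma square_integrable_zero: "square_integrable (\<lambda>t. 0)"
  by (simp add: square_integrable_def)

lemma square_integrable_scale:
  assumes "square_integrable f"
  shows "square_integrable (\<lambda>t. c * f t)"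
  using assms by (auto simp: square_integrable_def norm_mult power_mult_distrib)

lemma square_integrable_add:
  assumes "square_integrable f" "square_integrable g"
  shows "square_integrable (\<lambda>t. f t + g t)"
proof -
  have [measurable]: "f \<in> borel_measurable lborel" "g \<in> borel_measurable lborel"
    using assms by (auto simp: square_integrable_def)
  have "integrable lborel (\<lambda>t. 2 * (cmod (f t))\<^sup>2 + 2 * (cmod (g t))\<^sup>2)"
    using assms by (auto simp: square_integrable_def)
  then have "integrable lborel (\<lambda>t. (cmod (f t + g t))\<^sup>2)"
  proof (rule Bochner_Integration.integrable_bound, measurable, intro AE_I2)
    fix t
    have "(cmod (f t + g t))\<^sup>2 \<le> (cmod (f t) + cmod (g t))\<^sup>2"
      by (intro power_mono norm_triangle_ineq) auto
    also have "\<dots> \<le> 2 * (cmod (f t))\<^sup>2 + 2 * (cmod (g t))\<^sup>2"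
      using sum_squares_bound[of "cmod (f t)" "cmod (g t)"]
      by (simp add: power2_sum)
    finally show "norm ((cmod (f t + g t))\<^sup>2)
        \<le> norm (2 * (cmod (f t))\<^sup>2 + 2 * (cmod (g t))\<^sup>2)"
      by simp
  qed
  then show ?thesis by (simp add: square_integrable_def)
qed

lemma square_integrable_minus:
  "square_integrable f \<Longrightarrow> square_integrable (\<lambda>t. - f t)"
  using square_integrable_scale[of f "-1"] by simp

lemma square_integrable_diff:
  assumes "square_integrable f" "square_integrable g"
  shows "square_integrable (\<lambda>t. f t - g t)"
  using square_integrable_add[OF assms(1) square_integrable_minus[OF assms(2)]] by simp

lemma square_integrable_integrable_mult:
  assumes "square_integrable f" "square_integrable g"
  shows "integrable lborel (\<lambda>t. f t * cnj (g t))"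
proof -
  have [measurable]: "f \<in> borel_measurable lborel" "g \<in> borel_measurable lborel"
    using assms by (auto simp: square_integrable_def)
  have [measurable]: "(\<lambda>t. cnj (g t)) \<in> borel_measurable lborel"
    by (intro borel_measurable_continuous_on[where f = cnj]) (auto intro: continuous_intros)
  have "integrable lborel (\<lambda>t. (cmod (f t))\<^sup>2 + (cmod (g t))\<^sup>2)"
    using assms by (auto simp: square_integrable_def)
  then show ?thesis
  proof (rule Bochner_Integration.integrable_bound, measurable, intro AE_I2)
    fix t
    have "2 * cmod (f t) * cmod (g t) \<le> (cmod (f t))\<^sup>2 + (cmod (g t))\<^sup>2"
      by (rule sum_squares_bound)
    moreover have "0 \<le> cmod (f t) * cmod (g t)"
      by simp
    ultimately have "cmod (f t) * cmod (g t) \<le> (cmod (f t))\<^sup>2 + (cmod (g t))\<^sup>2"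
      by linarith
    then show "norm (f t * cnj (g t)) \<le> norm ((cmod (f t))\<^sup>2 + (cmod (g t))\<^sup>2)"
      by (simp add: norm_mult)
  qed
qed

lemma square_integrable_translate:
  assumes "square_integrable f"
  shows "square_integrable (\<lambda>t. f (t - x))"
proof -
  have [measurable]: "f \<in> borel_measurable lborel"
    using assms by (auto simp: square_integrable_def)
  have "integrable (distr lborel borel ((+) (-x))) (\<lambda>t. (cmod (f t))\<^sup>2)"
    using assms by (simp add: square_integrable_def lborel_distr_plus)
  then have "integrable lborel (\<lambda>t. (cmod (f (- x + t)))\<^sup>2)"
    by (subst (asm) integrable_distr_eq) auto
  then show ?thesis by (simp add: square_integrable_def)
qed

lemma AE_lborel_translate:
  fixes x :: "real ^ 'n"
  assumes "AE t in lborel. f t = (g t :: complex)"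
    and "f \<in> borel_measurable lborel" "g \<in> borel_measurable lborel"
  shows "AE t in lborel. f (t - x) = g (t - x)"
proof -
  have [measurable]: "f \<in> borel_measurable borel" "g \<in> borel_measurable borel"
    using assms by auto
  have "AE t in distr lborel borel ((+) (-x)). f t = g t"
    using assms by (subst lborel_distr_plus)
  then have "AE t in lborel. f (- x + t) = g (- x + t)"
    by (subst (asm) AE_distr_iff) auto
  then show ?thesis by simp
qed

lemma square_integrable_modulate:
  assumes "square_integrable f"
  shows "square_integrable (\<lambda>t. cis (2 * pi * (\<omega> \<bullet> t)) * f t)"
proof -
  have [measurable]: "f \<in> borel_measurable lborel"
    using assms by (auto simp: square_integrable_def)
  have [measurable]: "(\<lambda>t. cis (2 * pi * (\<omega> \<bullet> t))) \<in> borel_measurable lborel"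
    by (simp, intro borel_measurable_continuous_onI continuous_intros)
  show ?thesis
    using assms by (simp add: square_integrable_def norm_mult)
qed

quotient_type 'n l2 = "(real ^ 'n::finite) \<Rightarrow> complex" / partial: ae_equal
proof (rule part_equivpI)
  show "\<exists>f. ae_equal f (f :: real ^ 'n \<Rightarrow> complex)"
    by (intro exI[of _ "\<lambda>t. 0"]) (simp add: ae_equal_def square_integrable_zero)
  show "symp (ae_equal :: (real ^ 'n \<Rightarrow> complex) \<Rightarrow> _)"
    by (auto simp: symp_def ae_equal_def)
  show "transp (ae_equal :: (real ^ 'n \<Rightarrow> complex) \<Rightarrow> _)"
    by (auto simp: transp_def ae_equal_def)
qed

lift_definition cinner :: "'n::finite l2 \<Rightarrow> 'n l2 \<Rightarrow> complex" is
  "\<lambda>f g. \<integral>t. f t * cnj (g t) \<partial>lborel"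
proof -
  fix f f' g g' :: "real ^ 'n \<Rightarrow> complex"
  assume *: "ae_equal f f'" "ae_equal g g'"
  have "integrable lborel (\<lambda>t. f t * cnj (g t))" "integrable lborel (\<lambda>t. f' t * cnj (g' t))"
    using * by (auto simp: ae_equal_def intro!: square_integrable_integrable_mult)
  then show "(\<integral>t. f t * cnj (g t) \<partial>lborel) = (\<integral>t. f' t * cnj (g' t) \<partial>lborel)"
    using * by (intro integral_cong_AE borel_measurable_integrable) (auto simp: ae_equal_def)
qed

lift_definition scaleC :: "complex \<Rightarrow> 'n::finite l2 \<Rightarrow> 'n l2" (infixr \<open>*\<^sub>C\<close> 75) is
  "\<lambda>c f t. c * f t"
  by (auto simp: ae_equal_def square_integrable_scale)

instantiation l2 :: (finite) real_inner
begin

lift_definition zero_l2 :: "'a l2" is "\<lambda>t. 0"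
  by (simp add: ae_equal_def square_integrable_zero)

lift_definition plus_l2 :: "'a l2 \<Rightarrow> 'a l2 \<Rightarrow> 'a l2" is "\<lambda>f g t. f t + g t"
  by (auto simp: ae_equal_def square_integrable_add)

lift_definition uminus_l2 :: "'a l2 \<Rightarrow> 'a l2" is "\<lambda>f t. - f t"
  by (auto simp: ae_equal_def square_integrable_minus)

lift_definition minus_l2 :: "'a l2 \<Rightarrow> 'a l2 \<Rightarrow> 'a l2" is "\<lambda>f g t. f t - g t"
  by (auto simp: ae_equal_def square_integrable_diff)

definition scaleR_l2 :: "real \<Rightarrow> 'a l2 \<Rightarrow> 'a l2" where
  "scaleR_l2 r f = complex_of_real r *\<^sub>C f"

definition inner_l2 :: "'a l2 \<Rightarrow> 'a l2 \<Rightarrow> real" where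
  "inner_l2 f g = Re (cinner f g)"

definition norm_l2 :: "'a l2 \<Rightarrow> real" where
  "norm_l2 f = sqrt (inner f f)"

definition sgn_l2 :: "'a l2 \<Rightarrow> 'a l2" where
  "sgn_l2 f = inverse (norm f) *\<^sub>R f"

definition dist_l2 :: "'a l2 \<Rightarrow> 'a l2 \<Rightarrow> real" where
  "dist_l2 f g = norm (f - g)"

definition uniformity_l2 :: "('a l2 \<times> 'a l2) filter" where
  "uniformity_l2 = (INF e\<in>{0<..}. principal {(f, g). dist f g < e})"

definition open_l2 :: "'a l2 set \<Rightarrow> bool" where
  "open_l2 U \<longleftrightarrow> (\<forall>f\<in>U. eventually (\<lambda>(f', g). f' = f \<longrightarrow> g \<in> U) uniformity)"

instance
proof
  fix f g h :: "'a l2" and r s :: real and U :: "'a l2 set"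
  show "f + g + h = f + (g + h)"
    by transfer (auto simp: ae_equal_def square_integrable_add add.assoc)
  show "f + g = g + f"
    by transfer (auto simp: ae_equal_def square_integrable_add add.commute)
  show "0 + f = f"
    by transfer (auto simp: ae_equal_def)
  show "- f + f = 0"
    by transfer (auto simp: ae_equal_def square_integrable_zero)
  show "f - g = f + - g"
    by transfer (auto simp: ae_equal_def square_integrable_diff)
  show "r *\<^sub>R (f + g) = r *\<^sub>R f + r *\<^sub>R g"
    unfolding scaleR_l2_def
    by transfer (auto simp: ae_equal_def square_integrable_scale square_integrable_add ring_distribs)
  show "(r + s) *\<^sub>R f = r *\<^sub>R f + s *\<^sub>R f"
    unfolding scaleR_l2_def
    by transfer (auto simp: ae_equal_def square_integrable_scale square_integrable_add ring_distribs)
  show "r *\<^sub>R s *\<^sub>R f = (r * s) *\<^sub>R f"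
    unfolding scaleR_l2_def
    by transfer (auto simp: ae_equal_def square_integrable_scale mult.assoc)
  show "1 *\<^sub>R f = f"
    unfolding scaleR_l2_def by transfer (auto simp: ae_equal_def)
  show "dist f g = norm (f - g)"
    by (rule dist_l2_def)
  show "sgn f = inverse (norm f) *\<^sub>R f"
    by (rule sgn_l2_def)
  show "uniformity = (INF e\<in>{0<..}. principal {(f :: 'a l2, g). dist f g < e})"
    by (rule uniformity_l2_def)
  show "open U \<longleftrightarrow> (\<forall>f\<in>U. \<forall>\<^sub>F (f', g) in uniformity. f' = f \<longrightarrow> g \<in> U)"
    by (rule open_l2_def)
  show "norm f = sqrt (inner f f)"
    by (rule norm_l2_def)
  show "inner f g = inner g f"
    unfolding inner_l2_def
  proof transfer
    fix f g :: "real ^ 'a \<Rightarrow> complex"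
    assume "ae_equal f f" "ae_equal g g"
    have "(\<integral>t. f t * cnj (g t) \<partial>lborel) = (\<integral>t. cnj (g t * cnj (f t)) \<partial>lborel)"
      by (simp add: mult.commute)
    also have "\<dots> = cnj (\<integral>t. g t * cnj (f t) \<partial>lborel)"
      by (rule Bochner_Integration.integral_cnj)
    finally show "Re (\<integral>t. f t * cnj (g t) \<partial>lborel) = Re (\<integral>t. g t * cnj (f t) \<partial>lborel)"
      by simp
  qed
  show "inner (f + g) h = inner f h + inner g h"
    unfolding inner_l2_def
    by transfer
      (auto simp: ae_equal_def ring_distribs square_integrable_integrable_mult)
  show "inner (r *\<^sub>R f) g = r * inner f g"
    unfolding inner_l2_def scaleR_l2_def
    by transfer (simp add: mult.assoc)
  have ff: "(\<integral>t. f t * cnj (f t) \<partial>lborel) = complex_of_real (\<integral>t. (cmod (f t))\<^sup>2 \<partial>lborel)"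
    for f :: "real ^ 'a \<Rightarrow> complex"
    by (simp add: complex_norm_square[symmetric] del: of_real_power)
  show "0 \<le> inner f f"
    unfolding inner_l2_def by transfer (simp add: ff)
  show "inner f f = 0 \<longleftrightarrow> f = 0"
    unfolding inner_l2_def
  proof transfer
    fix f :: "real ^ 'a \<Rightarrow> complex"
    assume "ae_equal f f"
    then have "square_integrable f" by (simp add: ae_equal_def)
    then show "Re (\<integral>t. f t * cnj (f t) \<partial>lborel) = 0 \<longleftrightarrow> ae_equal f (\<lambda>t. 0)"
      unfolding ff
      by (subst Re_complex_of_real, subst integral_nonneg_eq_0_iff_AE)
        (auto simp: square_integrable_def ae_equal_def)
  qed
qed

end


section \<open>Phase space, lattices and time-frequency shifts\<close>

type_synonym 'n phase = "(real ^ 'n) \<times> (real ^ 'n)"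

definition symplectic :: "'n::finite phase \<Rightarrow> 'n phase \<Rightarrow> real" where
  "symplectic z z' = snd z \<bullet> fst z' - snd z' \<bullet> fst z"

definition integer_points :: "'n::finite phase set" where
  "integer_points = {z. \<forall>i. fst z $ i \<in> \<int> \<and> snd z $ i \<in> \<int>}"

text \<open>Invertible real matrices of size $2d$ are rendered as linear bijections of phase space.\<close>

definition lattice_basis :: "('n::finite phase \<Rightarrow> 'n phase) \<Rightarrow> 'n phase set \<Rightarrow> bool" where
  "lattice_basis B \<Lambda> \<longleftrightarrow> linear B \<and> bij B \<and> \<Lambda> = B ` integer_points"

definition full_rank_lattice :: "'n::finite phase set \<Rightarrow> bool" where
  "full_rank_lattice \<Lambda> \<longleftrightarrow> (\<exists>B. lattice_basis B \<Lambda>)"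

lift_definition tf_shift :: "'n::finite phase \<Rightarrow> 'n l2 \<Rightarrow> 'n l2" is
  "\<lambda>z f t. cis (2 * pi * (snd z \<bullet> t)) * f (t - fst z)"
proof -
  fix z :: "'n phase" and f g :: "real ^ 'n \<Rightarrow> complex"
  assume fg: "ae_equal f g"
  then have "AE t in lborel. f (t - fst z) = g (t - fst z)"
    by (intro AE_lborel_translate) (auto simp: ae_equal_def square_integrable_def)
  with fg show "ae_equal (\<lambda>t. cis (2 * pi * (snd z \<bullet> t)) * f (t - fst z))
      (\<lambda>t. cis (2 * pi * (snd z \<bullet> t)) * g (t - fst z))"
    by (auto simp: ae_equal_def
        intro!: square_integrable_modulate square_integrable_translate)
qed


section \<open>Hilbert-Schmidt operators\<close>

type_synonym 'n operator = "'n l2 \<Rightarrow> 'n l2"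

definition bounded_operator :: "'n::finite operator \<Rightarrow> bool" where
  "bounded_operator A \<longleftrightarrow> bounded_linear A \<and> (\<forall>c f. A (c *\<^sub>C f) = c *\<^sub>C A f)"

definition adj :: "'n::finite operator \<Rightarrow> 'n operator" where
  "adj A = (THE B. \<forall>f g. cinner (A f) g = cinner f (B g))"

definition orthonormal_basis :: "'n::finite l2 set \<Rightarrow> bool" where
  "orthonormal_basis E \<longleftrightarrow>
     (\<forall>e\<in>E. \<forall>e'\<in>E. cinner e e' = (if e = e' then 1 else 0)) \<and>
     (\<forall>f. (\<forall>e\<in>E. cinner f e = 0) \<longrightarrow> f = 0)"

text \<open>The choice of the orthonormal basis is immaterial for operators of trace class.\<close>

definition trace :: "'n::finite operator \<Rightarrow> complex" where
  "trace A = (\<Sum>\<^sub>\<infinity>e\<in>(SOME E. orthonormal_basis E). cinner (A e) e)"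

definition hilbert_schmidt :: "'n::finite operator \<Rightarrow> bool" where
  "hilbert_schmidt S \<longleftrightarrow> bounded_operator S \<and>
     (\<exists>E. orthonormal_basis E \<and> (\<lambda>e. (norm (S e))\<^sup>2) summable_on E)"

definition hs_inner :: "'n::finite operator \<Rightarrow> 'n operator \<Rightarrow> complex" where
  "hs_inner S T = trace (S \<circ> adj T)"

definition hs_norm :: "'n::finite operator \<Rightarrow> real" where
  "hs_norm S = sqrt (Re (hs_inner S S))"

definition op_diff :: "'n::finite operator \<Rightarrow> 'n operator \<Rightarrow> 'n operator" where
  "op_diff S T = (\<lambda>f. S f - T f)"

definition op_lincomb :: "('i \<Rightarrow> complex) \<Rightarrow> ('i \<Rightarrow> 'n::finite operator) \<Rightarrow> 'i set \<Rightarrow> 'n operator" where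
  "op_lincomb c A F = (\<lambda>f. \<Sum>i\<in>F. c i *\<^sub>C A i f)"

text \<open>Unconditional convergence of $\sum_{i \in I} c_i A_i$ to $T$ in Hilbert-Schmidt norm, as
  convergence of the net of finite partial sums (compare \<^const>\<open>has_sum\<close>).\<close>

definition hs_has_sum ::
  "('i \<Rightarrow> complex) \<Rightarrow> ('i \<Rightarrow> 'n::finite operator) \<Rightarrow> 'i set \<Rightarrow> 'n operator \<Rightarrow> bool" where
  "hs_has_sum c A I T \<longleftrightarrow> hilbert_schmidt T \<and>
     ((\<lambda>F. hs_norm (op_diff (op_lincomb c A F) T)) \<longlongrightarrow> 0) (finite_subsets_at_top I)"

definition hs_closed_span :: "('i \<Rightarrow> 'n::finite operator) \<Rightarrow> 'i set \<Rightarrow> 'n operator set" where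
  "hs_closed_span A I = {T. hilbert_schmidt T \<and>
     (\<forall>\<epsilon>>0. \<exists>F c. finite F \<and> F \<subseteq> I \<and> hs_norm (op_diff (op_lincomb c A F) T) < \<epsilon>)}"

definition hs_orthonormal_basis ::
  "'n::finite operator set \<Rightarrow> ('i \<Rightarrow> 'n operator) \<Rightarrow> 'i set \<Rightarrow> bool" where
  "hs_orthonormal_basis V A I \<longleftrightarrow> (\<forall>i\<in>I. A i \<in> V) \<and>
     (\<forall>i\<in>I. \<forall>j\<in>I. hs_inner (A i) (A j) = (if i = j then 1 else 0)) \<and>
     hs_closed_span A I = V"

definition boundedly_invertible_on ::
  "'n::finite operator set \<Rightarrow> ('n operator \<Rightarrow> 'n operator) \<Rightarrow> bool" where
  "boundedly_invertible_on V U \<longleftrightarrow> bij_betw U V V \<and>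
     (\<forall>S\<in>V. \<forall>T\<in>V. \<forall>a b. U (\<lambda>f. a *\<^sub>C S f + b *\<^sub>C T f) = (\<lambda>f. a *\<^sub>C U S f + b *\<^sub>C U T f)) \<and>
     (\<exists>M. \<forall>S\<in>V. hs_norm (U S) \<le> M * hs_norm S) \<and>
     (\<exists>M. \<forall>S\<in>V. hs_norm S \<le> M * hs_norm (U S))"

definition riesz_basis ::
  "'n::finite operator set \<Rightarrow> ('i \<Rightarrow> 'n operator) \<Rightarrow> 'i set \<Rightarrow> bool" where
  "riesz_basis V A I \<longleftrightarrow>
     (\<exists>e U. hs_orthonormal_basis V e I \<and> boundedly_invertible_on V U \<and> (\<forall>i\<in>I. A i = U (e i)))"

definition riesz_sequence :: "('i \<Rightarrow> 'n::finite operator) \<Rightarrow> 'i set \<Rightarrow> bool" where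
  "riesz_sequence A I \<longleftrightarrow> riesz_basis (hs_closed_span A I) A I"

definition op_translate :: "'n::finite phase \<Rightarrow> 'n operator \<Rightarrow> 'n operator" where
  "op_translate z S = tf_shift z \<circ> S \<circ> adj (tf_shift z)"


section \<open>Sequences on a lattice and the space generated by an operator\<close>

text \<open>Sequences on \<open>\<Lambda>\<close> are functions on phase space of which only the values on \<open>\<Lambda>\<close> matter.\<close>

definition ell2 :: "'i set \<Rightarrow> ('i \<Rightarrow> complex) set" where
  "ell2 I = {c. (\<lambda>i. (cmod (c i))\<^sup>2) summable_on I}"

definition lattice_conv ::
  "'n::finite phase set \<Rightarrow> ('n phase \<Rightarrow> complex) \<Rightarrow> ('n phase \<Rightarrow> complex) \<Rightarrow> 'n phase \<Rightarrow> complex" where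
  "lattice_conv \<Lambda> c d = (\<lambda>l. \<Sum>\<^sub>\<infinity>\<mu>\<in>\<Lambda>. c \<mu> * d (l - \<mu>))"

definition V2 :: "'n::finite phase set \<Rightarrow> 'n operator \<Rightarrow> 'n operator set" where
  "V2 \<Lambda> S = {T. \<exists>c\<in>ell2 \<Lambda>. hs_has_sum c (\<lambda>l. op_translate l S) \<Lambda> T}"


section \<open>The dual group and the symplectic Fourier series\<close>

definition adjoint_lattice :: "'n::finite phase set \<Rightarrow> 'n phase set" where
  "adjoint_lattice \<Lambda> = {z. \<forall>l\<in>\<Lambda>. cis (2 * pi * symplectic z l) = 1}"

text \<open>The dual group is the set of cosets of the adjoint lattice, i.e. the range of \<open>dual_class \<Lambda>\<close>.\<close>

definition dual_class :: "'n::finite phase set \<Rightarrow> 'n phase \<Rightarrow> 'n phase set" where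
  "dual_class \<Lambda> z = (+) z ` adjoint_lattice \<Lambda>"

definition fundamental_cell :: "'n::finite phase set \<Rightarrow> 'n phase set" where
  "fundamental_cell L = (SOME B. lattice_basis B L) `
     {z. \<forall>i. fst z $ i \<in> {0..<1} \<and> snd z $ i \<in> {0..<1}}"

text \<open>Normalized Haar measure on the Borel sets of the quotient group: the image, under the
  quotient map, of normalized Lebesgue measure on a fundamental cell of the adjoint lattice.\<close>

definition dual_haar :: "'n::finite phase set \<Rightarrow> 'n phase set measure" where
  "dual_haar \<Lambda> =
     distr (uniform_measure lborel (fundamental_cell (adjoint_lattice \<Lambda>)))
       (sigma (range (dual_class \<Lambda>))
         {A. A \<subseteq> range (dual_class \<Lambda>) \<and> dual_class \<Lambda> -` A \<in> sets borel})
       (dual_class \<Lambda>)"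

lemma sets_dual_haar:
  "sets (dual_haar \<Lambda>) = {A. A \<subseteq> range (dual_class \<Lambda>) \<and> dual_class \<Lambda> -` A \<in> sets borel}"
  (is "_ = ?A")
proof -
  have "dual_class \<Lambda> -` (range (dual_class \<Lambda>) - s) = - (dual_class \<Lambda> -` s)" for s
    by auto
  then have "sigma_algebra (range (dual_class \<Lambda>)) ?A"
    unfolding sigma_algebra_iff2
    by (auto simp: vimage_UN intro: borel_comp intro!: sets.countable_UN)
  then show ?thesis
    unfolding dual_haar_def by (simp add: sigma_algebra.sets_measure_of_eq)
qed

lemma measurable_dual_class: "dual_class \<Lambda> \<in> borel \<rightarrow>\<^sub>M dual_haar \<Lambda>"
proof (rule measurableI)
  have "space (dual_haar \<Lambda>) = range (dual_class \<Lambda>)"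
    unfolding dual_haar_def by (simp add: space_measure_of_conv)
  then show "dual_class \<Lambda> z \<in> space (dual_haar \<Lambda>)" for z
    by simp
qed (simp add: sets_dual_haar)

definition dual_char :: "'n::finite phase \<Rightarrow> 'n phase set \<Rightarrow> complex" where
  "dual_char l \<xi> = cis (2 * pi * symplectic l (SOME z. z \<in> \<xi>))"

lemma symplectic_add_right: "symplectic z (w + w') = symplectic z w + symplectic z w'"
  by (simp add: symplectic_def inner_add_left inner_add_right)

lemma symplectic_commute: "symplectic z w = - symplectic w z"
  by (simp add: symplectic_def)

lemma dual_char_class:
  assumes "l \<in> \<Lambda>"
  shows "dual_char l (dual_class \<Lambda> z) = cis (2 * pi * symplectic l z)"
proof -
  have "0 \<in> adjoint_lattice \<Lambda>"
    by (simp add: adjoint_lattice_def symplectic_def)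
  then have "z \<in> dual_class \<Lambda> z"
    unfolding dual_class_def by force
  then have "(SOME w. w \<in> dual_class \<Lambda> z) \<in> dual_class \<Lambda> z"
    by (rule someI)
  then obtain \<mu> where \<mu>: "\<mu> \<in> adjoint_lattice \<Lambda>"
    and eq: "(SOME w. w \<in> dual_class \<Lambda> z) = z + \<mu>"
    unfolding dual_class_def by auto
  have "cis (2 * pi * symplectic \<mu> l) = 1"
    using \<mu> assms by (simp add: adjoint_lattice_def)
  then have "cis (2 * pi * symplectic l \<mu>) = 1"
    by (subst symplectic_commute) (simp add: cis_inverse[symmetric] del: cis_inverse)
  then show ?thesis
    unfolding dual_char_def eq symplectic_add_right ring_distribs cis_mult[symmetric] by simp
qed

text \<open>A representative of the limit in $L^2(\widehat{\Lambda})$ of the finite partial sums of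
  $\sum_{\lambda \in \Lambda} c(\lambda) e^{2 \pi i \sigma(\lambda, z)}$; it is determined up to
  a null set.\<close>

definition symplectic_fourier ::
  "'n::finite phase set \<Rightarrow> ('n phase \<Rightarrow> complex) \<Rightarrow> 'n phase set \<Rightarrow> complex" where
  "symplectic_fourier \<Lambda> c = (SOME G. G \<in> borel_measurable (dual_haar \<Lambda>) \<and>
     ((\<lambda>F. \<integral>\<^sup>+\<xi>. ennreal ((cmod ((\<Sum>l\<in>F. c l * dual_char l \<xi>) - G \<xi>))\<^sup>2) \<partial>dual_haar \<Lambda>)
        \<longlongrightarrow> 0) (finite_subsets_at_top \<Lambda>))"

definition essinf :: "'a measure \<Rightarrow> ('a \<Rightarrow> ereal) \<Rightarrow> ereal" where
  "essinf M f = - esssup M (\<lambda>x. - f x)"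

definition condition_R :: "'n::finite phase set \<Rightarrow> ('n phase \<Rightarrow> complex) \<Rightarrow> bool" where
  "condition_R \<Lambda> q \<longleftrightarrow>
     0 < essinf (dual_haar \<Lambda>) (\<lambda>\<xi>. ereal (cmod (symplectic_fourier \<Lambda> q \<xi>))) \<and>
     essinf (dual_haar \<Lambda>) (\<lambda>\<xi>. ereal (cmod (symplectic_fourier \<Lambda> q \<xi>)))
       \<le> esssup (dual_haar \<Lambda>) (\<lambda>\<xi>. ereal (cmod (symplectic_fourier \<Lambda> q \<xi>))) \<and>
     esssup (dual_haar \<Lambda>) (\<lambda>\<xi>. ereal (cmod (symplectic_fourier \<Lambda> q \<xi>))) < \<infinity>"

end

theory Submission
  imports Defs "HOL-Probability.Probability_Measure"
begin

text \<open>The Riesz bounds identify coefficient sequences with operators in \<open>V2 \<Lambda> S\<close>, and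
  the symplectic Fourier series identifies them with square-integrable functions on the dual group;
  there, convolution with \<open>q\<close> is multiplication by its Fourier series \<open>\<theta>\<close>. Condition (R) says
  that \<open>\<theta>\<close> is bounded above and away from zero. If it holds, \<open>H\<close> must be the operator whose
  coefficient sequence \<open>h\<close> has Fourier series \<open>1 / \<theta>\<close>: reconstruction is the identity
  \<open>\<theta> \<cdot> (1 / \<theta>) = 1\<close>, and uniqueness follows by reconstructing \<open>H\<close> itself, whose samples
  are a unit impulse at \<open>0\<close>. Conversely, two Riesz bases make \<open>c \<mapsto> c * q\<close> bounded above and
  below on all admissible \<open>c\<close>, and testing with indicator functions of \<open>{\<bar>\<theta>\<bar> > a}\<close> and
  \<open>{\<bar>\<theta>\<bar> < a}\<close> turns this into bounds on \<open>\<theta>\<close>.\<close>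

section \<open>Square-integrable functions\<close>

text \<open>Several given notions rest on choices: \<open>trace\<close> sums over some basis,
  \<open>adj\<close> is a definite description, \<open>symplectic_fourier\<close> is some
  representative of a limit. Each must be shown to denote something before it can be computed with.
  This is why \<open>l2\<close> is proved complete, adjoints are built by coordinates, and
  Hilbert-Schmidt operators become a type in which convergence is plain \<open>has_sum\<close>. On
  the Fourier side only orthogonality and totality of the characters are used; totality is the hard
  one and is proved on a fundamental cell. The recurring obstacle is that \<theta> is a priori only
  square integrable, so f \<theta> need not be. The convolution rule therefore concerns the
  coefficients of a merely integrable product, and the converse direction may only test with
  functions f for which f \<theta> is square integrable. Unconditional convergence in (a) comes from
  an error identity: if f has coefficients c, a finite sum of samples times translates of H minus T
  is the synthesis of 1/\<theta> times (partial Fourier sum of f \<theta> minus f \<theta>).\<close>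

abbreviation L2_gap :: "'a measure \<Rightarrow> ('a \<Rightarrow> complex) \<Rightarrow> ('a \<Rightarrow> complex) \<Rightarrow> ennreal" where
  "L2_gap M f g \<equiv> \<integral>\<^sup>+x. ennreal ((cmod (f x - g x))\<^sup>2) \<partial>M"

abbreviation sq_norm :: "'a measure \<Rightarrow> ('a \<Rightarrow> complex) \<Rightarrow> real" where
  "sq_norm M f \<equiv> \<integral>x. (cmod (f x))\<^sup>2 \<partial>M"

abbreviation sq_sum :: "('i \<Rightarrow> complex) \<Rightarrow> 'i set \<Rightarrow> real" where
  "sq_sum c F \<equiv> \<Sum>i\<in>F. (cmod (c i))\<^sup>2"

lemma norm_add_sq_le:
  fixes x y :: "'a :: real_normed_vector"
  shows "(norm (x + y))\<^sup>2 \<le> 2 * (norm x)\<^sup>2 + 2 * (norm y)\<^sup>2"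
proof -
  have "(norm (x + y))\<^sup>2 \<le> (norm x + norm y)\<^sup>2"
    by (intro power_mono norm_triangle_ineq) auto
  also have "\<dots> \<le> 2 * (norm x)\<^sup>2 + 2 * (norm y)\<^sup>2"
    using sum_squares_bound[of "norm x" "norm y"] by (simp add: power2_sum)
  finally show ?thesis .
qed

text \<open>A triangle inequality with factor 2 for squared distances. It avoids square roots of
  extended reals and is enough for limit arguments.\<close>

lemma nn_integral_cmod_sq_triangle:
  fixes f g h :: "'a \<Rightarrow> complex"
  assumes [measurable]: "f \<in> borel_measurable M" "g \<in> borel_measurable M" "h \<in> borel_measurable M"
  shows "L2_gap M f h
    \<le> 2 * L2_gap M f g + 2 * L2_gap M g h"
proof -
  have "(cmod (f x - h x))\<^sup>2 \<le> 2 * (cmod (f x - g x))\<^sup>2 + 2 * (cmod (g x - h x))\<^sup>2" for x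
    using norm_add_sq_le[of "f x - g x" "g x - h x"] by simp
  then have "ennreal ((cmod (f x - h x))\<^sup>2)
      \<le> 2 * ennreal ((cmod (f x - g x))\<^sup>2) + 2 * ennreal ((cmod (g x - h x))\<^sup>2)" for x
    using ennreal_leI[of _ "2 * (cmod (f x - g x))\<^sup>2 + 2 * (cmod (g x - h x))\<^sup>2"]
    by (simp add: ennreal_mult)
  then have "L2_gap M f h
     \<le> (\<integral>\<^sup>+x. (2 * ennreal ((cmod (f x - g x))\<^sup>2) + 2 * ennreal ((cmod (g x - h x))\<^sup>2)) \<partial>M)"
    by (intro nn_integral_mono)
  also have "\<dots> = 2 * L2_gap M f g + 2 * L2_gap M g h"
    by (subst nn_integral_add) (auto simp: nn_integral_cmult)
  finally show ?thesis .
qed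

text \<open>The classical completeness proof: a fast subsequence converges almost everywhere, and
  Fatou's lemma upgrades this to convergence of the whole sequence in mean square.\<close>

lemma L2_Cauchy_limit:
  fixes f :: "nat \<Rightarrow> 'a \<Rightarrow> complex"
  assumes [measurable]: "\<And>n. f n \<in> borel_measurable M"
    and Cauchy: "\<And>e. e > 0 \<Longrightarrow> \<exists>N. \<forall>m\<ge>N. \<forall>n\<ge>N.
      (L2_gap M (f m) (f n)) \<le> ennreal e"
  obtains g where "g \<in> borel_measurable M"
    "(\<lambda>n. L2_gap M (f n) g) \<longlonglongrightarrow> 0"
proof -
  define d where "d m n = L2_gap M (f m) (f n)" for m n
  have "\<exists>N. \<forall>m\<ge>N. \<forall>n\<ge>N. d m n \<le> ennreal ((1/8) ^ k)" for k
    using Cauchy[of "(1/8) ^ k"] unfolding d_def by simp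
  then obtain N where N: "\<And>k m n. m \<ge> N k \<Longrightarrow> n \<ge> N k \<Longrightarrow> d m n \<le> ennreal ((1/8) ^ k)"
    by metis
  define r where "r k = Max (N ` {..k})" for k
  have r: "d (r k) (r (Suc k)) \<le> ennreal ((1/8) ^ k)" for k
    by (rule N; unfold r_def; rule Max_ge; auto)
  have rN: "r k \<ge> N k" for k unfolding r_def by (rule Max_ge) auto
  \<comment> \<open>Gaps of size 8^-k leave room for weights 4^k: the weighted sum of squared
    increments has integral at most the sum of 2^-k. Where it is finite, the increments decay like
    2^-k, so they are summable.\<close>
  define a where "a k x = cmod (f (r k) x - f (r (Suc k)) x)" for k x
  have [measurable]: "a k \<in> borel_measurable M" for k
    unfolding a_def by measurable
  have "(\<integral>\<^sup>+x. (\<Sum>k. ennreal (4 ^ k * (a k x)\<^sup>2)) \<partial>M) = (\<Sum>k. \<integral>\<^sup>+x. ennreal (4 ^ k * (a k x)\<^sup>2) \<partial>M)"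
    by (rule nn_integral_suminf) auto
  also have "\<dots> = (\<Sum>k. ennreal (4 ^ k) * d (r k) (r (Suc k)))"
    by (intro suminf_cong) (simp add: ennreal_mult nn_integral_cmult a_def d_def)
  also have "\<dots> \<le> (\<Sum>k. ennreal ((1/2) ^ k))"
  proof (intro suminf_le summableI)
    fix k
    have "ennreal (4 ^ k) * d (r k) (r (Suc k)) \<le> ennreal (4 ^ k) * ennreal ((1/8) ^ k)"
      by (intro mult_left_mono r) auto
    also have "\<dots> = ennreal ((1/2) ^ k)"
      using power_mult_distrib[of 4 "1/8::real" k] by (simp add: ennreal_mult[symmetric])
    finally show "ennreal (4 ^ k) * d (r k) (r (Suc k)) \<le> ennreal ((1/2) ^ k)" .
  qed
  also have "\<dots> = ennreal (\<Sum>k. (1/2) ^ k)"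
    by (rule suminf_ennreal2) (auto intro: summable_geometric)
  also have "\<dots> < \<infinity>" by simp
  finally have "(\<integral>\<^sup>+x. (\<Sum>k. ennreal (4 ^ k * (a k x)\<^sup>2)) \<partial>M) \<noteq> \<infinity>"
    by (rule less_imp_neq)
  then have fin: "AE x in M. (\<Sum>k. ennreal (4 ^ k * (a k x)\<^sup>2)) \<noteq> \<infinity>"
    by (rule nn_integral_PInf_AE[rotated]) measurable
  have pointwise: "convergent (\<lambda>k. f (r k) x)" if fin: "(\<Sum>k. ennreal (4 ^ k * (a k x)\<^sup>2)) \<noteq> \<infinity>" for x
  proof -
    define u where "u k = ennreal (4 ^ k * (a k x)\<^sup>2)" for k
    define s where "s = enn2real (\<Sum>k. u k)"
    have bd: "a k x \<le> sqrt s * (1/2) ^ k" for k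
    proof -
      have "u k \<le> (\<Sum>k. u k)"
        using sum_le_suminf[OF summableI, of "{k}" u] by simp
      also have "\<dots> = ennreal s"
        using fin unfolding s_def u_def[symmetric] by (simp add: less_top)
      finally have "4 ^ k * (a k x)\<^sup>2 \<le> s"
        by (simp add: s_def u_def)
      moreover have two: "((2::real) ^ k)\<^sup>2 = 4 ^ k"
        by (simp add: power2_eq_square flip: power_mult_distrib)
      ultimately have "(2 ^ k * a k x)\<^sup>2 \<le> s"
        using two by (simp add: power_mult_distrib)
      then have "2 ^ k * a k x \<le> sqrt s"
        by (rule real_le_rsqrt)
      then show ?thesis by (simp add: power_one_over field_simps)
    qed
    have "summable (\<lambda>k. f (r (Suc k)) x - f (r k) x)"
      by (rule summable_comparison_test'[of "\<lambda>k. sqrt s * (1/2) ^ k" 0])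
        (use bd in \<open>auto simp: a_def norm_minus_commute intro!: summable_mult summable_geometric\<close>)
    then have "convergent (\<lambda>n. \<Sum>k<n. (f (r (Suc k)) x - f (r k) x))"
      by (simp add: summable_iff_convergent)
    then have "convergent (\<lambda>n. f (r n) x - f (r 0) x)"
      by (simp add: sum_lessThan_telescope[of "\<lambda>k. f (r k) x"])
    then show "convergent (\<lambda>k. f (r k) x)"
      by (simp add: convergent_diff_const_right_iff)
  qed
  have conv: "AE x in M. convergent (\<lambda>k. f (r k) x)"
    by (rule eventually_mono[OF fin pointwise])
  define g where "g x = lim (\<lambda>k. f (r k) x)" for x
  have [measurable]: "g \<in> borel_measurable M"
    unfolding g_def by (rule borel_measurable_lim_metric) simp
  have lim: "AE x in M. (\<lambda>k. f (r k) x) \<longlonglongrightarrow> g x"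
    using conv by eventually_elim (simp add: g_def convergent_LIMSEQ_iff)
  \<comment> \<open>Fatou's lemma along the subsequence, with \<open>n\<close> held fixed.\<close>
  have bound: "L2_gap M (f n) g \<le> ennreal ((1/8) ^ k)" if "n \<ge> N k" for n k
  proof -
    have "L2_gap M (f n) g
        = (\<integral>\<^sup>+x. liminf (\<lambda>j. ennreal ((cmod (f n x - f (r j) x))\<^sup>2)) \<partial>M)"
    proof (rule nn_integral_cong_AE)
      show "AE x in M. ennreal ((cmod (f n x - g x))\<^sup>2) = liminf (\<lambda>j. ennreal ((cmod (f n x - f (r j) x))\<^sup>2))"
        using lim
      proof eventually_elim
        fix x assume "(\<lambda>k. f (r k) x) \<longlonglongrightarrow> g x"
        then have "(\<lambda>j. ennreal ((cmod (f n x - f (r j) x))\<^sup>2)) \<longlonglongrightarrow> ennreal ((cmod (f n x - g x))\<^sup>2)"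
          by (intro tendsto_intros tendsto_ennrealI)
        then show "ennreal ((cmod (f n x - g x))\<^sup>2) = liminf (\<lambda>j. ennreal ((cmod (f n x - f (r j) x))\<^sup>2))"
          by (intro lim_imp_Liminf[symmetric]) simp_all
      qed
    qed
    also have "\<dots> \<le> liminf (\<lambda>j. d n (r j))"
      unfolding d_def by (rule nn_integral_liminf) simp
    also have "\<dots> \<le> ennreal ((1/8) ^ k)"
    proof (rule Liminf_le, simp)
      have "\<forall>\<^sub>F j in sequentially. j \<ge> k" by (rule eventually_ge_at_top)
      then show "\<forall>\<^sub>F j in sequentially. d n (r j) \<le> ennreal ((1/8) ^ k)"
      proof eventually_elim
        fix j assume "k \<le> j"
        then have "N k \<le> r j" unfolding r_def by (intro Max_ge) auto
        with that show "d n (r j) \<le> ennreal ((1/8) ^ k)" by (intro N)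
      qed
    qed
    finally show ?thesis .
  qed
  have "(\<lambda>n. L2_gap M (f n) g) \<longlonglongrightarrow> 0"
  proof (rule order_tendstoI)
    fix e :: ennreal assume e: "0 < e"
    have "(\<lambda>k. ennreal ((1/8) ^ k)) \<longlonglongrightarrow> ennreal 0"
      by (intro tendsto_ennrealI LIMSEQ_power_zero) auto
    then have "\<forall>\<^sub>F k in sequentially. ennreal ((1/8) ^ k) < e"
      using e by (intro order_tendstoD) auto
    then obtain k where k: "ennreal ((1/8) ^ k) < e"
      by (auto simp: eventually_sequentially)
    show "\<forall>\<^sub>F n in sequentially. (L2_gap M (f n) g) < e"
      using eventually_ge_at_top[of "N k"]
      by eventually_elim (use bound k in \<open>blast intro: le_less_trans\<close>)
  qed simp
  then show thesis using that \<open>g \<in> borel_measurable M\<close> by blast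
qed

lemma integral_cmod_sq_Cauchy_Schwarz:
  fixes f g :: "'a \<Rightarrow> complex"
  assumes [measurable]: "f \<in> borel_measurable M" "g \<in> borel_measurable M"
    and "integrable M (\<lambda>x. (cmod (f x))\<^sup>2)" "integrable M (\<lambda>x. (cmod (g x))\<^sup>2)"
  shows "integrable M (\<lambda>x. f x * g x)"
    and "(cmod (\<integral>x. f x * g x \<partial>M))\<^sup>2 \<le> sq_norm M f * sq_norm M g"
proof -
  have "integrable M (\<lambda>x. (cmod (f x))\<^sup>2 + (cmod (g x))\<^sup>2)"
    using assms by auto
  then show int: "integrable M (\<lambda>x. f x * g x)"
  proof (rule Bochner_Integration.integrable_bound, measurable, intro AE_I2)
    fix x
    have "2 * cmod (f x) * cmod (g x) \<le> (cmod (f x))\<^sup>2 + (cmod (g x))\<^sup>2"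
      by (rule sum_squares_bound)
    moreover have "0 \<le> cmod (f x) * cmod (g x)" by simp
    ultimately have "cmod (f x) * cmod (g x) \<le> (cmod (f x))\<^sup>2 + (cmod (g x))\<^sup>2" by linarith
    then show "norm (f x * g x) \<le> norm ((cmod (f x))\<^sup>2 + (cmod (g x))\<^sup>2)"
      by (simp add: norm_mult)
  qed
  have "ennreal ((cmod (\<integral>x. f x * g x \<partial>M))\<^sup>2) \<le> (\<integral>\<^sup>+x. ennreal (cmod (f x)) * ennreal (cmod (g x)) \<partial>M)\<^sup>2"
    using integral_norm_bound_ennreal[OF int]
    by (simp add: ennreal_power[symmetric] norm_mult ennreal_mult power_mono)
  also have "\<dots> \<le> (\<integral>\<^sup>+x. (ennreal (cmod (f x)))\<^sup>2 \<partial>M) * (\<integral>\<^sup>+x. (ennreal (cmod (g x)))\<^sup>2 \<partial>M)"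
    by (rule Cauchy_Schwarz_nn_integral) auto
  also have "\<dots> = ennreal (sq_norm M f) * ennreal (sq_norm M g)"
    using assms by (simp add: ennreal_power nn_integral_eq_integral)
  finally show "(cmod (\<integral>x. f x * g x \<partial>M))\<^sup>2 \<le> sq_norm M f * sq_norm M g"
    by (simp add: ennreal_mult[symmetric])
qed

text \<open>Cauchy criterion for the net of finite partial sums: two of them differ by a sum over a
  set difference, which the tail of \<open>w\<close> controls. It serves orthonormal series and
  Riesz synthesis alike.\<close>

lemma summable_on_norm_sq_bound:
  fixes x :: "'i \<Rightarrow> 'a :: {real_normed_vector, complete_space}"
  assumes bound: "\<And>F. finite F \<Longrightarrow> F \<subseteq> I \<Longrightarrow> (norm (\<Sum>i\<in>F. x i))\<^sup>2 \<le> (\<Sum>i\<in>F. w i)"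
    and w: "w summable_on I"
  shows "x summable_on I"
proof -
  have "\<exists>P. eventually P (finite_subsets_at_top I) \<and>
      (\<forall>F F'. P F \<and> P F' \<longrightarrow> dist (sum x F) (sum x F') < e)" if "e > 0" for e
  proof -
    obtain L where L: "(sum w \<longlongrightarrow> L) (finite_subsets_at_top I)"
      using w unfolding summable_on_def has_sum_def by blast
    \<comment> \<open>Two sums within \<open>d\<close> of the limit differ by less than 2 d = e^2/8,
      which is below (e/2)^2.\<close>
    define d where "d = e\<^sup>2 / 16"
    have d: "d > 0" using that by (simp add: d_def)
    have "\<forall>\<^sub>F F in finite_subsets_at_top I. dist (sum w F) L < d"
      using L d by (simp add: tendsto_iff)
    then obtain F0 where F0: "finite F0" "F0 \<subseteq> I"
      and F0d: "\<And>F. finite F \<Longrightarrow> F0 \<subseteq> F \<Longrightarrow> F \<subseteq> I \<Longrightarrow> dist (sum w F) L < d"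
      unfolding eventually_finite_subsets_at_top by metis
    have close: "dist (sum x F) (sum x F0) < e / 2" if F: "finite F" "F0 \<subseteq> F" "F \<subseteq> I" for F
    proof -
      have "(dist (sum x F) (sum x F0))\<^sup>2 = (norm (sum x (F - F0)))\<^sup>2"
        using F by (simp add: dist_norm sum_diff)
      also have "\<dots> \<le> sum w (F - F0)"
        using F by (intro bound) auto
      also have "\<dots> = sum w F - sum w F0"
        using F by (simp add: sum_diff)
      also have "\<dots> < 2 * d"
        using F0d[OF F] F0d[OF F0(1) order_refl F0(2)] by (simp add: dist_real_def)
      also have "\<dots> \<le> (e / 2)\<^sup>2"
        by (simp add: d_def power2_eq_square)
      finally show ?thesis
        by (rule power2_less_imp_less) (use \<open>e > 0\<close> in simp)
    qed
    show ?thesis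
    proof (intro exI[of _ "\<lambda>F. finite F \<and> F0 \<subseteq> F \<and> F \<subseteq> I"] conjI allI impI)
      show "\<forall>\<^sub>F F in finite_subsets_at_top I. finite F \<and> F0 \<subseteq> F \<and> F \<subseteq> I"
        using F0 unfolding eventually_finite_subsets_at_top by blast
      show "dist (sum x F) (sum x F') < e"
        if "(finite F \<and> F0 \<subseteq> F \<and> F \<subseteq> I) \<and> (finite F' \<and> F0 \<subseteq> F' \<and> F' \<subseteq> I)" for F F'
        using close[of F] close[of F'] that dist_triangle2[of "sum x F" "sum x F'" "sum x F0"] by auto
    qed
  qed
  then have "cauchy_filter (filtermap (sum x) (finite_subsets_at_top I))"
    by (simp add: cauchy_filter_metric_filtermap)
  moreover have "complete (UNIV :: 'a set)"
    by (meson Cauchy_convergent UNIV_I complete_def convergent_def)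
  ultimately obtain L' where "(sum x \<longlongrightarrow> L') (finite_subsets_at_top I)"
    using complete_uniform[where S=UNIV] by (force simp add: filterlim_def)
  then show ?thesis
    using summable_on_def has_sum_def by blast
qed

section \<open>Complex inner product spaces\<close>

text \<open>The class \<open>real_inner\<close> supplies the topology; the complex structure is
  added as parameters tied to it by \<open>Re_ip\<close>. Both \<open>l2\<close> and the later type
  \<open>hs\<close> are instances, so Hilbert space arguments are made once.\<close>

locale complex_inner_space =
  fixes sc :: "complex \<Rightarrow> 'a :: real_inner \<Rightarrow> 'a" and ip :: "'a \<Rightarrow> 'a \<Rightarrow> complex"
  assumes Re_ip: "Re (ip x y) = inner x y"
    and ip_sc_left: "ip (sc a x) y = a * ip x y"
    and ip_cnj: "cnj (ip x y) = ip y x"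
begin

lemma ip_sc_right: "ip x (sc a y) = cnj a * ip x y"
  by (metis complex_cnj_mult ip_cnj ip_sc_left)

text \<open>The imaginary part is the real inner product with a rotated second argument. Additivity
  of \<open>ip\<close> is thereby inherited from \<open>inner\<close> instead of being
  assumed.\<close>

lemma ip_eq: "ip x y = Complex (inner x y) (inner x (sc \<i> y))"
  by (simp add: complex_eq_iff Re_ip[symmetric] ip_sc_right)

lemma ip_add_left: "ip (x + y) z = ip x z + ip y z"
  by (simp add: ip_eq complex_eq_iff inner_add_left)

lemma ip_add_right: "ip x (y + z) = ip x y + ip x z"
  by (metis complex_cnj_add ip_cnj ip_add_left)

lemma ip_scaleR_left: "ip (r *\<^sub>R x) z = of_real r * ip x z"
  by (simp add: ip_eq complex_eq_iff)

lemma ip_diff_left: "ip (x - y) z = ip x z - ip y z"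
  by (simp add: ip_eq complex_eq_iff inner_diff_left)

lemma ip_zero_left [simp]: "ip 0 z = 0"
  by (simp add: ip_eq complex_eq_iff)

lemma ip_zero_right [simp]: "ip z 0 = 0"
  by (metis complex_cnj_zero ip_cnj ip_zero_left)

lemma ip_sum_left: "ip (\<Sum>i\<in>F. f i) z = (\<Sum>i\<in>F. ip (f i) z)"
  by (induction F rule: infinite_finite_induct) (auto simp: ip_add_left)

lemma ip_sum_right: "ip z (\<Sum>i\<in>F. f i) = (\<Sum>i\<in>F. ip z (f i))"
  by (induction F rule: infinite_finite_induct) (auto simp: ip_add_right)

lemma ip_self: "ip x x = of_real ((norm x)\<^sup>2)"
proof -
  have "Im (ip x x) = 0"
    using ip_cnj[of x x] by (simp add: complex_eq_iff)
  then show ?thesis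
    by (simp add: complex_eq_iff Re_ip power2_norm_eq_inner del: of_real_power)
qed

lemma ip_eqI: "(\<And>z. ip x z = ip y z) \<Longrightarrow> x = y"
  using ip_self[of "x - y"] by (simp add: ip_diff_left)

lemma ip_eqI_right: "(\<And>z. ip z x = ip z y) \<Longrightarrow> x = y"
  by (rule ip_eqI) (metis ip_cnj)

text \<open>Vector space laws for \<open>sc\<close> are consequences: both sides have the same inner
  product with every vector.\<close>

lemma sc_add_right: "sc a (x + y) = sc a x + sc a y"
  and sc_add_left: "sc (a + b) x = sc a x + sc b x"
  and sc_diff_left: "sc (a - b) x = sc a x - sc b x"
  and sc_sc: "sc a (sc b x) = sc (a * b) x"
  and sc_one: "sc 1 x = x"
  and sc_zero_left: "sc 0 x = 0"
  and sc_zero_right: "sc a 0 = 0"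
  and sc_of_real: "sc (of_real r) x = r *\<^sub>R x"
  by (rule ip_eqI; simp add: ip_add_left ip_diff_left ip_sc_left ip_scaleR_left algebra_simps)+

lemma norm_sc: "norm (sc a x) = cmod a * norm x"
proof -
  have "complex_of_real ((norm (sc a x))\<^sup>2) = (a * cnj a) * ip x x"
    by (simp only: ip_self[symmetric] ip_sc_left ip_sc_right mult_ac)
  also have "\<dots> = of_real ((cmod a)\<^sup>2) * of_real ((norm x)\<^sup>2)"
    by (simp only: ip_self complex_norm_square)
  also have "\<dots> = of_real ((cmod a * norm x)\<^sup>2)"
    by (simp only: power_mult_distrib of_real_mult)
  finally have "(norm (sc a x))\<^sup>2 = (cmod a * norm x)\<^sup>2"
    by (simp only: of_real_eq_iff)
  then show ?thesis by (rule power2_eq_imp_eq) auto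
qed

lemma bounded_linear_sc: "bounded_linear (sc a)"
proof (rule bounded_linear_intro[where K = "cmod a"])
  show "sc a (r *\<^sub>R x) = r *\<^sub>R sc a x" for r x
    by (simp add: sc_of_real[symmetric] sc_sc mult.commute)
qed (auto simp: sc_add_right norm_sc)

lemma cmod_ip_le: "cmod (ip x y) \<le> norm x * norm y"
proof (cases "ip x y = 0")
  case False
  \<comment> \<open>Rotating \<open>x\<close> by this phase makes the inner product real and
    nonnegative, so the real Cauchy-Schwarz inequality applies.\<close>
  define u where "u = sgn (ip x y)"
  have u: "cmod u = 1" using False by (simp add: u_def norm_sgn)
  have "cmod (ip x y) = Re (cnj u * ip x y)"
    using False
    by (simp add: u_def sgn_eq mult.commute complex_norm_square[symmetric] power2_eq_square
        flip: of_real_mult of_real_divide)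
  also have "\<dots> = inner (sc (cnj u) x) y"
    by (simp only: Re_ip[symmetric] ip_sc_left)
  also have "\<dots> \<le> norm (sc (cnj u) x) * norm y"
    by (rule norm_cauchy_schwarz)
  finally show ?thesis using u by (simp add: norm_sc)
qed simp

lemma bounded_linear_ip_left: "bounded_linear (\<lambda>x. ip x z)"
  by (rule bounded_linear_intro[where K = "norm z"])
    (auto simp: ip_add_left ip_scaleR_left scaleR_conv_of_real cmod_ip_le)

definition orthonormal :: "('i \<Rightarrow> 'a) \<Rightarrow> 'i set \<Rightarrow> bool" where
  "orthonormal e I \<longleftrightarrow> (\<forall>i\<in>I. \<forall>j\<in>I. ip (e i) (e j) = (if i = j then 1 else 0))"

lemma ip_orthonormal_sum:
  assumes "orthonormal e I" "finite F" "F \<subseteq> I" "j \<in> I"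
  shows "ip (\<Sum>i\<in>F. sc (c i) (e i)) (e j) = (if j \<in> F then c j else 0)"
proof -
  have "ip (\<Sum>i\<in>F. sc (c i) (e i)) (e j) = (\<Sum>i\<in>F. c i * ip (e i) (e j))"
    by (simp add: ip_sum_left ip_sc_left)
  also have "\<dots> = (\<Sum>i\<in>F. if i = j then c i else 0)"
    using assms by (intro sum.cong refl) (auto simp: orthonormal_def)
  finally show ?thesis using assms by simp
qed

lemma norm_orthonormal_sum:
  assumes "orthonormal e I" "finite F" "F \<subseteq> I"
  shows "(norm (\<Sum>i\<in>F. sc (c i) (e i)))\<^sup>2 = sq_sum c F"
proof -
  have "complex_of_real ((norm (\<Sum>i\<in>F. sc (c i) (e i)))\<^sup>2)
      = (\<Sum>j\<in>F. ip (\<Sum>i\<in>F. sc (c i) (e i)) (sc (c j) (e j)))"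
    by (simp only: ip_self[symmetric] ip_sum_right)
  also have "\<dots> = (\<Sum>j\<in>F. cnj (c j) * c j)"
    using assms by (intro sum.cong refl) (auto simp: ip_sc_right ip_orthonormal_sum[OF assms])
  also have "\<dots> = of_real (sq_sum c F)"
    by (simp add: complex_norm_square mult.commute del: of_real_power)
  finally show ?thesis by (simp only: of_real_eq_iff)
qed

lemma Bessel_finite:
  assumes "orthonormal e I" "finite F" "F \<subseteq> I"
  shows "(\<Sum>i\<in>F. (cmod (ip x (e i)))\<^sup>2) \<le> (norm x)\<^sup>2"
proof -
  define p where "p = (\<Sum>i\<in>F. sc (ip x (e i)) (e i))"
  have "ip x p = of_real (\<Sum>i\<in>F. (cmod (ip x (e i)))\<^sup>2)"
    by (simp add: p_def ip_sum_right ip_sc_right complex_norm_square mult.commute del: of_real_power)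
  then have "inner x p = (\<Sum>i\<in>F. (cmod (ip x (e i)))\<^sup>2)"
    by (simp only: Re_ip[symmetric] Re_complex_of_real)
  moreover have "(norm p)\<^sup>2 = (\<Sum>i\<in>F. (cmod (ip x (e i)))\<^sup>2)"
    unfolding p_def by (rule norm_orthonormal_sum[OF assms])
  moreover have "0 \<le> (norm (x - p))\<^sup>2" by simp
  ultimately show ?thesis
    by (simp add: power2_norm_eq_inner inner_diff_left inner_diff_right inner_commute)
qed

lemma Bessel_summable:
  assumes "orthonormal e I"
  shows "(\<lambda>i. (cmod (ip x (e i)))\<^sup>2) summable_on I"
  using Bessel_finite[OF assms, of _ x]
  by (intro nonneg_bdd_above_summable_on) (auto intro!: bdd_aboveI[of _ "(norm x)\<^sup>2"])

text \<open>Zorn's lemma: a nonzero vector orthogonal to a maximal orthonormal set could be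
  normalised and added to it. This supplies the basis that the choice inside \<open>trace\<close>
  requires.\<close>

lemma maximal_orthonormal_set_exists:
  "\<exists>E. orthonormal (\<lambda>e. e) E \<and> (\<forall>x. (\<forall>e\<in>E. ip x e = 0) \<longrightarrow> x = 0)"
proof -
  have "\<exists>E\<in>{E. orthonormal (\<lambda>e. e) E}. \<forall>X\<in>{E. orthonormal (\<lambda>e. e) E}. E \<subseteq> X \<longrightarrow> X = E"
  proof (rule subset_Zorn')
    fix C assume C: "subset.chain {E. orthonormal (\<lambda>e. e) E} C"
    have "ip x y = (if x = y then 1 else 0)" if "x \<in> \<Union>C" "y \<in> \<Union>C" for x y
    proof -
      from that obtain X Y where "X \<in> C" "Y \<in> C" "x \<in> X" "y \<in> Y" by blast
      moreover have "X \<subseteq> Y \<or> Y \<subseteq> X"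
        using C \<open>X \<in> C\<close> \<open>Y \<in> C\<close> by (auto simp: subset_chain_def)
      ultimately obtain Z where "Z \<in> C" "x \<in> Z" "y \<in> Z" by blast
      moreover have "orthonormal (\<lambda>e. e) Z"
        using C \<open>Z \<in> C\<close> by (auto simp: subset_chain_def)
      ultimately show ?thesis by (simp add: orthonormal_def)
    qed
    then show "\<Union>C \<in> {E. orthonormal (\<lambda>e. e) E}" by (simp add: orthonormal_def)
  qed
  then obtain E where E: "orthonormal (\<lambda>e. e) E"
    and max: "\<And>X. orthonormal (\<lambda>e. e) X \<Longrightarrow> E \<subseteq> X \<Longrightarrow> X = E"
    by blast
  have "x = 0" if x: "\<forall>e\<in>E. ip x e = 0" for x
  proof (rule ccontr)
    assume "x \<noteq> 0"
    define u where "u = sc (of_real (inverse (norm x))) x"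
    have u: "ip u u = 1"
      using \<open>x \<noteq> 0\<close> by (simp add: u_def ip_self norm_sc norm_inverse)
    have ue: "ip u e = 0" if "e \<in> E" for e
      using x that by (simp add: u_def ip_sc_left)
    moreover have "ip e u = 0" if "e \<in> E" for e
      using ue[OF that] ip_cnj[of u e] by simp
    ultimately have "orthonormal (\<lambda>e. e) (insert u E)"
      using E u by (auto simp: orthonormal_def)
    then have "insert u E = E" by (rule max) auto
    then have "u \<in> E" by blast
    from ue[OF this] u show False by simp
  qed
  with E show ?thesis by blast
qed

end

locale complex_hilbert_space = complex_inner_space sc ip
  for sc :: "complex \<Rightarrow> 'a :: {real_inner, complete_space} \<Rightarrow> 'a" and ip
begin

lemma orthonormal_series:
  assumes e: "orthonormal e I" and c: "(\<lambda>i. (cmod (c i))\<^sup>2) summable_on I"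
  shows "(\<lambda>i. sc (c i) (e i)) summable_on I"
    and "j \<in> I \<Longrightarrow> ip (\<Sum>\<^sub>\<infinity>i\<in>I. sc (c i) (e i)) (e j) = c j"
proof -
  show sum: "(\<lambda>i. sc (c i) (e i)) summable_on I"
    by (rule summable_on_norm_sq_bound[OF _ c]) (simp add: norm_orthonormal_sum[OF e])
  assume j: "j \<in> I"
  have "((\<lambda>i. ip (sc (c i) (e i)) (e j)) has_sum ip (\<Sum>\<^sub>\<infinity>i\<in>I. sc (c i) (e i)) (e j)) I"
    using has_sum_bounded_linear[OF bounded_linear_ip_left has_sum_infsum[OF sum]] by (simp add: o_def)
  moreover have "((\<lambda>i. ip (sc (c i) (e i)) (e j)) has_sum c j) I"
  proof (rule has_sum_finite_neutralI[of "{j}"])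
    show "ip (sc (c i) (e i)) (e j) = 0" if "i \<in> I - {j}" for i
      using that e j by (auto simp: ip_sc_left orthonormal_def)
    show "c j = (\<Sum>i\<in>{j}. ip (sc (c i) (e i)) (e j))"
      using e j by (simp add: ip_sc_left orthonormal_def)
  qed (use j in auto)
  ultimately show "ip (\<Sum>\<^sub>\<infinity>i\<in>I. sc (c i) (e i)) (e j) = c j"
    by (rule has_sum_unique)
qed

context
  fixes e :: "'i \<Rightarrow> 'a" and I
  assumes e: "orthonormal e I" and total: "\<And>x. (\<And>i. i \<in> I \<Longrightarrow> ip x (e i) = 0) \<Longrightarrow> x = 0"
begin

text \<open>The Fourier series of \<open>x\<close> converges by Bessel, and its difference from
  \<open>x\<close> is orthogonal to the whole system, hence zero by totality.\<close>

lemma orthonormal_expansion: "((\<lambda>i. sc (ip x (e i)) (e i)) has_sum x) I"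
proof -
  note series = orthonormal_series[OF e Bessel_summable[OF e, of x]]
  have "x - (\<Sum>\<^sub>\<infinity>i\<in>I. sc (ip x (e i)) (e i)) = 0"
    by (rule total) (simp add: ip_diff_left series(2))
  then show ?thesis
    using has_sum_infsum[OF series(1)] by simp
qed

lemma Parseval_ip: "((\<lambda>i. ip x (e i) * ip (e i) y) has_sum ip x y) I"
  using has_sum_bounded_linear[OF bounded_linear_ip_left[of y] orthonormal_expansion[of x]]
  by (simp add: o_def ip_sc_left)

lemma Parseval: "((\<lambda>i. (cmod (ip x (e i)))\<^sup>2) has_sum (norm x)\<^sup>2) I"
proof -
  have "((\<lambda>i. complex_of_real ((cmod (ip x (e i)))\<^sup>2)) has_sum complex_of_real ((norm x)\<^sup>2)) I"
    using Parseval_ip[of x x]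
    by (simp only: ip_self complex_norm_square ip_cnj)
  then show ?thesis by (simp only: has_sum_of_real_iff)
qed

text \<open>The vector \<open>B y\<close> is assembled from its prospective coordinates, the numbers
  \<open>ip y (A (e i))\<close>. The real content is that these are square summable.\<close>

lemma adjoint_exists:
  assumes A: "bounded_linear A" and A_sc: "\<And>c x. A (sc c x) = sc c (A x)"
  shows "\<exists>B. \<forall>x y. ip (A x) y = ip x (B y)"
proof -
  obtain K where K: "K > 0" "\<And>x. norm (A x) \<le> norm x * K"
    using bounded_linear.pos_bounded[OF A] by blast
  have summable: "(\<lambda>i. (cmod (ip y (A (e i))))\<^sup>2) summable_on I" for y
  proof (intro nonneg_bdd_above_summable_on bdd_aboveI[of _ "(K * norm y)\<^sup>2"], simp, clarify)
    fix F assume F: "F \<subseteq> I" "finite F"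
    define S where "S = (\<Sum>i\<in>F. (cmod (ip y (A (e i))))\<^sup>2)"
    \<comment> \<open>A partial sum of the prospective \<open>B y\<close>. Pairing \<open>y\<close>
      with \<open>A p\<close> returns \<open>S\<close>, while \<open>p\<close> has norm sqrt S;
      boundedness of \<open>A\<close> gives S \<le> K norm(y) sqrt S, and cancelling one root leaves
      a bound independent of \<open>F\<close>.\<close>
    define p where "p = (\<Sum>i\<in>F. sc (ip y (A (e i))) (e i))"
    have S: "0 \<le> S" by (simp add: S_def sum_nonneg)
    have "A p = (\<Sum>i\<in>F. sc (ip y (A (e i))) (A (e i)))"
      by (simp add: p_def bounded_linear.linear[OF A] linear_sum A_sc)
    then have "ip y (A p) = of_real S"
      by (simp add: S_def ip_sum_right ip_sc_right complex_norm_square mult.commute del: of_real_power)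
    then have "S \<le> norm y * norm (A p)"
      using cmod_ip_le[of y "A p"] S by simp
    also have "\<dots> \<le> norm y * (norm p * K)"
      by (intro mult_left_mono K) auto
    also have "norm p = sqrt S"
      unfolding S_def p_def by (simp add: norm_orthonormal_sum[OF e F(2,1), symmetric])
    finally have "S \<le> K * norm y * sqrt S" by (simp add: mult_ac)
    moreover have "S = sqrt S * sqrt S" using S by simp
    ultimately have "sqrt S * sqrt S \<le> K * norm y * sqrt S"
      by metis
    then have "sqrt S \<le> K * norm y" if "S \<noteq> 0"
      by (rule mult_right_le_imp_le) (use S that in simp)
    then have "sqrt S \<le> K * norm y"
      using K(1) by (cases "S = 0") auto
    then have "(sqrt S)\<^sup>2 \<le> (K * norm y)\<^sup>2"
      by (intro power_mono) (auto simp: S)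
    then show "(\<Sum>i\<in>F. (cmod (ip y (A (e i))))\<^sup>2) \<le> (K * norm y)\<^sup>2"
      using S unfolding S_def[symmetric] by simp
  qed
  define B where "B y = (\<Sum>\<^sub>\<infinity>i\<in>I. sc (ip y (A (e i))) (e i))" for y
  have B: "ip (B y) (e i) = ip y (A (e i))" if "i \<in> I" for i y
    unfolding B_def using orthonormal_series(2)[OF e summable that] .
  have "ip (A x) y = ip x (B y)" for x y
  proof -
    have "((\<lambda>i. ip (A (sc (ip x (e i)) (e i))) y) has_sum ip (A x) y) I"
      using has_sum_bounded_linear[OF bounded_linear_ip_left has_sum_bounded_linear[OF A orthonormal_expansion]]
      by (simp add: o_def)
    then have "((\<lambda>i. ip x (e i) * ip (A (e i)) y) has_sum ip (A x) y) I"
      by (simp add: A_sc ip_sc_left)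
    moreover have "((\<lambda>i. ip x (e i) * ip (A (e i)) y) has_sum ip x (B y)) I"
    proof (subst has_sum_cong)
      show "ip x (e i) * ip (A (e i)) y = ip x (e i) * ip (e i) (B y)" if "i \<in> I" for i
        using B[OF that, of y] ip_cnj by metis
    qed (rule Parseval_ip)
    ultimately show ?thesis by (rule has_sum_unique)
  qed
  then show ?thesis by blast
qed

end

end

section \<open>The space of square-integrable functions is complete\<close>

interpretation l2: complex_inner_space "scaleC :: complex \<Rightarrow> 'n::finite l2 \<Rightarrow> 'n l2" cinner
proof
  fix x y :: "'n l2" and a
  show "Re (cinner x y) = inner x y" by (simp add: inner_l2_def)
  show "cinner (a *\<^sub>C x) y = a * cinner x y"
    by transfer (simp add: mult.assoc)
  show "cnj (cinner x y) = cinner y x"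
  proof transfer
    fix f g :: "real ^ 'n \<Rightarrow> complex"
    have "cnj (\<integral>t. f t * cnj (g t) \<partial>lborel) = (\<integral>t. cnj (f t * cnj (g t)) \<partial>lborel)"
      by (rule Bochner_Integration.integral_cnj[symmetric])
    then show "cnj (\<integral>t. f t * cnj (g t) \<partial>lborel) = (\<integral>t. g t * cnj (f t) \<partial>lborel)"
      by (simp add: mult.commute)
  qed
qed

text \<open>Carries Cauchy sequences of classes over to representatives, where
  \<open>L2_Cauchy_limit\<close> applies.\<close>

lemma dist_abs_l2:
  assumes "square_integrable f" "square_integrable g"
  shows "ennreal ((dist (abs_l2 f) (abs_l2 g))\<^sup>2) = L2_gap lborel f g"
proof -
  have fg: "ae_equal f f" "ae_equal g g" "ae_equal (\<lambda>t. f t - g t) (\<lambda>t. f t - g t)"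
    using assms square_integrable_diff by (auto simp: ae_equal_def)
  have "complex_of_real ((dist (abs_l2 f) (abs_l2 g))\<^sup>2) = cinner (abs_l2 f - abs_l2 g) (abs_l2 f - abs_l2 g)"
    by (simp only: dist_norm l2.ip_self)
  also have "\<dots> = (\<integral>t. (f t - g t) * cnj (f t - g t) \<partial>lborel)"
    using fg by (simp add: minus_l2.abs_eq cinner.abs_eq)
  also have "\<dots> = complex_of_real (\<integral>t. (cmod (f t - g t))\<^sup>2 \<partial>lborel)"
    by (simp only: complex_norm_square[symmetric] integral_complex_of_real)
  finally have "(dist (abs_l2 f) (abs_l2 g))\<^sup>2 = (\<integral>t. (cmod (f t - g t))\<^sup>2 \<partial>lborel)"
    by (simp only: of_real_eq_iff)
  then show ?thesis
    using square_integrable_diff[OF assms] by (simp add: nn_integral_eq_integral square_integrable_def)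
qed

instance l2 :: (finite) complete_space
proof
  fix X :: "nat \<Rightarrow> 'a l2"
  assume X: "Cauchy X"
  define f where "f n = rep_l2 (X n)" for n
  have Xf: "X n = abs_l2 (f n)" for n
    by (simp add: f_def Quotient_abs_rep[OF Quotient_l2])
  have f: "square_integrable (f n)" for n
    using Quotient_rep_reflp[OF Quotient_l2, of "X n"] by (simp add: f_def ae_equal_def)
  have [measurable]: "f n \<in> borel_measurable lborel" for n
    using f[of n] by (simp add: square_integrable_def)
  obtain g where [measurable]: "g \<in> borel_measurable lborel"
    and lim: "(\<lambda>n. L2_gap lborel (f n) g) \<longlonglongrightarrow> 0"
  proof (rule L2_Cauchy_limit[of f lborel])
    fix e :: real assume "e > 0"
    then obtain N where N: "\<And>m n. m \<ge> N \<Longrightarrow> n \<ge> N \<Longrightarrow> dist (X m) (X n) < sqrt e"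
      using X unfolding Cauchy_def by (metis real_sqrt_gt_0_iff)
    show "\<exists>N. \<forall>m\<ge>N. \<forall>n\<ge>N. (L2_gap lborel (f m) (f n)) \<le> ennreal e"
    proof (intro exI[of _ N] allI impI)
      fix m n assume "m \<ge> N" "n \<ge> N"
      then have "(dist (X m) (X n))\<^sup>2 \<le> (sqrt e)\<^sup>2"
        by (intro power_mono less_imp_le[OF N]) auto
      then show "L2_gap lborel (f m) (f n) \<le> ennreal e"
        using \<open>e > 0\<close> unfolding Xf by (simp add: dist_abs_l2[OF f f, symmetric] ennreal_leI)
    qed
  qed auto
  have "\<forall>\<^sub>F n in sequentially. (L2_gap lborel (f n) g) < 1"
    using lim by (rule order_tendstoD) simp
  then obtain N where N: "L2_gap lborel (f N) g < 1"
    by (auto simp: eventually_sequentially)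
  have "square_integrable (\<lambda>t. f N t - g t)"
    unfolding square_integrable_def
    by (intro conjI integrableI_bounded) (use N in \<open>auto intro: less_trans\<close>)
  then have g: "square_integrable g"
    using square_integrable_diff[OF f[of N], of "\<lambda>t. f N t - g t"] by simp
  have "(\<lambda>n. ennreal ((dist (X n) (abs_l2 g))\<^sup>2)) \<longlonglongrightarrow> ennreal 0"
    using lim unfolding Xf by (simp add: dist_abs_l2[OF f g])
  then have "(\<lambda>n. (dist (X n) (abs_l2 g))\<^sup>2) \<longlonglongrightarrow> 0"
    by (subst (asm) tendsto_ennreal_iff) auto
  then have "(\<lambda>n. sqrt ((dist (X n) (abs_l2 g))\<^sup>2)) \<longlonglongrightarrow> sqrt 0"
    by (rule tendsto_real_sqrt)
  then have "(\<lambda>n. dist (X n) (abs_l2 g)) \<longlonglongrightarrow> 0"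
    by simp
  then have "X \<longlonglongrightarrow> abs_l2 g"
    by (rule iffD2[OF tendsto_dist_iff])
  then show "convergent X" by (auto simp: convergent_def)
qed

interpretation l2: complex_hilbert_space "scaleC :: complex \<Rightarrow> 'n::finite l2 \<Rightarrow> 'n l2" cinner ..

lemma orthonormal_basis_iff:
  "orthonormal_basis E \<longleftrightarrow> l2.orthonormal (\<lambda>e. e) E \<and> (\<forall>f. (\<forall>e\<in>E. cinner f e = 0) \<longrightarrow> f = 0)"
  by (simp add: orthonormal_basis_def l2.orthonormal_def)

lemma orthonormal_basis_exists: "\<exists>E :: 'n::finite l2 set. orthonormal_basis E"
  unfolding orthonormal_basis_iff by (rule l2.maximal_orthonormal_set_exists)

lemma l2_Parseval:
  assumes "orthonormal_basis E"
  shows "((\<lambda>e. (cmod (cinner f e))\<^sup>2) has_sum (norm f)\<^sup>2) E"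
  using assms by (intro l2.Parseval) (auto simp: orthonormal_basis_iff)

lemma l2_Parseval':
  assumes "orthonormal_basis E"
  shows "((\<lambda>e. (cmod (cinner e f))\<^sup>2) has_sum (norm f)\<^sup>2) E"
  using l2_Parseval[OF assms, of f] by (metis (no_types, lifting) has_sum_cong complex_mod_cnj l2.ip_cnj)

section \<open>Adjoints and Hilbert-Schmidt operators\<close>

text \<open>Shows that the definite description in \<open>adj\<close> denotes, which the definition
  alone does not ensure.\<close>

lemma bounded_operator_adj:
  fixes A :: "'n::finite operator"
  assumes "bounded_operator A"
  shows "cinner (A f) g = cinner f (adj A g)"
proof -
  obtain E :: "'n l2 set" where E: "orthonormal_basis E"
    using orthonormal_basis_exists by blast
  have "\<exists>B. \<forall>f g. cinner (A f) g = cinner f (B g)"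
    using E assms
    by (intro l2.adjoint_exists[of "\<lambda>e. e" E]) (auto simp: orthonormal_basis_iff bounded_operator_def)
  then have "\<exists>!B. \<forall>f g. cinner (A f) g = cinner f (B g)"
    by (intro ex_ex1I ext l2.ip_eqI_right) auto
  from theI'[OF this] show ?thesis
    unfolding adj_def by blast
qed

lemma adj_eqI:
  assumes "\<And>f g. cinner (A f) g = cinner f (B g)"
  shows "adj A = B"
  unfolding adj_def
proof (rule the_equality)
  show "B' = B" if "\<forall>f g. cinner (A f) g = cinner f (B' g)" for B'
    by (intro ext l2.ip_eqI_right) (metis assms that)
qed (use assms in blast)

lemma cinner_adj_left:
  assumes "bounded_operator A"
  shows "cinner (adj A f) g = cinner f (A g)"
  by (metis assms bounded_operator_adj l2.ip_cnj)

lemma bounded_operator_norm: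
  assumes "bounded_operator A"
  shows "\<exists>K\<ge>0. \<forall>f. norm (A f) \<le> K * norm f"
  using bounded_linear.nonneg_bounded[of A] assms by (auto simp: bounded_operator_def mult.commute)

lemma bounded_operatorI:
  assumes "\<And>f g. A (f + g) = A f + A g" "\<And>c f. A (c *\<^sub>C f) = c *\<^sub>C A f"
    and "\<And>f. norm (A f) \<le> K * norm f"
  shows "bounded_operator A"
  unfolding bounded_operator_def
  using assms by (auto intro!: bounded_linear_intro[where K = K] simp: scaleR_l2_def mult.commute)

lemma bounded_operator_simps:
  assumes "bounded_operator A"
  shows "A (f + g) = A f + A g" "A (f - g) = A f - A g" "A 0 = 0" "A (c *\<^sub>C f) = c *\<^sub>C A f"
  using assms linear_add[of A] linear_diff[of A] linear_0[of A]
  by (auto simp: bounded_operator_def bounded_linear.linear)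

lemma bounded_operator_adjoint:
  assumes A: "bounded_operator A"
  shows "bounded_operator (adj A)"
proof -
  obtain K where K: "K \<ge> 0" "\<And>f. norm (A f) \<le> K * norm f"
    using bounded_operator_norm[OF A] by blast
  show ?thesis
  proof (rule bounded_operatorI[where K = K])
    show "adj A (f + g) = adj A f + adj A g" for f g
      by (rule l2.ip_eqI_right) (simp add: bounded_operator_adj[OF A, symmetric] l2.ip_add_right)
    show "adj A (c *\<^sub>C f) = c *\<^sub>C adj A f" for c f
      by (rule l2.ip_eqI_right) (simp add: bounded_operator_adj[OF A, symmetric] l2.ip_sc_right)
    show "norm (adj A f) \<le> K * norm f" for f
    proof (cases "adj A f = 0")
      case False
      have "complex_of_real ((norm (adj A f))\<^sup>2) = cinner (A (adj A f)) f"
        by (simp only: l2.ip_self[symmetric] bounded_operator_adj[OF A, symmetric])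
      then have "(norm (adj A f))\<^sup>2 = cmod (cinner (A (adj A f)) f)"
        by (metis norm_of_real abs_of_nonneg zero_le_power2)
      also have "\<dots> \<le> norm (A (adj A f)) * norm f" by (rule l2.cmod_ip_le)
      also have "\<dots> \<le> (K * norm (adj A f)) * norm f"
        by (intro mult_right_mono K) auto
      finally have "norm (adj A f) * norm (adj A f) \<le> (K * norm f) * norm (adj A f)"
        by (simp add: power2_eq_square mult_ac)
      then show ?thesis
        by (rule mult_right_le_imp_le) (use False in simp)
    qed (use K in simp)
  qed
qed

lemma adj_adj:
  assumes "bounded_operator A"
  shows "adj (adj A) = A"
  by (rule adj_eqI) (rule cinner_adj_left[OF assms])

text \<open>Summing \<open>|\<langle>S e, f\<rangle>|\<^sup>2\<close> first over \<open>f\<close> or first over \<open>e\<close> gives the two sides.\<close>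

lemma hilbert_schmidt_swap:
  assumes S: "bounded_operator S" and E: "orthonormal_basis E" and E': "orthonormal_basis E'"
    and sum: "((\<lambda>e. (norm (S e))\<^sup>2) has_sum s) E"
  shows "((\<lambda>e. (norm (adj S e))\<^sup>2) has_sum s) E'"
proof -
  define k where "k = (\<lambda>(e, e'). (cmod (cinner (S e) e'))\<^sup>2)"
  have row: "((\<lambda>e'. k (e, e')) has_sum (norm (S e))\<^sup>2) E'" for e
    unfolding k_def using l2_Parseval[OF E', of "S e"] by simp
  have col: "((\<lambda>e. k (e, e')) has_sum (norm (adj S e'))\<^sup>2) E" for e'
    unfolding k_def using l2_Parseval'[OF E, of "adj S e'"] by (simp add: bounded_operator_adj[OF S])
  have "k summable_on (E \<times> E')"
    by (rule summable_on_SigmaI[OF row]) (use sum in \<open>auto simp: k_def has_sum_imp_summable\<close>)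
  then obtain t where t: "(k has_sum t) (E \<times> E')"
    by (auto simp: summable_on_def)
  have "((\<lambda>e. (norm (S e))\<^sup>2) has_sum t) E"
    by (rule has_sum_SigmaD[OF t]) (rule row)
  then have "t = s" using sum has_sum_unique by blast
  have "((\<lambda>(e', e). k (e, e')) has_sum t) (E' \<times> E)"
    using t by (subst has_sum_swap) simp
  then show ?thesis
    unfolding \<open>t = s\<close> by (rule has_sum_SigmaD) (use col in simp)
qed

lemma hs_bounded: "hilbert_schmidt S \<Longrightarrow> bounded_operator S"
  by (simp add: hilbert_schmidt_def)

text \<open>The definition gives summability over one unspecified basis. Swapping to the adjoint
  over \<open>E\<close>, and from there back to the operator over \<open>E\<close>, shows that the
  sum does not depend on the basis.\<close>

lemma hilbert_schmidt_has_sum: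
  assumes S: "hilbert_schmidt S" and E: "orthonormal_basis E"
  shows "((\<lambda>e. (norm (S e))\<^sup>2) has_sum (\<Sum>\<^sub>\<infinity>e\<in>E. (norm (S e))\<^sup>2)) E"
    and "((\<lambda>e. (norm (adj S e))\<^sup>2) has_sum (\<Sum>\<^sub>\<infinity>e\<in>E. (norm (S e))\<^sup>2)) E"
proof -
  obtain E0 s where E0: "orthonormal_basis E0" "((\<lambda>e. (norm (S e))\<^sup>2) has_sum s) E0"
    using S by (auto simp: hilbert_schmidt_def summable_on_def)
  note b = hs_bounded[OF S]
  have adj: "((\<lambda>e. (norm (adj S e))\<^sup>2) has_sum s) E"
    by (rule hilbert_schmidt_swap[OF b E0(1) E E0(2)])
  have "((\<lambda>e. (norm (adj (adj S) e))\<^sup>2) has_sum s) E"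
    by (rule hilbert_schmidt_swap[OF bounded_operator_adjoint[OF b] E E adj])
  then have "((\<lambda>e. (norm (S e))\<^sup>2) has_sum s) E" by (simp add: adj_adj[OF b])
  with adj show "((\<lambda>e. (norm (S e))\<^sup>2) has_sum (\<Sum>\<^sub>\<infinity>e\<in>E. (norm (S e))\<^sup>2)) E"
    and "((\<lambda>e. (norm (adj S e))\<^sup>2) has_sum (\<Sum>\<^sub>\<infinity>e\<in>E. (norm (S e))\<^sup>2)) E"
    by (simp_all add: infsumI)
qed

text \<open>The very basis chosen inside \<open>trace\<close>, named so that traces can be evaluated
  on it.\<close>

definition std_onb :: "'n::finite l2 set" where
  "std_onb = (SOME E. orthonormal_basis E)"

lemma std_onb_basis: "orthonormal_basis std_onb"
  unfolding std_onb_def by (rule someI_ex[OF orthonormal_basis_exists])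

text \<open>Moving \<open>S\<close> to the other side turns each diagonal entry of the trace into an
  inner product of adjoint images. The arithmetic-geometric mean inequality then gives absolute
  convergence.\<close>

lemma hs_inner_has_sum:
  assumes S: "hilbert_schmidt S" and T: "hilbert_schmidt T"
  shows "((\<lambda>e. cinner (adj T e) (adj S e)) has_sum hs_inner S T) std_onb"
proof -
  note b = hs_bounded[OF S]
  have "(\<lambda>e. (norm (adj T e))\<^sup>2 + (norm (adj S e))\<^sup>2) summable_on std_onb"
    using hilbert_schmidt_has_sum(2)[OF _ std_onb_basis] S T
    by (intro summable_on_add) (blast intro: has_sum_imp_summable)+
  then have "(\<lambda>e. norm (cinner (adj T e) (adj S e))) summable_on std_onb"
  proof (rule Infinite_Sum.abs_summable_on_comparison_test')
    fix e :: "'a l2"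
    have "norm (cinner (adj T e) (adj S e)) \<le> norm (adj T e) * norm (adj S e)"
      by (rule l2.cmod_ip_le)
    moreover have "2 * norm (adj T e) * norm (adj S e) \<le> (norm (adj T e))\<^sup>2 + (norm (adj S e))\<^sup>2"
      by (rule sum_squares_bound)
    moreover have "0 \<le> norm (adj T e) * norm (adj S e)" by simp
    ultimately show "norm (cinner (adj T e) (adj S e)) \<le> (norm (adj T e))\<^sup>2 + (norm (adj S e))\<^sup>2"
      by linarith
  qed
  then have "((\<lambda>e. cinner (adj T e) (adj S e)) has_sum (\<Sum>\<^sub>\<infinity>e\<in>std_onb. cinner (adj T e) (adj S e))) std_onb"
    by (rule has_sum_infsum[OF abs_summable_summable])
  then show ?thesis
    by (simp add: hs_inner_def trace_def std_onb_def[symmetric] bounded_operator_adj[OF b])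
qed

lemma hs_inner_self:
  assumes S: "hilbert_schmidt S" and E: "orthonormal_basis E"
  shows "hs_inner S S = of_real (\<Sum>\<^sub>\<infinity>e\<in>E. (norm (S e))\<^sup>2)"
proof -
  note b = hs_bounded[OF S] and sums = hilbert_schmidt_has_sum[OF S]
  have "((\<lambda>e. complex_of_real ((norm (adj S e))\<^sup>2))
      has_sum complex_of_real (\<Sum>\<^sub>\<infinity>e\<in>E. (norm (S e))\<^sup>2)) std_onb"
    using hilbert_schmidt_swap[OF b E std_onb_basis sums(1)[OF E]]
    by (simp only: has_sum_of_real_iff)
  then show ?thesis
    using hs_inner_has_sum[OF S S] by (simp only: l2.ip_self) (rule has_sum_unique)
qed

lemma hs_norm_has_sum:
  assumes S: "hilbert_schmidt S" and E: "orthonormal_basis E"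
  shows "((\<lambda>e. (norm (S e))\<^sup>2) has_sum (hs_norm S)\<^sup>2) E"
    and "((\<lambda>e. (norm (adj S e))\<^sup>2) has_sum (hs_norm S)\<^sup>2) E"
proof -
  have "(hs_norm S)\<^sup>2 = (\<Sum>\<^sub>\<infinity>e\<in>E. (norm (S e))\<^sup>2)"
    by (simp add: hs_norm_def hs_inner_self[OF assms] infsum_nonneg)
  then show "((\<lambda>e. (norm (S e))\<^sup>2) has_sum (hs_norm S)\<^sup>2) E"
    and "((\<lambda>e. (norm (adj S e))\<^sup>2) has_sum (hs_norm S)\<^sup>2) E"
    using hilbert_schmidt_has_sum[OF assms] by simp_all
qed

lemma hs_norm_nonneg: "hilbert_schmidt S \<Longrightarrow> hs_norm S \<ge> 0"
  by (simp add: hs_norm_def hs_inner_self[OF _ std_onb_basis] infsum_nonneg)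

text \<open>Expand \<open>S f\<close> in the basis, move \<open>S\<close> onto each basis vector as
  \<open>adj S e\<close>, and apply Cauchy-Schwarz term by term.\<close>

lemma norm_le_hs_norm:
  assumes S: "hilbert_schmidt S"
  shows "norm (S f) \<le> hs_norm S * norm f"
proof (rule power2_le_imp_le)
  note b = hs_bounded[OF S]
  have "((\<lambda>e. (cmod (cinner (S f) e))\<^sup>2) has_sum (norm (S f))\<^sup>2) std_onb"
    by (rule l2_Parseval[OF std_onb_basis])
  moreover have "((\<lambda>e. (norm (adj S e))\<^sup>2 * (norm f)\<^sup>2) has_sum ((hs_norm S)\<^sup>2 * (norm f)\<^sup>2)) std_onb"
    using hs_norm_has_sum(2)[OF S std_onb_basis] by (rule has_sum_cmult_left)
  moreover have "(cmod (cinner (S f) e))\<^sup>2 \<le> (norm (adj S e))\<^sup>2 * (norm f)\<^sup>2" for e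
    unfolding bounded_operator_adj[OF b] power_mult_distrib[symmetric]
    by (intro power_mono) (auto simp: mult.commute[of "norm (adj S e)"] l2.cmod_ip_le)
  ultimately show "(norm (S f))\<^sup>2 \<le> (hs_norm S * norm f)\<^sup>2"
    unfolding power_mult_distrib by (rule has_sum_mono)
qed (simp add: hs_norm_nonneg[OF S])

section \<open>The Hilbert space of Hilbert-Schmidt operators\<close>

lemma hilbert_schmidtI:
  assumes "bounded_operator S" and "orthonormal_basis E" and "(\<lambda>e. (norm (S e))\<^sup>2) summable_on E"
  shows "hilbert_schmidt S"
  using assms by (auto simp: hilbert_schmidt_def)

lemma hilbert_schmidt_zero: "hilbert_schmidt (\<lambda>f :: 'n::finite l2. 0)"
  by (rule hilbert_schmidtI[OF bounded_operatorI[where K = 0] std_onb_basis])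
    (auto simp: l2.sc_zero_right)

lemma bounded_operator_lincomb:
  assumes A: "bounded_operator A" and B: "bounded_operator B"
  shows "bounded_operator (\<lambda>f. a *\<^sub>C A f + b *\<^sub>C B f)"
proof -
  obtain K L where K: "\<And>f. norm (A f) \<le> K * norm f" and L: "\<And>f. norm (B f) \<le> L * norm f"
    using bounded_operator_norm[OF A] bounded_operator_norm[OF B] by blast
  show ?thesis
  proof (rule bounded_operatorI[where K = "cmod a * K + cmod b * L"])
    fix f
    have "norm (a *\<^sub>C A f + b *\<^sub>C B f) \<le> cmod a * norm (A f) + cmod b * norm (B f)"
      using norm_triangle_ineq[of "a *\<^sub>C A f" "b *\<^sub>C B f"] by (simp add: l2.norm_sc)
    also have "\<dots> \<le> cmod a * (K * norm f) + cmod b * (L * norm f)"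
      by (intro add_mono mult_left_mono K L) auto
    finally show "norm (a *\<^sub>C A f + b *\<^sub>C B f) \<le> (cmod a * K + cmod b * L) * norm f"
      by (simp add: algebra_simps)
  qed (simp_all add: bounded_operator_simps[OF A] bounded_operator_simps[OF B]
      l2.sc_add_right l2.sc_sc mult.commute)
qed

lemma hs_lincomb:
  assumes A: "hilbert_schmidt A" and B: "hilbert_schmidt B"
  shows "hilbert_schmidt (\<lambda>f. a *\<^sub>C A f + b *\<^sub>C B f)"
proof (rule hilbert_schmidtI[OF bounded_operator_lincomb std_onb_basis])
  have "(\<lambda>e. (2 * (cmod a)\<^sup>2) * (norm (A e))\<^sup>2 + (2 * (cmod b)\<^sup>2) * (norm (B e))\<^sup>2) summable_on std_onb"
    using hilbert_schmidt_has_sum(1)[OF A std_onb_basis]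
      hilbert_schmidt_has_sum(1)[OF B std_onb_basis]
    by (intro summable_on_add summable_on_cmult_right) (blast intro: has_sum_imp_summable)+
  then show "(\<lambda>e. (norm (a *\<^sub>C A e + b *\<^sub>C B e))\<^sup>2) summable_on std_onb"
  proof (rule summable_on_comparison_test)
    fix e :: "'a l2"
    show "(norm (a *\<^sub>C A e + b *\<^sub>C B e))\<^sup>2
        \<le> (2 * (cmod a)\<^sup>2) * (norm (A e))\<^sup>2 + (2 * (cmod b)\<^sup>2) * (norm (B e))\<^sup>2"
      using norm_add_sq_le[of "a *\<^sub>C A e" "b *\<^sub>C B e"] by (simp add: l2.norm_sc power_mult_distrib)
  qed auto
qed (use assms in \<open>auto intro: hs_bounded\<close>)

lemma adj_lincomb:
  assumes A: "bounded_operator A" and B: "bounded_operator B"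
  shows "adj (\<lambda>f. a *\<^sub>C A f + b *\<^sub>C B f) = (\<lambda>f. cnj a *\<^sub>C adj A f + cnj b *\<^sub>C adj B f)"
  by (rule adj_eqI) (simp add: l2.ip_add_left l2.ip_add_right l2.ip_sc_left l2.ip_sc_right
      bounded_operator_adj[OF A] bounded_operator_adj[OF B])

lemma hs_inner_lincomb_left:
  assumes A: "hilbert_schmidt A" and B: "hilbert_schmidt B" and T: "hilbert_schmidt T"
  shows "hs_inner (\<lambda>f. a *\<^sub>C A f + b *\<^sub>C B f) T = a * hs_inner A T + b * hs_inner B T"
proof (rule has_sum_unique[OF hs_inner_has_sum[OF hs_lincomb[OF A B] T]])
  have "((\<lambda>e. a * cinner (adj T e) (adj A e) + b * cinner (adj T e) (adj B e))
      has_sum (a * hs_inner A T + b * hs_inner B T)) std_onb"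
    by (intro has_sum_add has_sum_cmult_right hs_inner_has_sum assms)
  then show "((\<lambda>e. cinner (adj T e) (adj (\<lambda>f. a *\<^sub>C A f + b *\<^sub>C B f) e))
      has_sum (a * hs_inner A T + b * hs_inner B T)) std_onb"
    using A B
    by (simp add: adj_lincomb hs_bounded l2.ip_add_right l2.ip_sc_right)
qed

lemma hs_inner_cnj:
  assumes "hilbert_schmidt S" "hilbert_schmidt T"
  shows "cnj (hs_inner S T) = hs_inner T S"
proof (rule has_sum_unique[OF _ hs_inner_has_sum[OF assms(2,1)]])
  have "((\<lambda>e. cnj (cinner (adj T e) (adj S e))) has_sum cnj (hs_inner S T)) std_onb"
    using hs_inner_has_sum[OF assms] by (simp only: has_sum_cnj_iff)
  then show "((\<lambda>e. cinner (adj S e) (adj T e)) has_sum cnj (hs_inner S T)) std_onb"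
    by (simp only: l2.ip_cnj)
qed

text \<open>Lower semicontinuity of the Hilbert-Schmidt norm under pointwise limits: finite sums
  over the basis pass to the limit and stay below K^2. Applied to differences of a Cauchy sequence,
  it yields completeness.\<close>

lemma hilbert_schmidt_pointwise_limit:
  assumes A: "\<And>m. hilbert_schmidt (A m)" and le: "\<And>m. m \<ge> N \<Longrightarrow> hs_norm (A m) \<le> K"
    and lim: "\<And>f. (\<lambda>m. A m f) \<longlonglongrightarrow> L f"
  shows "hilbert_schmidt L" and "hs_norm L \<le> K"
proof -
  note b = hs_bounded[OF A]
  have ev: "\<forall>\<^sub>F m in sequentially. hs_norm (A m) \<le> K"
    using le eventually_sequentially by blast
  have K: "K \<ge> 0"
    using le[of N] hs_norm_nonneg[OF A, of N] by simp
  have bL: "bounded_operator L"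
  proof (rule bounded_operatorI[where K = K])
    show "L (f + g) = L f + L g" for f g
      using tendsto_add[OF lim lim, of f g] lim[of "f + g"]
      by (simp add: bounded_operator_simps[OF b] LIMSEQ_unique)
    show "L (c *\<^sub>C f) = c *\<^sub>C L f" for c f
      using bounded_linear.tendsto[OF l2.bounded_linear_sc lim, of c f] lim[of "c *\<^sub>C f"]
      by (simp add: bounded_operator_simps[OF b] LIMSEQ_unique)
    show "norm (L f) \<le> K * norm f" for f
    proof (rule tendsto_upperbound[OF tendsto_norm[OF lim]])
      show "\<forall>\<^sub>F m in sequentially. norm (A m f) \<le> K * norm f"
        using ev
      proof eventually_elim
        fix m assume "hs_norm (A m) \<le> K"
        then show "norm (A m f) \<le> K * norm f"
          using norm_le_hs_norm[OF A, of m f] mult_right_mono[of "hs_norm (A m)" K "norm f"] by simp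
      qed
    qed simp
  qed
  have bound: "(\<Sum>e\<in>F. (norm (L e))\<^sup>2) \<le> K\<^sup>2" if F: "finite F" "F \<subseteq> std_onb" for F
  proof (rule tendsto_upperbound)
    show "(\<lambda>m. \<Sum>e\<in>F. (norm (A m e))\<^sup>2) \<longlonglongrightarrow> (\<Sum>e\<in>F. (norm (L e))\<^sup>2)"
      by (intro tendsto_sum tendsto_power tendsto_norm lim)
    show "\<forall>\<^sub>F m in sequentially. (\<Sum>e\<in>F. (norm (A m e))\<^sup>2) \<le> K\<^sup>2"
      using ev
    proof eventually_elim
      fix m assume m: "hs_norm (A m) \<le> K"
      have "(\<Sum>e\<in>F. (norm (A m e))\<^sup>2) \<le> (hs_norm (A m))\<^sup>2"
        by (rule finite_sum_le_has_sum[OF hs_norm_has_sum(1)[OF A std_onb_basis]]) (use F in auto)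
      also have "\<dots> \<le> K\<^sup>2"
        using m hs_norm_nonneg[OF A] by (intro power_mono) auto
      finally show "(\<Sum>e\<in>F. (norm (A m e))\<^sup>2) \<le> K\<^sup>2" .
    qed
  qed simp
  have "(\<lambda>e. (norm (L e))\<^sup>2) summable_on std_onb"
    using bound by (intro nonneg_bdd_above_summable_on bdd_aboveI[of _ "K\<^sup>2"]) auto
  then show L: "hilbert_schmidt L"
    by (rule hilbert_schmidtI[OF bL std_onb_basis])
  have "(hs_norm L)\<^sup>2 \<le> K\<^sup>2"
    using bound by (intro has_sum_le_finite_sums[OF hs_norm_has_sum(1)[OF L std_onb_basis]])
  then show "hs_norm L \<le> K"
    using K by (rule power2_le_imp_le)
qed

text \<open>A type of its own gives Hilbert-Schmidt operators the topology of a normed space, hence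
  \<open>has_sum\<close>, limits and the Hilbert space locale, in place of explicit estimates of
  \<open>hs_norm\<close>.\<close>

typedef (overloaded) 'n hs = "{A :: 'n::finite operator. hilbert_schmidt A}"
  morphisms hs_apply Abs_hs
  using hilbert_schmidt_zero by blast

setup_lifting type_definition_hs

lift_definition scaleC_hs :: "complex \<Rightarrow> 'n::finite hs \<Rightarrow> 'n hs" is "\<lambda>a A f. a *\<^sub>C A f"
  subgoal for a A
    using hs_lincomb[of A A a 0] by (simp add: l2.sc_zero_left)
  done

lift_definition cinner_hs :: "'n::finite hs \<Rightarrow> 'n hs \<Rightarrow> complex" is hs_inner .

instantiation hs :: (finite) real_inner
begin

lift_definition zero_hs :: "'a hs" is "\<lambda>f. 0"
  by (rule hilbert_schmidt_zero)

lift_definition plus_hs :: "'a hs \<Rightarrow> 'a hs \<Rightarrow> 'a hs" is "\<lambda>A B f. A f + B f"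
  subgoal for A B
    using hs_lincomb[of A B 1 1] by (simp add: l2.sc_one)
  done

lift_definition minus_hs :: "'a hs \<Rightarrow> 'a hs \<Rightarrow> 'a hs" is "\<lambda>A B f. A f - B f"
  subgoal for A B
    using hs_lincomb[of A B "of_real 1" "of_real (- 1)"]
    unfolding l2.sc_of_real by simp
  done

lift_definition uminus_hs :: "'a hs \<Rightarrow> 'a hs" is "\<lambda>A f. - A f"
  subgoal for A
    using hs_lincomb[of A A "of_real (- 1)" "of_real 0"]
    unfolding l2.sc_of_real by simp
  done

definition scaleR_hs :: "real \<Rightarrow> 'a hs \<Rightarrow> 'a hs" where
  "scaleR_hs r = scaleC_hs (complex_of_real r)"

definition inner_hs :: "'a hs \<Rightarrow> 'a hs \<Rightarrow> real" where
  "inner_hs A B = Re (cinner_hs A B)"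

definition norm_hs :: "'a hs \<Rightarrow> real" where
  "norm_hs A = hs_norm (hs_apply A)"

definition sgn_hs :: "'a hs \<Rightarrow> 'a hs" where
  "sgn_hs A = inverse (norm A) *\<^sub>R A"

definition dist_hs :: "'a hs \<Rightarrow> 'a hs \<Rightarrow> real" where
  "dist_hs A B = norm (A - B)"

definition uniformity_hs :: "('a hs \<times> 'a hs) filter" where
  "uniformity_hs = (INF e\<in>{0<..}. principal {(A, B). dist A B < e})"

definition open_hs :: "'a hs set \<Rightarrow> bool" where
  "open_hs U \<longleftrightarrow> (\<forall>A\<in>U. eventually (\<lambda>(A', B). A' = A \<longrightarrow> B \<in> U) uniformity)"

instance
proof
  fix A B C :: "'a hs" and r s :: real and U :: "'a hs set"
  have lin: "hs_inner (\<lambda>f. A f + B f) T = hs_inner A T + hs_inner B T"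
    if "hilbert_schmidt A" "hilbert_schmidt B" "hilbert_schmidt T" for A B T :: "'a operator"
    using hs_inner_lincomb_left[OF that, of 1 1] by (simp add: l2.sc_one)
  have lin': "hs_inner (\<lambda>f. a *\<^sub>C A f) T = a * hs_inner A T"
    if "hilbert_schmidt A" "hilbert_schmidt T" for a and A T :: "'a operator"
    using hs_inner_lincomb_left[OF that(1,1,2), of a 0] by (simp add: l2.sc_zero_left)
  show "A + B + C = A + (B + C)" "A + B = B + A" "0 + A = A" "- A + A = 0" "A - B = A + - B"
    by (transfer; simp add: algebra_simps)+
  show "r *\<^sub>R (A + B) = r *\<^sub>R A + r *\<^sub>R B" "(r + s) *\<^sub>R A = r *\<^sub>R A + s *\<^sub>R A"
    "r *\<^sub>R s *\<^sub>R A = (r * s) *\<^sub>R A" "1 *\<^sub>R A = A"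
    unfolding scaleR_hs_def
    by (transfer; simp add: l2.sc_add_left l2.sc_add_right l2.sc_sc l2.sc_one)+
  show "dist A B = norm (A - B)" by (rule dist_hs_def)
  show "sgn A = inverse (norm A) *\<^sub>R A" by (rule sgn_hs_def)
  show "uniformity = (INF e\<in>{0<..}. principal {(A :: 'a hs, B). dist A B < e})"
    by (rule uniformity_hs_def)
  show "open U \<longleftrightarrow> (\<forall>A\<in>U. \<forall>\<^sub>F (A', B) in uniformity. A' = A \<longrightarrow> B \<in> U)"
    by (rule open_hs_def)
  show "norm A = sqrt (inner A A)"
    by (simp add: norm_hs_def inner_hs_def cinner_hs.rep_eq hs_norm_def)
  show "inner A B = inner B A"
    unfolding inner_hs_def by transfer (metis complex_cnj_cancel_iff hs_inner_cnj cnj.simps(1))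
  show "inner (A + B) C = inner A C + inner B C"
    unfolding inner_hs_def by transfer (simp add: lin)
  show "inner (r *\<^sub>R A) B = r * inner A B"
    unfolding inner_hs_def scaleR_hs_def by transfer (simp add: lin')
  show "0 \<le> inner A A"
    unfolding inner_hs_def
    by transfer (simp add: hs_inner_self[OF _ std_onb_basis] infsum_nonneg)
  show "inner A A = 0 \<longleftrightarrow> A = 0"
    unfolding inner_hs_def
  proof transfer
    fix A :: "'a operator" assume A: "hilbert_schmidt A"
    show "Re (hs_inner A A) = 0 \<longleftrightarrow> A = (\<lambda>f. 0)"
    proof
      assume "Re (hs_inner A A) = 0"
      then have "hs_norm A = 0" by (simp add: hs_norm_def)
      then show "A = (\<lambda>f. 0)" using norm_le_hs_norm[OF A] by (auto simp: fun_eq_iff)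
    qed (use hs_inner_self[OF hilbert_schmidt_zero[where 'n = 'a] std_onb_basis] in auto)
  qed
qed

end

lemma hs_hs_apply [simp]: "hilbert_schmidt (hs_apply A)"
  using hs_apply by blast

lemma hs_apply_Abs [simp]: "hilbert_schmidt A \<Longrightarrow> hs_apply (Abs_hs A) = A"
  by (rule Abs_hs_inverse) simp

interpretation hs: complex_inner_space "scaleC_hs :: complex \<Rightarrow> 'n::finite hs \<Rightarrow> 'n hs" cinner_hs
proof
  fix x y :: "'n hs" and a
  show "Re (cinner_hs x y) = inner x y" by (simp add: inner_hs_def)
  show "cnj (cinner_hs x y) = cinner_hs y x"
    by transfer (rule hs_inner_cnj)
  show "cinner_hs (scaleC_hs a x) y = a * cinner_hs x y"
  proof transfer
    fix a and A T :: "'n operator" assume "hilbert_schmidt A" "hilbert_schmidt T"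
    then show "hs_inner (\<lambda>f. a *\<^sub>C A f) T = a * hs_inner A T"
      using hs_inner_lincomb_left[of A A T a 0] by (simp add: l2.sc_zero_left)
  qed
qed

instance hs :: (finite) complete_space
proof
  fix X :: "nat \<Rightarrow> 'a hs"
  assume X: "Cauchy X"
  have le: "dist (hs_apply A f) (hs_apply B f) \<le> dist A B * norm f" for A B :: "'a hs" and f
    using norm_le_hs_norm[OF hs_hs_apply, of "A - B" f] by (simp add: dist_norm norm_hs_def minus_hs.rep_eq)
  have "Cauchy (\<lambda>n. hs_apply (X n) f)" for f
  proof (rule metric_CauchyI)
    fix e :: real assume "e > 0"
    then have "e / (norm f + 1) > 0" by (simp add: add_nonneg_pos)
    with X obtain N where N: "\<And>m n. m \<ge> N \<Longrightarrow> n \<ge> N \<Longrightarrow> dist (X m) (X n) < e / (norm f + 1)"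
      unfolding Cauchy_def by blast
    show "\<exists>N. \<forall>m\<ge>N. \<forall>n\<ge>N. dist (hs_apply (X m) f) (hs_apply (X n) f) < e"
    proof (intro exI[of _ N] allI impI)
      fix m n assume "m \<ge> N" "n \<ge> N"
      have "dist (hs_apply (X m) f) (hs_apply (X n) f) \<le> dist (X m) (X n) * (norm f + 1)"
        using le[of "X m" f "X n"] by (simp add: distrib_left add_increasing2)
      also have "\<dots> < e"
        using N[OF \<open>m \<ge> N\<close> \<open>n \<ge> N\<close>] by (simp add: pos_less_divide_eq add_nonneg_pos)
      finally show "dist (hs_apply (X m) f) (hs_apply (X n) f) < e" .
    qed
  qed
  then have conv: "convergent (\<lambda>n. hs_apply (X n) f)" for f
    by (rule Cauchy_convergent)
  define L where "L f = lim (\<lambda>n. hs_apply (X n) f)" for f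
  have L: "(\<lambda>n. hs_apply (X n) f) \<longlonglongrightarrow> L f" for f
    using conv[of f] by (simp add: L_def convergent_LIMSEQ_iff)
  have bounds: "hilbert_schmidt (\<lambda>f. hs_apply (X n) f - L f)"
    "hs_norm (\<lambda>f. hs_apply (X n) f - L f) \<le> e"
    if "\<And>m. m \<ge> N \<Longrightarrow> dist (X n) (X m) \<le> e" for n N e
  proof -
    have lim: "(\<lambda>m. hs_apply (X n - X m) f) \<longlonglongrightarrow> hs_apply (X n) f - L f" for f
      unfolding minus_hs.rep_eq by (intro tendsto_intros L)
    have le: "hs_norm (hs_apply (X n - X m)) \<le> e" if "m \<ge> N" for m
      using \<open>m \<ge> N \<Longrightarrow> dist (X n) (X m) \<le> e\<close> that by (simp add: dist_norm norm_hs_def)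
    show "hilbert_schmidt (\<lambda>f. hs_apply (X n) f - L f)"
      by (rule hilbert_schmidt_pointwise_limit(1)[OF hs_hs_apply le lim])
    show "hs_norm (\<lambda>f. hs_apply (X n) f - L f) \<le> e"
      by (rule hilbert_schmidt_pointwise_limit(2)[OF hs_hs_apply le lim])
  qed
  \<comment> \<open>So far only differences \<open>X n - L\<close> are known to be Hilbert-Schmidt.
    The limit itself is recovered as \<open>X N0\<close> minus such a difference.\<close>
  obtain N0 where "\<And>m. m \<ge> N0 \<Longrightarrow> dist (X N0) (X m) \<le> 1"
    using X unfolding Cauchy_def by (metis less_imp_le order_refl zero_less_one)
  then have "hilbert_schmidt (\<lambda>f. hs_apply (X N0) f - L f)" by (rule bounds(1))
  then have "hilbert_schmidt (\<lambda>f. hs_apply (X N0) f - hs_apply (Abs_hs (\<lambda>f. hs_apply (X N0) f - L f)) f)"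
    using hs_hs_apply[of "X N0 - Abs_hs (\<lambda>f. hs_apply (X N0) f - L f)"]
    by (simp add: minus_hs.rep_eq)
  then have hL: "hilbert_schmidt L"
    using \<open>hilbert_schmidt (\<lambda>f. hs_apply (X N0) f - L f)\<close> by simp
  have "X \<longlonglongrightarrow> Abs_hs L"
  proof (rule metric_LIMSEQ_I)
    fix e :: real assume "e > 0"
    then obtain N where N: "\<And>m n. m \<ge> N \<Longrightarrow> n \<ge> N \<Longrightarrow> dist (X m) (X n) < e / 2"
      using X unfolding Cauchy_def by (metis half_gt_zero)
    show "\<exists>N. \<forall>n\<ge>N. dist (X n) (Abs_hs L) < e"
    proof (intro exI[of _ N] allI impI)
      fix n assume n: "n \<ge> N"
      have "hs_norm (\<lambda>f. hs_apply (X n) f - L f) \<le> e / 2"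
        by (rule bounds(2)[of N]) (use N n in \<open>auto intro: less_imp_le\<close>)
      then show "dist (X n) (Abs_hs L) < e"
        using hL \<open>e > 0\<close> by (simp add: dist_norm norm_hs_def minus_hs.rep_eq)
    qed
  qed
  then show "convergent X" by (auto simp: convergent_def)
qed

interpretation hs: complex_hilbert_space "scaleC_hs :: complex \<Rightarrow> 'n::finite hs \<Rightarrow> 'n hs" cinner_hs ..

lemma hs_apply_sum: "hs_apply (\<Sum>i\<in>F. A i) f = (\<Sum>i\<in>F. hs_apply (A i) f)"
  by (induction F rule: infinite_finite_induct) (auto simp: zero_hs.rep_eq plus_hs.rep_eq)

lemma hs_norm_op_diff_lincomb:
  assumes "\<And>i. i \<in> F \<Longrightarrow> hilbert_schmidt (A i)" "hilbert_schmidt T"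
  shows "hs_norm (op_diff (op_lincomb c A F) T) = dist (\<Sum>i\<in>F. scaleC_hs (c i) (Abs_hs (A i))) (Abs_hs T)"
  using assms
  by (simp add: dist_norm norm_hs_def op_diff_def op_lincomb_def fun_eq_iff minus_hs.rep_eq
      hs_apply_sum scaleC_hs.rep_eq cong: sum.cong)

text \<open>The dictionary between the convergence used in the statement and \<open>has_sum\<close>
  in the type \<open>hs\<close>; every later series argument takes place on the right-hand
  side.\<close>

lemma hs_has_sum_iff:
  assumes A: "\<And>i. i \<in> I \<Longrightarrow> hilbert_schmidt (A i)"
  shows "hs_has_sum c A I T \<longleftrightarrow> hilbert_schmidt T \<and> ((\<lambda>i. scaleC_hs (c i) (Abs_hs (A i))) has_sum Abs_hs T) I"
proof (cases "hilbert_schmidt T")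
  case True
  have "\<forall>\<^sub>F F in finite_subsets_at_top I. hs_norm (op_diff (op_lincomb c A F) T)
      = dist (\<Sum>i\<in>F. scaleC_hs (c i) (Abs_hs (A i))) (Abs_hs T)"
    using A True by (intro eventually_finite_subsets_at_top_weakI hs_norm_op_diff_lincomb) auto
  then show ?thesis
    using True unfolding hs_has_sum_def has_sum_def
    by (subst (2) tendsto_dist_iff) (simp add: tendsto_cong)
qed (simp add: hs_has_sum_def)

section \<open>Translations of operators\<close>

lemma ae_equal_refl: "ae_equal f f \<longleftrightarrow> square_integrable f"
  by (simp add: ae_equal_def)

lemma tf_shift_add: "tf_shift z (f + g) = tf_shift z f + tf_shift z g"
  by transfer (simp add: ae_equal_def square_integrable_add square_integrable_modulate
      square_integrable_translate distrib_left)

lemma tf_shift_scaleC: "tf_shift z (c *\<^sub>C f) = c *\<^sub>C tf_shift z f"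
  by transfer (simp add: ae_equal_def square_integrable_scale square_integrable_modulate
      square_integrable_translate mult.left_commute)

lemma tf_shift_zero: "tf_shift 0 f = f"
  by transfer (simp add: ae_equal_def)

text \<open>Time-frequency shifts compose only up to a phase. Under conjugation this phase meets its
  inverse, coming from \<open>adj_tf_shift_add\<close>, so that operator translation is a genuine
  action of phase space.\<close>

lemma tf_shift_tf_shift:
  "tf_shift z (tf_shift w f) = cis (- (2 * pi * (snd w \<bullet> fst z))) *\<^sub>C tf_shift (z + w) f"
proof transfer
  fix z w :: "'a phase" and f :: "real ^ 'a \<Rightarrow> complex"
  assume f: "ae_equal f f"
  have pointwise: "cis (2 * pi * (snd z \<bullet> t)) * (cis (2 * pi * (snd w \<bullet> (t - fst z))) * f (t - fst z - fst w))
    = cis (- (2 * pi * (snd w \<bullet> fst z))) * (cis (2 * pi * (snd (z + w) \<bullet> t)) * f (t - fst (z + w)))" for t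
  proof -
    have "2 * pi * (snd z \<bullet> t) + 2 * pi * (snd w \<bullet> (t - fst z))
        = - (2 * pi * (snd w \<bullet> fst z)) + 2 * pi * (snd (z + w) \<bullet> t)"
      by (simp add: inner_diff_right inner_add_left algebra_simps)
    moreover have "t - fst z - fst w = t - fst (z + w)" by simp
    ultimately show ?thesis by (simp only: mult.assoc[symmetric] cis_mult)
  qed
  have inner: "square_integrable (\<lambda>t. cis (2 * pi * (snd w \<bullet> t)) * f (t - fst w))"
    using f unfolding ae_equal_refl by (rule square_integrable_modulate[OF square_integrable_translate[of f "fst w"]])
  have "square_integrable (\<lambda>t. cis (2 * pi * (snd z \<bullet> t)) *
      (cis (2 * pi * (snd w \<bullet> (t - fst z))) * f (t - fst z - fst w)))"
    by (rule square_integrable_modulate[OF square_integrable_translate[OF inner, of "fst z"]])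
  with pointwise show "ae_equal (\<lambda>t. cis (2 * pi * (snd z \<bullet> t)) *
      (cis (2 * pi * (snd w \<bullet> (t - fst z))) * f (t - fst z - fst w)))
    (\<lambda>t. cis (- (2 * pi * (snd w \<bullet> fst z))) * (cis (2 * pi * (snd (z + w) \<bullet> t)) * f (t - fst (z + w))))"
    by (simp add: ae_equal_refl)
qed

lemma cinner_tf_shift: "cinner (tf_shift z f) (tf_shift z g) = cinner f g"
proof transfer
  fix z :: "'a phase" and f g :: "real ^ 'a \<Rightarrow> complex"
  assume fg: "ae_equal f f" "ae_equal g g"
  then have [measurable]: "(\<lambda>t. f t * cnj (g t)) \<in> borel_measurable borel"
    using square_integrable_integrable_mult[of f g] by (auto simp: ae_equal_def)
  have unimodular: "cis a * x * cnj (cis a * y) = x * cnj y" for a x y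
  proof -
    have "cis a * x * cnj (cis a * y) = (cis a * cnj (cis a)) * (x * cnj y)"
      by (simp only: complex_cnj_mult mult_ac)
    then show ?thesis by (simp add: cis_cnj cis_mult)
  qed
  have "(\<integral>t. cis (2 * pi * (snd z \<bullet> t)) * f (t - fst z) * cnj (cis (2 * pi * (snd z \<bullet> t)) * g (t - fst z)) \<partial>lborel)
     = (\<integral>t. f (- fst z + t) * cnj (g (- fst z + t)) \<partial>lborel)"
    by (simp only: unimodular) simp
  also have "\<dots> = (\<integral>t. f t * cnj (g t) \<partial>distr lborel borel ((+) (- fst z)))"
    by (subst integral_distr) auto
  finally show "(\<integral>t. cis (2 * pi * (snd z \<bullet> t)) * f (t - fst z) * cnj (cis (2 * pi * (snd z \<bullet> t)) * g (t - fst z)) \<partial>lborel)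
     = (\<integral>t. f t * cnj (g t) \<partial>lborel)"
    by (simp add: lborel_distr_plus)
qed

lemma norm_tf_shift: "norm (tf_shift z f) = norm f"
  by (simp add: norm_l2_def inner_l2_def cinner_tf_shift)

lemma bounded_tf_shift: "bounded_operator (tf_shift z)"
  by (rule bounded_operatorI[where K = 1]) (auto simp: tf_shift_add tf_shift_scaleC norm_tf_shift)

lemma adj_tf_shift_cancel: "adj (tf_shift z) (tf_shift z f) = f"
  by (rule l2.ip_eqI) (simp add: cinner_adj_left[OF bounded_tf_shift] cinner_tf_shift)

text \<open>Being an isometry makes the adjoint a left inverse only; surjectivity, by an explicit
  preimage, makes it two-sided.\<close>

lemma surj_tf_shift: "surj (tf_shift z)"
proof (rule surjI)
  fix f
  have "tf_shift z (cis (2 * pi * (snd (- z) \<bullet> fst z)) *\<^sub>C tf_shift (- z) f) = f"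
    by (simp add: tf_shift_scaleC tf_shift_tf_shift l2.sc_sc cis_mult l2.sc_one tf_shift_zero)
  then show "tf_shift z (cis (2 * pi * (snd (- z) \<bullet> fst z)) *\<^sub>C tf_shift (- z) f) = f" .
qed

lemma tf_shift_adj_cancel: "tf_shift z (adj (tf_shift z) f) = f"
proof -
  obtain g where "f = tf_shift z g" using surj_tf_shift by (rule surjE)
  then show ?thesis by (simp add: adj_tf_shift_cancel)
qed

lemma orthonormal_basis_tf_shift:
  assumes "orthonormal_basis E"
  shows "orthonormal_basis (tf_shift z ` E)"
  unfolding orthonormal_basis_def
proof (intro conjI ballI allI impI)
  fix e e' assume "e \<in> tf_shift z ` E" "e' \<in> tf_shift z ` E"
  then show "cinner e e' = (if e = e' then 1 else 0)"
    using assms adj_tf_shift_cancel[of z] by (auto simp: orthonormal_basis_def cinner_tf_shift)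
next
  fix f assume "\<forall>e\<in>tf_shift z ` E. cinner f e = 0"
  then have "\<forall>e\<in>E. cinner (adj (tf_shift z) f) e = 0"
    by (simp add: cinner_adj_left[OF bounded_tf_shift])
  then have "adj (tf_shift z) f = 0"
    using assms by (simp add: orthonormal_basis_def)
  then show "f = 0"
    using tf_shift_adj_cancel[of z f] bounded_operator_simps(3)[OF bounded_tf_shift] by metis
qed

lemma
  assumes S: "hilbert_schmidt S"
  shows hs_op_translate: "hilbert_schmidt (op_translate z S)"
    and hs_norm_op_translate: "hs_norm (op_translate z S) = hs_norm S"
proof -
  note bz = bounded_tf_shift[of z] and bS = hs_bounded[OF S]
  note E = orthonormal_basis_tf_shift[OF std_onb_basis, of z]
  have b: "bounded_operator (op_translate z S)"
  proof -
    obtain K where K: "K \<ge> 0" "\<And>f. norm (S f) \<le> K * norm f"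
      using bounded_operator_norm[OF bS] by blast
    note ba = bounded_operator_adjoint[OF bz]
    show ?thesis
    proof (rule bounded_operatorI[where K = K])
      show "norm (op_translate z S f) \<le> K * norm f" for f
        using K(2)[of "adj (tf_shift z) f"] norm_tf_shift[of z "adj (tf_shift z) f"]
        by (simp add: op_translate_def norm_tf_shift tf_shift_adj_cancel)
    qed (simp_all add: op_translate_def bounded_operator_simps[OF bz] bounded_operator_simps[OF bS]
        bounded_operator_simps[OF ba])
  qed
  have inj: "inj_on (tf_shift z) std_onb"
    by (metis adj_tf_shift_cancel inj_on_def)
  have sum: "((\<lambda>e. (norm (op_translate z S e))\<^sup>2) has_sum (hs_norm S)\<^sup>2) (tf_shift z ` std_onb)"
    unfolding has_sum_reindex[OF inj]
    using hs_norm_has_sum(1)[OF S std_onb_basis]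
    by (simp add: o_def op_translate_def adj_tf_shift_cancel norm_tf_shift)
  then show hs: "hilbert_schmidt (op_translate z S)"
    by (intro hilbert_schmidtI[OF b E]) (rule has_sum_imp_summable)
  have "(hs_norm (op_translate z S))\<^sup>2 = (hs_norm S)\<^sup>2"
    using hs_norm_has_sum(1)[OF hs E] sum by (rule has_sum_unique)
  then show "hs_norm (op_translate z S) = hs_norm S"
    using hs_norm_nonneg[OF hs] hs_norm_nonneg[OF S] by (rule power2_eq_imp_eq)
qed

lemma adj_tf_shift_add:
  "adj (tf_shift w) (adj (tf_shift z) f)
    = cis (2 * pi * (snd w \<bullet> fst z)) *\<^sub>C adj (tf_shift (z + w)) f"
proof -
  have "tf_shift z (tf_shift w (cis (2 * pi * (snd w \<bullet> fst z)) *\<^sub>C adj (tf_shift (z + w)) f)) = f"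
    by (simp add: tf_shift_scaleC tf_shift_tf_shift l2.sc_sc cis_mult l2.sc_one tf_shift_adj_cancel)
  then show ?thesis by (metis adj_tf_shift_cancel)
qed

lemma op_translate_op_translate:
  assumes "bounded_operator S"
  shows "op_translate z (op_translate w S) = op_translate (z + w) S"
  by (rule ext) (simp add: op_translate_def adj_tf_shift_add bounded_operator_simps[OF assms]
      tf_shift_tf_shift tf_shift_scaleC l2.sc_sc cis_mult l2.sc_one)

lemma op_translate_zero: "op_translate 0 S = S"
proof -
  have "adj (tf_shift 0) f = f" for f :: "'a l2"
    using adj_tf_shift_cancel[of 0 f] by (simp add: tf_shift_zero)
  then show ?thesis by (simp add: op_translate_def fun_eq_iff tf_shift_zero)
qed

lift_definition hs_translate :: "'n::finite phase \<Rightarrow> 'n hs \<Rightarrow> 'n hs" is op_translate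
  by (rule hs_op_translate)

lemma hs_translate_scaleC: "hs_translate z (scaleC_hs c A) = scaleC_hs c (hs_translate z A)"
  by transfer (simp add: op_translate_def fun_eq_iff tf_shift_scaleC)

lemma bounded_linear_hs_translate: "bounded_linear (hs_translate z)"
proof (rule bounded_linear_intro[where K = 1])
  show "hs_translate z (A + B) = hs_translate z A + hs_translate z B" for A B
    by (rule hs_apply_inject[THEN iffD1])
      (simp only: fun_eq_iff hs_translate.rep_eq plus_hs.rep_eq op_translate_def tf_shift_add o_apply simp_thms)
  show "hs_translate z (r *\<^sub>R A) = r *\<^sub>R hs_translate z A" for r A
    by (simp add: scaleR_hs_def hs_translate_scaleC)
  show "norm (hs_translate z A) \<le> norm A * 1" for A
    by (simp add: norm_hs_def hs_translate.rep_eq hs_norm_op_translate)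
qed

lemma hs_translate_hs_translate: "hs_translate z (hs_translate w A) = hs_translate (z + w) A"
  by transfer (simp add: op_translate_op_translate hs_bounded)

lemma hs_translate_zero: "hs_translate 0 A = A"
  by transfer (rule op_translate_zero)

section \<open>Riesz sequences\<close>

context complex_hilbert_space
begin

text \<open>Extends the estimate from finite families to square-summable coefficients: it bounds
  tails, which gives convergence, and it survives the limit.\<close>

lemma series_upper_bound:
  assumes upper: "\<And>F c. finite F \<Longrightarrow> F \<subseteq> I \<Longrightarrow>
      (norm (\<Sum>i\<in>F. sc (c i) (a i)))\<^sup>2 \<le> K * sq_sum c F"
    and c: "((\<lambda>i. (cmod (c i))\<^sup>2) has_sum s) I"
  shows "(\<lambda>i. sc (c i) (a i)) summable_on I"
    and "(norm (\<Sum>\<^sub>\<infinity>i\<in>I. sc (c i) (a i)))\<^sup>2 \<le> K * s"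
proof -
  show sum: "(\<lambda>i. sc (c i) (a i)) summable_on I"
    by (rule summable_on_norm_sq_bound[where w = "\<lambda>i. K * (cmod (c i))\<^sup>2"])
      (use upper c in \<open>auto simp: sum_distrib_left[symmetric] intro: summable_on_cmult_right has_sum_imp_summable\<close>)
  show "(norm (\<Sum>\<^sub>\<infinity>i\<in>I. sc (c i) (a i)))\<^sup>2 \<le> K * s"
  proof (rule tendsto_le)
    show "((\<lambda>F. (norm (\<Sum>i\<in>F. sc (c i) (a i)))\<^sup>2) \<longlongrightarrow> (norm (\<Sum>\<^sub>\<infinity>i\<in>I. sc (c i) (a i)))\<^sup>2)
        (finite_subsets_at_top I)"
      by (intro tendsto_power tendsto_norm infsum_tendsto[OF sum])
    show "((\<lambda>F. K * sq_sum c F) \<longlongrightarrow> K * s) (finite_subsets_at_top I)"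
      using c unfolding has_sum_def by (rule tendsto_mult_left)
    show "\<forall>\<^sub>F F in finite_subsets_at_top I.
        (norm (\<Sum>i\<in>F. sc (c i) (a i)))\<^sup>2 \<le> K * sq_sum c F"
      by (intro eventually_finite_subsets_at_top_weakI upper)
  qed simp
qed

text \<open>Square summability of \<open>c\<close> is part of the conclusion. Each finite sum of
  squares is dominated by all later partial sums, whose norms tend to that of
  \<open>x\<close>.\<close>

lemma series_lower_bound:
  assumes lower: "\<And>F c. finite F \<Longrightarrow> F \<subseteq> I \<Longrightarrow>
      k * sq_sum c F \<le> (norm (\<Sum>i\<in>F. sc (c i) (a i)))\<^sup>2"
    and k: "k > 0" and x: "((\<lambda>i. sc (c i) (a i)) has_sum x) I"
  shows "\<exists>s. ((\<lambda>i. (cmod (c i))\<^sup>2) has_sum s) I \<and> k * s \<le> (norm x)\<^sup>2"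
proof -
  have bound: "k * sq_sum c F \<le> (norm x)\<^sup>2" if F: "finite F" "F \<subseteq> I" for F
  proof (rule tendsto_lowerbound)
    show "((\<lambda>F. (norm (\<Sum>i\<in>F. sc (c i) (a i)))\<^sup>2) \<longlongrightarrow> (norm x)\<^sup>2) (finite_subsets_at_top I)"
      using x unfolding has_sum_def by (intro tendsto_power tendsto_norm)
    have "k * sq_sum c F \<le> (norm (\<Sum>i\<in>F'. sc (c i) (a i)))\<^sup>2"
      if F': "finite F'" "F \<subseteq> F'" "F' \<subseteq> I" for F'
    proof -
      have "sq_sum c F \<le> sq_sum c F'"
        using F' by (intro sum_mono2) auto
      then have "k * sq_sum c F \<le> k * sq_sum c F'"
        using k by (intro mult_left_mono) auto
      also have "\<dots> \<le> (norm (\<Sum>i\<in>F'. sc (c i) (a i)))\<^sup>2"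
        by (rule lower) (use F' in auto)
      finally show ?thesis .
    qed
    then show "\<forall>\<^sub>F F' in finite_subsets_at_top I.
        k * sq_sum c F \<le> (norm (\<Sum>i\<in>F'. sc (c i) (a i)))\<^sup>2"
      unfolding eventually_finite_subsets_at_top using F by blast
  qed simp
  have le: "sq_sum c F \<le> (norm x)\<^sup>2 / k" if "finite F" "F \<subseteq> I" for F
    using bound[OF that] k by (simp add: pos_le_divide_eq mult.commute)
  have sum: "(\<lambda>i. (cmod (c i))\<^sup>2) summable_on I"
    using le by (intro nonneg_bdd_above_summable_on bdd_aboveI[of _ "(norm x)\<^sup>2 / k"]) auto
  have "(\<Sum>\<^sub>\<infinity>i\<in>I. (cmod (c i))\<^sup>2) \<le> (norm x)\<^sup>2 / k"
    by (rule infsum_le_finite_sums[OF sum le])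
  then show ?thesis
    using k has_sum_infsum[OF sum] by (intro exI conjI) (auto simp: pos_le_divide_eq mult.commute)
qed

end

lemma hs_closed_span_hilbert_schmidt: "T \<in> hs_closed_span A I \<Longrightarrow> hilbert_schmidt T"
  by (simp add: hs_closed_span_def)

lemma op_lincomb_eq_hs_apply:
  assumes "\<And>i. i \<in> F \<Longrightarrow> hilbert_schmidt (A i)"
  shows "op_lincomb c A F = hs_apply (\<Sum>i\<in>F. scaleC_hs (c i) (Abs_hs (A i)))"
  using assms by (simp add: fun_eq_iff op_lincomb_def hs_apply_sum scaleC_hs.rep_eq cong: sum.cong)

text \<open>The two-sided Riesz inequality, imposed on finite combinations only, so that no
  convergence has to be presupposed.\<close>

definition riesz_bounds :: "real \<Rightarrow> real \<Rightarrow> ('i \<Rightarrow> 'n::finite hs) \<Rightarrow> 'i set \<Rightarrow> bool" where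
  "riesz_bounds k K a I \<longleftrightarrow> (\<forall>F c. finite F \<longrightarrow> F \<subseteq> I \<longrightarrow>
    k * sq_sum c F \<le> (norm (\<Sum>i\<in>F. scaleC_hs (c i) (a i)))\<^sup>2 \<and>
    (norm (\<Sum>i\<in>F. scaleC_hs (c i) (a i)))\<^sup>2 \<le> K * sq_sum c F)"

text \<open>On finite combinations of the orthonormal basis the norm is the l2 norm of the
  coefficients. Applying \<open>U\<close> changes it at most by the bounds of \<open>U\<close> and
  of its inverse.\<close>

lemma riesz_basis_bounds:
  assumes "riesz_basis V A I"
  shows "\<exists>k K. k > 0 \<and> riesz_bounds k K (\<lambda>i. Abs_hs (A i)) I"
proof -
  obtain e U M M' where e: "hs_orthonormal_basis V e I" and A: "\<And>i. i \<in> I \<Longrightarrow> A i = U (e i)"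
    and UV: "bij_betw U V V"
    and lin: "\<And>S T a b. S \<in> V \<Longrightarrow> T \<in> V \<Longrightarrow>
      U (\<lambda>f. a *\<^sub>C S f + b *\<^sub>C T f) = (\<lambda>f. a *\<^sub>C U S f + b *\<^sub>C U T f)"
    and M: "\<And>S. S \<in> V \<Longrightarrow> hs_norm (U S) \<le> M * hs_norm S"
    and M': "\<And>S. S \<in> V \<Longrightarrow> hs_norm S \<le> M' * hs_norm (U S)"
    using assms unfolding riesz_basis_def boundedly_invertible_on_def by blast
  have V: "hs_closed_span e I = V" and eV: "\<And>i. i \<in> I \<Longrightarrow> e i \<in> V"
    using e by (auto simp: hs_orthonormal_basis_def)
  have hs: "hilbert_schmidt S" if "S \<in> V" for S
    using that V hs_closed_span_hilbert_schmidt by blast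
  have eo: "hs.orthonormal (\<lambda>i. Abs_hs (e i)) I"
    using e hs[OF eV] by (simp add: hs.orthonormal_def hs_orthonormal_basis_def cinner_hs.rep_eq)
  have UVin: "U S \<in> V" if "S \<in> V" for S
    using UV that by (auto simp: bij_betw_def)
  have hsA: "hilbert_schmidt (A i)" if "i \<in> I" for i
    using that by (simp add: A hs UVin eV)
  \<comment> \<open>\<open>U\<close> is linear and bounded on \<open>V\<close> only, so finite
    combinations must first be placed in \<open>V\<close>.\<close>
  have lcV: "op_lincomb c e F \<in> V" if "finite F" "F \<subseteq> I" for c F
  proof -
    have hs_e: "hilbert_schmidt (e i)" if "i \<in> F" for i
      using that \<open>F \<subseteq> I\<close> by (auto intro: hs eV)
    have lc: "hilbert_schmidt (op_lincomb c e F)"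
      by (simp add: op_lincomb_eq_hs_apply[OF hs_e])
    have "hs_norm (op_diff (op_lincomb c e F) (op_lincomb c e F)) = 0"
      by (subst hs_norm_op_diff_lincomb[OF hs_e lc])
        (simp_all add: op_lincomb_eq_hs_apply[OF hs_e] hs_apply_inverse)
    then have "\<forall>\<epsilon>>0. \<exists>F' c'. finite F' \<and> F' \<subseteq> I \<and>
        hs_norm (op_diff (op_lincomb c' e F') (op_lincomb c e F)) < \<epsilon>"
      using that by (intro allI impI exI[of _ F] exI[of _ c]) simp
    with lc show ?thesis
      unfolding V[symmetric] hs_closed_span_def by blast
  qed
  have Ulc: "U (op_lincomb c e F) = op_lincomb c A F" if "finite F" "F \<subseteq> I" for c F
    using that
  proof (induction F rule: finite_induct)
    case empty
    have "U (\<lambda>f. 0 *\<^sub>C op_lincomb c e {} f + 0 *\<^sub>C op_lincomb c e {} f) = (\<lambda>f. 0)"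
      by (subst lin) (simp_all add: lcV l2.sc_zero_left)
    then show ?case by (simp add: op_lincomb_def l2.sc_zero_left)
  next
    case (insert i F)
    have "U (\<lambda>f. c i *\<^sub>C e i f + 1 *\<^sub>C op_lincomb c e F f) = (\<lambda>f. c i *\<^sub>C A i f + 1 *\<^sub>C op_lincomb c A F f)"
      using insert by (subst lin) (simp_all add: lcV eV A)
    then show ?case using insert.hyps by (simp add: op_lincomb_def l2.sc_one)
  qed
  have norms: "(hs_norm (op_lincomb c e F))\<^sup>2 = sq_sum c F"
    "hs_norm (op_lincomb c A F) = norm (\<Sum>i\<in>F. scaleC_hs (c i) (Abs_hs (A i)))"
    if F: "finite F" "F \<subseteq> I" for c F
  proof -
    have "op_lincomb c e F = hs_apply (\<Sum>i\<in>F. scaleC_hs (c i) (Abs_hs (e i)))"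
      using F by (intro op_lincomb_eq_hs_apply) (auto intro: hs eV)
    then show "(hs_norm (op_lincomb c e F))\<^sup>2 = sq_sum c F"
      by (simp only: norm_hs_def[symmetric] hs.norm_orthonormal_sum[OF eo F])
    have "op_lincomb c A F = hs_apply (\<Sum>i\<in>F. scaleC_hs (c i) (Abs_hs (A i)))"
      using F by (intro op_lincomb_eq_hs_apply) (auto intro: hsA)
    then show "hs_norm (op_lincomb c A F) = norm (\<Sum>i\<in>F. scaleC_hs (c i) (Abs_hs (A i)))"
      by (simp only: norm_hs_def)
  qed
  \<comment> \<open>The definition says nothing about the sign of \<open>M'\<close>; enlarging it to
    this positive bound makes the lower Riesz constant positive.\<close>
  have pos: "\<bar>M'\<bar> + 1 > 0" by simp
  show ?thesis
    unfolding riesz_bounds_def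
  proof (rule exI[of _ "1 / (\<bar>M'\<bar> + 1)\<^sup>2"], rule exI[of _ "M\<^sup>2"], intro conjI allI impI)
    show "1 / (\<bar>M'\<bar> + 1)\<^sup>2 > 0" using pos by simp
    fix F c assume F: "finite F" "F \<subseteq> I"
    have nonneg: "hs_norm (op_lincomb c e F) \<ge> 0" "hs_norm (op_lincomb c A F) \<ge> 0"
      using lcV[OF F] UVin[OF lcV[OF F]] Ulc[OF F] by (auto intro!: hs_norm_nonneg hs)
    have "hs_norm (op_lincomb c e F) \<le> M' * hs_norm (op_lincomb c A F)"
      using M'[OF lcV[OF F]] by (simp add: Ulc[OF F])
    also have "\<dots> \<le> (\<bar>M'\<bar> + 1) * hs_norm (op_lincomb c A F)"
      using nonneg by (intro mult_right_mono) auto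
    finally have "(hs_norm (op_lincomb c e F))\<^sup>2 \<le> ((\<bar>M'\<bar> + 1) * hs_norm (op_lincomb c A F))\<^sup>2"
      using nonneg by (intro power_mono) auto
    then show "1 / (\<bar>M'\<bar> + 1)\<^sup>2 * sq_sum c F
        \<le> (norm (\<Sum>i\<in>F. scaleC_hs (c i) (Abs_hs (A i))))\<^sup>2"
      using pos by (simp add: norms[OF F] power_mult_distrib pos_divide_le_eq mult.commute)
    have "hs_norm (op_lincomb c A F) \<le> M * hs_norm (op_lincomb c e F)"
      using M[OF lcV[OF F]] by (simp add: Ulc[OF F])
    then have "(hs_norm (op_lincomb c A F))\<^sup>2 \<le> (M * hs_norm (op_lincomb c e F))\<^sup>2"
      using nonneg by (intro power_mono) auto
    then show "(norm (\<Sum>i\<in>F. scaleC_hs (c i) (Abs_hs (A i))))\<^sup>2 \<le> M\<^sup>2 * sq_sum c F"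
      by (simp add: norms[OF F] power_mult_distrib)
  qed
qed

section \<open>Orthonormal systems of characters\<close>

lemma tendsto_zero_power2_iff:
  fixes f :: "'b \<Rightarrow> complex"
  shows "(f \<longlongrightarrow> 0) F \<longleftrightarrow> ((\<lambda>x. (cmod (f x))\<^sup>2) \<longlongrightarrow> 0) F"
proof
  assume "((\<lambda>x. (cmod (f x))\<^sup>2) \<longlongrightarrow> 0) F"
  then have "((\<lambda>x. sqrt ((cmod (f x))\<^sup>2)) \<longlongrightarrow> sqrt 0) F" by (rule tendsto_real_sqrt)
  then show "(f \<longlongrightarrow> 0) F" by (simp add: tendsto_norm_zero_iff)
next
  assume "(f \<longlongrightarrow> 0) F"
  then have "((\<lambda>x. (cmod (f x))\<^sup>2) \<longlongrightarrow> (cmod 0)\<^sup>2) F" by (intro tendsto_intros)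
  then show "((\<lambda>x. (cmod (f x))\<^sup>2) \<longlongrightarrow> 0) F" by simp
qed

text \<open>Everything about the dual group that Fourier series depend on: a probability space and a
  total family of unimodular functions, indexed homomorphically by a subgroup \<open>L\<close>.
  Orthogonality reduces to \<open>integral_char\<close>, because a quotient of two characters is a
  character.\<close>

locale character_system = prob_space M
  for M :: "'a measure" and L :: "'g :: ab_group_add set" and ch :: "'g \<Rightarrow> 'a \<Rightarrow> complex" +
  assumes zero_L: "0 \<in> L"
    and diff_L: "l \<in> L \<Longrightarrow> m \<in> L \<Longrightarrow> l - m \<in> L"
    and measurable_char [measurable]: "l \<in> L \<Longrightarrow> ch l \<in> borel_measurable M"
    and char_add: "l \<in> L \<Longrightarrow> m \<in> L \<Longrightarrow> x \<in> space M \<Longrightarrow> ch (l + m) x = ch l x * ch m x"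
    and cmod_char: "l \<in> L \<Longrightarrow> x \<in> space M \<Longrightarrow> cmod (ch l x) = 1"
    and integral_char: "l \<in> L \<Longrightarrow> l \<noteq> 0 \<Longrightarrow> (\<integral>x. ch l x \<partial>M) = 0"
    and total: "f \<in> borel_measurable M \<Longrightarrow> integrable M (\<lambda>x. (cmod (f x))\<^sup>2) \<Longrightarrow>
      (\<And>l. l \<in> L \<Longrightarrow> (\<integral>x. f x * cnj (ch l x) \<partial>M) = 0) \<Longrightarrow> AE x in M. f x = 0"
begin

definition L2 :: "('a \<Rightarrow> complex) \<Rightarrow> bool" where
  "L2 f \<longleftrightarrow> f \<in> borel_measurable M \<and> integrable M (\<lambda>x. (cmod (f x))\<^sup>2)"

definition J :: "('a \<Rightarrow> complex) \<Rightarrow> ('a \<Rightarrow> complex) \<Rightarrow> complex" where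
  "J f g = (\<integral>x. f x * cnj (g x) \<partial>M)"

definition coef :: "('a \<Rightarrow> complex) \<Rightarrow> 'g \<Rightarrow> complex" where
  "coef f l = J f (ch l)"

definition trig :: "('g \<Rightarrow> complex) \<Rightarrow> 'g set \<Rightarrow> 'a \<Rightarrow> complex" where
  "trig c F x = (\<Sum>l\<in>F. c l * ch l x)"

abbreviation gap_tendsto_0 :: "('g \<Rightarrow> complex) \<Rightarrow> ('a \<Rightarrow> complex) \<Rightarrow> bool" where
  "gap_tendsto_0 c G \<equiv> ((\<lambda>F. L2_gap M (trig c F) G) \<longlongrightarrow> 0) (finite_subsets_at_top L)"

abbreviation L2_converges :: "('g \<Rightarrow> complex) \<Rightarrow> ('a \<Rightarrow> complex) \<Rightarrow> bool" where
  "L2_converges c G \<equiv> ((\<lambda>F. sq_norm M (\<lambda>x. trig c F x - G x)) \<longlongrightarrow> 0) (finite_subsets_at_top L)"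

lemma L2_cnj: "L2 f \<Longrightarrow> L2 (\<lambda>x. cnj (f x))"
  by (auto simp: L2_def intro!: borel_measurable_continuous_on[where f = cnj] continuous_intros)

lemma integrable_mult_cnj: "L2 f \<Longrightarrow> L2 g \<Longrightarrow> integrable M (\<lambda>x. f x * cnj (g x))"
  using L2_cnj[of g] by (intro integral_cmod_sq_Cauchy_Schwarz(1)) (auto simp: L2_def)

lemma J_Cauchy_Schwarz:
  "L2 f \<Longrightarrow> L2 g \<Longrightarrow> (cmod (J f g))\<^sup>2 \<le> sq_norm M f * sq_norm M g"
  using L2_cnj[of g] integral_cmod_sq_Cauchy_Schwarz(2)[of f M "\<lambda>x. cnj (g x)"] by (simp add: L2_def J_def)

lemma J_cnj: "cnj (J f g) = J g f"
proof -
  have "cnj (J f g) = (\<integral>x. cnj (f x * cnj (g x)) \<partial>M)"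
    unfolding J_def by (rule Bochner_Integration.integral_cnj[symmetric])
  then show ?thesis by (simp add: J_def mult.commute)
qed

lemma J_self: "J f f = of_real (sq_norm M f)"
  unfolding J_def by (simp only: complex_norm_square[symmetric] integral_complex_of_real)

lemma L2_bounded_mult:
  assumes f: "L2 f" and [measurable]: "g \<in> borel_measurable M" and g: "AE x in M. cmod (g x) \<le> B"
  shows "L2 (\<lambda>x. f x * g x)"
proof -
  have [measurable]: "f \<in> borel_measurable M" using f by (simp add: L2_def)
  have "integrable M (\<lambda>x. B\<^sup>2 * (cmod (f x))\<^sup>2)" using f by (simp add: L2_def)
  then have "integrable M (\<lambda>x. (cmod (f x * g x))\<^sup>2)"
  proof (rule Bochner_Integration.integrable_bound, measurable)
    show "AE x in M. norm ((cmod (f x * g x))\<^sup>2) \<le> norm (B\<^sup>2 * (cmod (f x))\<^sup>2)"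
      using g
    proof eventually_elim
      fix x assume "cmod (g x) \<le> B"
      then have "(cmod (g x))\<^sup>2 \<le> B\<^sup>2" by (intro power_mono) auto
      then show "norm ((cmod (f x * g x))\<^sup>2) \<le> norm (B\<^sup>2 * (cmod (f x))\<^sup>2)"
        using mult_right_mono[of "(cmod (g x))\<^sup>2" "B\<^sup>2" "(cmod (f x))\<^sup>2"]
        by (simp add: norm_mult power_mult_distrib mult.commute)
    qed
  qed
  then show ?thesis by (simp add: L2_def)
qed

lemma L2_bounded:
  assumes "g \<in> borel_measurable M" "AE x in M. cmod (g x) \<le> B"
  shows "L2 g"
  using L2_bounded_mult[of "\<lambda>x. 1" g B] assms by (simp add: L2_def)

lemma L2_char: "l \<in> L \<Longrightarrow> L2 (ch l)"
  by (rule L2_bounded[where B = 1]) (auto simp: cmod_char)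

lemma L2_scale: "L2 f \<Longrightarrow> L2 (\<lambda>x. c * f x)"
  by (auto simp: L2_def norm_mult power_mult_distrib)

lemma L2_add:
  assumes f: "L2 f" and g: "L2 g"
  shows "L2 (\<lambda>x. f x + g x)"
proof -
  have [measurable]: "f \<in> borel_measurable M" "g \<in> borel_measurable M"
    using f g by (auto simp: L2_def)
  have "integrable M (\<lambda>x. 2 * (cmod (f x))\<^sup>2 + 2 * (cmod (g x))\<^sup>2)"
    using f g by (simp add: L2_def)
  then have "integrable M (\<lambda>x. (cmod (f x + g x))\<^sup>2)"
    by (rule Bochner_Integration.integrable_bound, measurable)
      (intro AE_I2, use norm_add_sq_le[of "f _" "g _"] in simp)
  then show ?thesis by (simp add: L2_def)
qed

lemma L2_diff: "L2 f \<Longrightarrow> L2 g \<Longrightarrow> L2 (\<lambda>x. f x - g x)"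
  using L2_add[of f "\<lambda>x. - 1 * g x"] L2_scale[of g "- 1"] by simp

lemma L2_trig: "finite F \<Longrightarrow> F \<subseteq> L \<Longrightarrow> L2 (trig c F)"
proof (induction F rule: finite_induct)
  case empty
  show ?case by (simp add: trig_def L2_def)
next
  case (insert l F)
  then have "L2 (\<lambda>x. c l * ch l x + trig c F x)"
    by (intro L2_add L2_scale L2_char) auto
  then show ?case using insert.hyps by (simp add: trig_def[abs_def])
qed

lemma J_diff_left: "L2 f \<Longrightarrow> L2 g \<Longrightarrow> L2 h \<Longrightarrow> J (\<lambda>x. f x - g x) h = J f h - J g h"
  unfolding J_def left_diff_distrib
  by (intro Bochner_Integration.integral_diff integrable_mult_cnj)

lemma J_diff_right: "L2 f \<Longrightarrow> L2 g \<Longrightarrow> L2 h \<Longrightarrow> J h (\<lambda>x. f x - g x) = J h f - J h g"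
  by (metis J_cnj J_diff_left complex_cnj_diff)

lemma J_trig_left:
  assumes "finite F" "F \<subseteq> L" "L2 h"
  shows "J (trig c F) h = (\<Sum>l\<in>F. c l * J (ch l) h)"
proof -
  have "J (trig c F) h = (\<integral>x. (\<Sum>l\<in>F. c l * (ch l x * cnj (h x))) \<partial>M)"
    by (simp add: J_def trig_def sum_distrib_right mult.assoc)
  also have "\<dots> = (\<Sum>l\<in>F. c l * J (ch l) h)"
    using assms integrable_mult_cnj[OF L2_char]
    by (subst Bochner_Integration.integral_sum) (auto simp: J_def subset_iff)
  finally show ?thesis .
qed

lemma J_trig_right:
  assumes "finite F" "F \<subseteq> L" "L2 h"
  shows "J h (trig c F) = (\<Sum>l\<in>F. cnj (c l) * coef h l)"
  using arg_cong[OF J_trig_left[OF assms, of c], of cnj] by (simp add: J_cnj coef_def)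

lemma char_zero: "x \<in> space M \<Longrightarrow> ch 0 x = 1"
  using char_add[of 0 0 x] cmod_char[of 0 x] zero_L by force

lemma char_diff:
  assumes l: "l \<in> L" and m: "m \<in> L" and x: "x \<in> space M"
  shows "ch (l - m) x = ch l x * cnj (ch m x)"
proof -
  have "ch m x * cnj (ch m x) = 1"
    using cmod_char[OF m x] by (simp add: complex_norm_square[symmetric])
  moreover have "ch l x = ch (l - m) x * ch m x"
    using char_add[OF diff_L[OF l m] m x] by simp
  ultimately show ?thesis by (simp add: mult.assoc)
qed

lemma J_char:
  assumes "l \<in> L" "m \<in> L"
  shows "J (ch l) (ch m) = (if l = m then 1 else 0)"
proof -
  have "J (ch l) (ch m) = (\<integral>x. ch (l - m) x \<partial>M)"
    unfolding J_def by (intro Bochner_Integration.integral_cong) (simp_all add: char_diff assms)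
  moreover have "(\<integral>x. ch 0 x \<partial>M) = (\<integral>x. 1 \<partial>M)"
    by (intro Bochner_Integration.integral_cong) (simp_all add: char_zero)
  ultimately show ?thesis
    using integral_char[OF diff_L[OF assms]] by (simp add: prob_space)
qed

lemma coef_trig:
  assumes "finite F" "F \<subseteq> L" "l \<in> L"
  shows "coef (trig c F) l = (if l \<in> F then c l else 0)"
proof -
  have "coef (trig c F) l = (\<Sum>m\<in>F. if m = l then c m else 0)"
    unfolding coef_def J_trig_left[OF assms(1,2) L2_char[OF assms(3)]]
    using assms by (intro sum.cong) (auto simp: J_char)
  then show ?thesis using assms by simp
qed

lemma J_trig_trig:
  assumes "finite F" "F \<subseteq> L"
  shows "J (trig c F) (trig c F) = of_real (sq_sum c F)"
proof -
  have "J (trig c F) (trig c F) = (\<Sum>l\<in>F. cnj (c l) * c l)"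
    unfolding J_trig_right[OF assms L2_trig[OF assms]]
    by (intro sum.cong refl) (simp add: coef_trig assms subsetD[OF assms(2)])
  then show ?thesis by (simp add: complex_norm_square mult.commute del: of_real_power)
qed

lemma integral_trig:
  assumes "finite F" "F \<subseteq> L"
  shows "sq_norm M (trig c F) = sq_sum c F"
  using J_trig_trig[OF assms, of c] J_self[of "trig c F"] by (simp only: of_real_eq_iff)

lemma nn_integral_trig_diff:
  assumes "finite F" "F \<subseteq> L" "F' \<subseteq> F"
  shows "L2_gap M (trig c F) (trig c F') = ennreal (sq_sum c (F - F'))"
proof -
  have "trig c F x - trig c F' x = trig c (F - F') x" for x
    using assms by (simp add: trig_def sum_diff)
  moreover have "L2 (trig c (F - F'))" using assms by (intro L2_trig) auto
  moreover have "finite (F - F')" "F - F' \<subseteq> L" using assms by auto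
  ultimately show ?thesis
    by (simp add: nn_integral_eq_integral L2_def integral_trig)
qed

text \<open>The completeness lemma is about sequences, whereas the partial sums form a net. The
  limit is taken along an increasing sequence of finite sets that captures the sum of squares fast
  enough, and then shown to be the limit of the net.\<close>

lemma Riesz_Fischer:
  assumes c: "(\<lambda>l. (cmod (c l))\<^sup>2) summable_on L"
  shows "\<exists>G. G \<in> borel_measurable M \<and>
    gap_tendsto_0 c G"
proof -
  define w where "w F = sq_sum c F" for F
  obtain s where s: "(w \<longlongrightarrow> s) (finite_subsets_at_top L)"
    using c unfolding summable_on_def has_sum_def w_def[abs_def] by blast
  \<comment> \<open>The factor 1/2 is there because two sums, each near \<open>s\<close>, get
    subtracted; their difference is then at most (1/2)^n.\<close>
  have "\<exists>F0. finite F0 \<and> F0 \<subseteq> L \<and> (\<forall>F. finite F \<and> F0 \<subseteq> F \<and> F \<subseteq> L \<longrightarrow> dist (w F) s < (1/2) ^ n / 2)" for n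
    using tendstoD[OF s, of "(1/2) ^ n / 2"] unfolding eventually_finite_subsets_at_top by simp
  then obtain F0 where F0: "\<And>n. finite (F0 n)" "\<And>n. F0 n \<subseteq> L"
    and F0w: "\<And>n F. finite F \<Longrightarrow> F0 n \<subseteq> F \<Longrightarrow> F \<subseteq> L \<Longrightarrow> dist (w F) s < (1/2) ^ n / 2"
    by metis
  \<comment> \<open>Unions make the exhausting sets increasing, so that any two of them are nested
    and \<open>close\<close> applies.\<close>
  define E where "E n = (\<Union>k\<le>n. F0 k)" for n
  have E: "finite (E n)" "E n \<subseteq> L" for n using F0 by (auto simp: E_def)
  have E_mono: "E m \<subseteq> E n" if "m \<le> n" for m n
    unfolding E_def using that by (intro UN_mono) auto
  have FE: "F0 n \<subseteq> E n" for n by (auto simp: E_def)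
  have close: "L2_gap M (trig c F) (trig c (E n)) \<le> ennreal ((1/2) ^ n)"
    if F: "finite F" "F \<subseteq> L" "E n \<subseteq> F" for F n
  proof -
    have "sq_sum c (F - E n) = w F - w (E n)"
      using F by (simp add: w_def sum_diff)
    also have "\<dots> \<le> (1/2) ^ n"
      using F0w[OF F(1) order_trans[OF FE F(3)] F(2)] F0w[OF E(1) FE E(2), of n]
      unfolding dist_real_def by linarith
    finally show ?thesis
      unfolding nn_integral_trig_diff[OF F] by (rule ennreal_leI)
  qed
  have [measurable]: "trig c (E n) \<in> borel_measurable M" for n
    using L2_trig[OF E] by (simp add: L2_def)
  have pow: "(\<lambda>n. (1/2::real) ^ n) \<longlonglongrightarrow> 0" by (rule LIMSEQ_power_zero) simp
  obtain G where [measurable]: "G \<in> borel_measurable M"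
    and G: "(\<lambda>n. L2_gap M (trig c (E n)) G) \<longlonglongrightarrow> 0"
  proof (rule L2_Cauchy_limit[of "\<lambda>n. trig c (E n)" M])
    fix e :: real assume "e > 0"
    then obtain N where N: "(1/2) ^ N < e" using real_arch_pow_inv[of e "1/2"] by auto
    have le: "L2_gap M (trig c (E m)) (trig c (E n)) \<le> ennreal e"
      if "N \<le> n" "n \<le> m" for m n
    proof -
      have "(1/2::real) ^ n \<le> (1/2) ^ N" using that by (intro power_decreasing) auto
      with N have "(1/2) ^ n \<le> e" by linarith
      then have "ennreal ((1/2) ^ n) \<le> ennreal e" by (rule ennreal_leI)
      with close[OF E E_mono[OF that(2)]] show ?thesis by (rule order_trans)
    qed
    show "\<exists>N. \<forall>m\<ge>N. \<forall>n\<ge>N. (L2_gap M (trig c (E m)) (trig c (E n))) \<le> ennreal e"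
    proof (intro exI[of _ N] allI impI)
      fix m n assume "N \<le> m" "N \<le> n"
      then show "L2_gap M (trig c (E m)) (trig c (E n)) \<le> ennreal e"
        using le[of n m] le[of m n] by (cases "n \<le> m") (simp_all add: norm_minus_commute)
    qed
  qed auto
  have "gap_tendsto_0 c G"
  proof (rule order_tendstoI)
    fix e :: ennreal assume e: "0 < e"
    have "(\<lambda>n. 2 * ennreal ((1/2) ^ n) + 2 * L2_gap M (trig c (E n)) G)
        \<longlonglongrightarrow> 2 * ennreal 0 + 2 * 0"
      by (intro tendsto_add ennreal_tendsto_cmult G tendsto_ennrealI pow) auto
    then have "\<forall>\<^sub>F n in sequentially.
        2 * ennreal ((1/2) ^ n) + 2 * L2_gap M (trig c (E n)) G < e"
      using e by (intro order_tendstoD) auto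
    then obtain n where n: "2 * ennreal ((1/2) ^ n) + 2 * L2_gap M (trig c (E n)) G < e"
      by (auto simp: eventually_sequentially)
    have "L2_gap M (trig c F) G < e"
      if F: "finite F" "E n \<subseteq> F" "F \<subseteq> L" for F
    proof -
      have [measurable]: "trig c F \<in> borel_measurable M"
        using L2_trig[OF F(1,3)] by (simp add: L2_def)
      have "L2_gap M (trig c F) G
        \<le> 2 * L2_gap M (trig c F) (trig c (E n))
          + 2 * L2_gap M (trig c (E n)) G"
        by (rule nn_integral_cmod_sq_triangle) auto
      also have "\<dots> \<le> 2 * ennreal ((1/2) ^ n) + 2 * L2_gap M (trig c (E n)) G"
        by (intro add_right_mono mult_left_mono close F) auto
      finally show ?thesis using n by (rule le_less_trans)
    qed
    then show "\<forall>\<^sub>F F in finite_subsets_at_top L. (L2_gap M (trig c F) G) < e"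
      unfolding eventually_finite_subsets_at_top using E(1)[of n] E(2)[of n] by (intro exI[of _ "E n"]) simp
  qed simp
  then show ?thesis using \<open>G \<in> borel_measurable M\<close> by blast
qed

text \<open>The limit in \<open>symplectic_fourier\<close> is required to be measurable only, with
  an extended-valued gap. Some partial sum has gap below 1, so it differs from \<open>G\<close> by a
  square-integrable function; thereafter the gap is an ordinary integral.\<close>

lemma L2_limit:
  assumes [measurable]: "G \<in> borel_measurable M"
    and G: "gap_tendsto_0 c G"
  shows "L2 G" and "L2_converges c G"
proof -
  have "\<forall>\<^sub>F F in finite_subsets_at_top L. (L2_gap M (trig c F) G) < 1"
    using G by (rule order_tendstoD) simp
  then obtain F where F: "finite F" "F \<subseteq> L"
    and lt: "L2_gap M (trig c F) G < 1"
    unfolding eventually_finite_subsets_at_top by blast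
  note tF = L2_trig[OF F, of c]
  have [measurable]: "trig c F \<in> borel_measurable M" using tF by (simp add: L2_def)
  have "L2 (\<lambda>x. trig c F x - G x)"
    unfolding L2_def by (intro conjI integrableI_bounded) (use lt in \<open>auto intro: less_trans\<close>)
  from L2_diff[OF tF this] show L2G: "L2 G" by simp
  have eq: "\<forall>\<^sub>F F in finite_subsets_at_top L.
      (L2_gap M (trig c F) G) = ennreal (sq_norm M (\<lambda>x. trig c F x - G x))"
  proof (rule eventually_finite_subsets_at_top_weakI)
    fix F assume "finite F" "F \<subseteq> L"
    then have "L2 (\<lambda>x. trig c F x - G x)" by (intro L2_diff L2_trig L2G)
    then show "L2_gap M (trig c F) G = ennreal (sq_norm M (\<lambda>x. trig c F x - G x))"
      by (intro nn_integral_eq_integral) (auto simp: L2_def)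
  qed
  have "((\<lambda>F. ennreal (sq_norm M (\<lambda>x. trig c F x - G x))) \<longlongrightarrow> ennreal 0) (finite_subsets_at_top L)"
    using G tendsto_cong[OF eq] by simp
  then show "L2_converges c G"
    by (subst (asm) tendsto_ennreal_iff) auto
qed

text \<open>Pairing with a fixed square-integrable \<open>h\<close> is continuous by Cauchy-Schwarz.
  Suitable \<open>h\<close> turn this into the formulas for coefficients of limits and of
  products.\<close>

lemma tendsto_J_trig:
  assumes G: "L2 G" and lim: "L2_converges c G"
    and h: "L2 h"
  shows "((\<lambda>l. c l * J (ch l) h) has_sum J G h) L"
proof -
  have "((\<lambda>F. (cmod (J (trig c F) h - J G h))\<^sup>2) \<longlongrightarrow> 0) (finite_subsets_at_top L)"
  proof (rule tendsto_sandwich)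
    show "\<forall>\<^sub>F F in finite_subsets_at_top L. 0 \<le> (cmod (J (trig c F) h - J G h))\<^sup>2" by simp
    show "\<forall>\<^sub>F F in finite_subsets_at_top L. (cmod (J (trig c F) h - J G h))\<^sup>2
        \<le> sq_norm M (\<lambda>x. trig c F x - G x) * sq_norm M h"
    proof (rule eventually_finite_subsets_at_top_weakI)
      fix F assume "finite F" "F \<subseteq> L"
      then have t: "L2 (trig c F)" by (rule L2_trig)
      show "(cmod (J (trig c F) h - J G h))\<^sup>2
          \<le> sq_norm M (\<lambda>x. trig c F x - G x) * sq_norm M h"
        using J_Cauchy_Schwarz[OF L2_diff[OF t G] h] by (simp add: J_diff_left[OF t G h])
    qed
    show "((\<lambda>F. (sq_norm M (\<lambda>x. trig c F x - G x)) * sq_norm M h) \<longlongrightarrow> 0)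
        (finite_subsets_at_top L)"
      using tendsto_mult_right[OF lim] by simp
  qed simp
  then have "((\<lambda>F. J (trig c F) h - J G h) \<longlongrightarrow> 0) (finite_subsets_at_top L)"
    by (simp only: tendsto_zero_power2_iff)
  then have "((\<lambda>F. J (trig c F) h) \<longlongrightarrow> J G h) (finite_subsets_at_top L)"
    by (simp only: LIM_zero_iff)
  moreover have "\<forall>\<^sub>F F in finite_subsets_at_top L. J (trig c F) h = (\<Sum>l\<in>F. c l * J (ch l) h)"
    by (intro eventually_finite_subsets_at_top_weakI J_trig_left h)
  ultimately show ?thesis
    unfolding has_sum_def by (rule Lim_transform_eventually)
qed

lemma coef_limit:
  assumes G: "L2 G" and lim: "L2_converges c G"
    and l: "l \<in> L"
  shows "coef G l = c l"
proof -
  have "((\<lambda>m. c m * J (ch m) (ch l)) has_sum c l) L"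
    by (rule has_sum_finite_neutralI[of "{l}"]) (use l in \<open>auto simp: J_char\<close>)
  then show ?thesis
    using tendsto_J_trig[OF G lim L2_char[OF l]] unfolding coef_def by (rule has_sum_unique[rotated])
qed

text \<open>Pythagoras: the partial Fourier sum is the orthogonal projection of
  \<open>f\<close>.\<close>

lemma integral_diff_trig:
  assumes f: "L2 f" and F: "finite F" "F \<subseteq> L"
  shows "sq_norm M (\<lambda>x. trig (coef f) F x - f x)
    = sq_norm M f - sq_sum (coef f) F"
proof -
  let ?t = "trig (coef f) F" and ?w = "complex_of_real (sq_sum (coef f) F)"
  note t = L2_trig[OF F, of "coef f"]
  have ft: "J f ?t = ?w"
    unfolding J_trig_right[OF F f] by (simp add: complex_norm_square mult.commute del: of_real_power)
  then have tf: "J ?t f = ?w" using J_cnj[of f ?t] by simp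
  have "J (\<lambda>x. ?t x - f x) (\<lambda>x. ?t x - f x) = J f f - ?w"
    by (simp add: J_diff_left J_diff_right L2_diff t f ft tf J_trig_trig[OF F] del: of_real_sum)
  then show ?thesis
    unfolding J_self of_real_diff[symmetric] by (simp only: of_real_eq_iff)
qed

text \<open>Bessel and Riesz-Fischer give a \<open>G\<close> with the same coefficients as
  \<open>f\<close>; totality identifies the two almost everywhere, so the Fourier series converges
  to \<open>f\<close>.\<close>

lemma Parseval:
  assumes f: "L2 f"
  shows "((\<lambda>l. (cmod (coef f l))\<^sup>2) has_sum (sq_norm M f)) L"
    and "L2_converges (coef f) f"
proof -
  have "sq_sum (coef f) F \<le> sq_norm M f" if "finite F" "F \<subseteq> L" for F
    using integral_diff_trig[OF f that] Bochner_Integration.integral_nonneg[of M "\<lambda>x. (cmod (trig (coef f) F x - f x))\<^sup>2"] by simp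
  then have "(\<lambda>l. (cmod (coef f l))\<^sup>2) summable_on L"
    by (intro nonneg_bdd_above_summable_on bdd_aboveI[of _ "sq_norm M f"]) auto
  from Riesz_Fischer[OF this] obtain G where "G \<in> borel_measurable M"
    and "gap_tendsto_0 (coef f) G"
    by blast
  note G = L2_limit[OF this]
  have "AE x in M. f x - G x = 0"
  proof (rule total)
    have "L2 (\<lambda>x. f x - G x)" by (intro L2_diff f G)
    then show "(\<lambda>x. f x - G x) \<in> borel_measurable M" "integrable M (\<lambda>x. (cmod (f x - G x))\<^sup>2)"
      by (auto simp: L2_def)
    fix l assume l: "l \<in> L"
    have "J (\<lambda>x. f x - G x) (ch l) = coef f l - coef G l"
      by (simp add: J_diff_left f G L2_char l coef_def)
    then show "(\<integral>x. (f x - G x) * cnj (ch l x) \<partial>M) = 0"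
      using coef_limit[OF G l] by (simp add: J_def)
  qed
  then have AE: "AE x in M. f x = G x" by eventually_elim simp
  have [measurable]: "f \<in> borel_measurable M" "G \<in> borel_measurable M"
    using f G by (auto simp: L2_def)
  have "\<forall>\<^sub>F F in finite_subsets_at_top L.
      (sq_norm M (\<lambda>x. trig (coef f) F x - G x)) = sq_norm M (\<lambda>x. trig (coef f) F x - f x)"
  proof (rule eventually_finite_subsets_at_top_weakI)
    fix F assume "finite F" "F \<subseteq> L"
    then have [measurable]: "trig (coef f) F \<in> borel_measurable M"
      using L2_trig by (simp add: L2_def)
    show "sq_norm M (\<lambda>x. trig (coef f) F x - G x) = sq_norm M (\<lambda>x. trig (coef f) F x - f x)"
      by (rule integral_cong_AE) (measurable, use AE in auto)
  qed
  from tendsto_cong[OF this] G(2)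
  show lim: "L2_converges (coef f) f"
    by simp
  have "\<forall>\<^sub>F F in finite_subsets_at_top L. (sq_norm M (\<lambda>x. trig (coef f) F x - f x))
      = sq_norm M f - sq_sum (coef f) F"
    by (intro eventually_finite_subsets_at_top_weakI integral_diff_trig f)
  from tendsto_cong[OF this] lim
  have "((\<lambda>F. (sq_norm M f) - sq_sum (coef f) F) \<longlongrightarrow> 0) (finite_subsets_at_top L)"
    by simp
  from tendsto_diff[OF tendsto_const[of "sq_norm M f"] this]
  show "((\<lambda>l. (cmod (coef f l))\<^sup>2) has_sum (sq_norm M f)) L"
    unfolding has_sum_def by simp
qed

lemma J_char_left:
  assumes "l \<in> L" "m \<in> L"
  shows "J (ch m) (\<lambda>x. cnj (g x) * ch l x) = coef g (l - m)"
  unfolding coef_def J_def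
  by (intro Bochner_Integration.integral_cong) (simp_all add: char_diff assms)

text \<open>The factor \<open>g\<close> is moved to the other side of the pairing: the coefficient
  of the product is the inner product of \<open>f\<close> with \<open>cnj (g x) * ch l x\<close>,
  which is square integrable even when the product of \<open>f\<close> and \<open>g\<close> is
  not.\<close>

lemma coef_mult:
  assumes f: "L2 f" and g: "L2 g" and l: "l \<in> L"
  shows "((\<lambda>m. coef f m * coef g (l - m)) has_sum coef (\<lambda>x. f x * g x) l) L"
proof -
  have h: "L2 (\<lambda>x. cnj (g x) * ch l x)"
    by (rule L2_bounded_mult[OF L2_cnj[OF g], where B = 1]) (use l in \<open>auto simp: cmod_char\<close>)
  have "J f (\<lambda>x. cnj (g x) * ch l x) = coef (\<lambda>x. f x * g x) l"
    unfolding J_def coef_def by (simp add: mult.assoc)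
  with tendsto_J_trig[OF f Parseval(2)[OF f] h]
  have "((\<lambda>m. coef f m * J (ch m) (\<lambda>x. cnj (g x) * ch l x)) has_sum coef (\<lambda>x. f x * g x) l) L"
    by simp
  then show ?thesis
    by (rule has_sum_cong[THEN iffD1, rotated]) (simp add: J_char_left l)
qed

lemma coef_trig_mult:
  assumes F: "finite F" "F \<subseteq> L" and g: "L2 g" and l: "l \<in> L"
  shows "coef (\<lambda>x. trig c F x * g x) l = (\<Sum>m\<in>F. c m * coef g (l - m))"
proof -
  have h: "L2 (\<lambda>x. cnj (g x) * ch l x)"
    by (rule L2_bounded_mult[OF L2_cnj[OF g], where B = 1]) (use l in \<open>auto simp: cmod_char\<close>)
  have "coef (\<lambda>x. trig c F x * g x) l = J (trig c F) (\<lambda>x. cnj (g x) * ch l x)"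
    unfolding J_def coef_def by (simp add: mult.assoc)
  also have "\<dots> = (\<Sum>m\<in>F. c m * coef g (l - m))"
    unfolding J_trig_left[OF F h] using F l by (intro sum.cong) (auto simp: J_char_left)
  finally show ?thesis .
qed

lemma coef_diff: "L2 f \<Longrightarrow> L2 g \<Longrightarrow> l \<in> L \<Longrightarrow> coef (\<lambda>x. f x - g x) l = coef f l - coef g l"
  by (simp add: coef_def J_diff_left L2_char)

end

section \<open>Lattices and their adjoints\<close>

abbreviation sympl_char :: "'n::finite phase \<Rightarrow> 'n phase \<Rightarrow> complex" where
  "sympl_char l z \<equiv> cis (2 * pi * symplectic l z)"

lemma symplectic_add_left: "symplectic (z + z') w = symplectic z w + symplectic z' w"
  by (simp add: symplectic_def inner_add_left inner_add_right)

lemma symplectic_scaleR_left: "symplectic (r *\<^sub>R z) w = r * symplectic z w"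
  by (simp add: symplectic_def algebra_simps)

lemma symplectic_scaleR_right: "symplectic z (r *\<^sub>R w) = r * symplectic z w"
  by (simp add: symplectic_def algebra_simps)

lemma symplectic_zero_left [simp]: "symplectic 0 w = 0"
  by (simp add: symplectic_def)

lemma symplectic_zero_right [simp]: "symplectic w 0 = 0"
  by (simp add: symplectic_def)

lemma symplectic_diff_right: "symplectic z (w - w') = symplectic z w - symplectic z w'"
  by (simp add: symplectic_def algebra_simps)

lemma symplectic_sum_right: "symplectic w (\<Sum>i\<in>F. f i) = (\<Sum>i\<in>F. symplectic w (f i))"
  by (induction F rule: infinite_finite_induct) (auto simp: symplectic_add_right)

lemma symplectic_nondegenerate:
  assumes "\<And>w. symplectic z w = 0"
  shows "z = 0"
proof -
  have "symplectic z (snd z, - fst z) = snd z \<bullet> snd z + fst z \<bullet> fst z"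
    by (simp add: symplectic_def)
  with assms have "snd z \<bullet> snd z + fst z \<bullet> fst z = 0" by metis
  then have "snd z \<bullet> snd z = 0" "fst z \<bullet> fst z = 0"
    using inner_ge_zero[of "snd z"] inner_ge_zero[of "fst z"] by linarith+
  then show ?thesis by (simp add: prod_eq_iff)
qed

lemma continuous_on_symplectic [continuous_intros]:
  "continuous_on A f \<Longrightarrow> continuous_on A (\<lambda>x. symplectic z (f x))"
  unfolding symplectic_def by (intro continuous_intros)

lemma cis_2pi_eq_1_iff: "cis (2 * pi * r) = 1 \<longleftrightarrow> r \<in> \<int>"
proof
  assume "cis (2 * pi * r) = 1"
  then have "cos (2 * pi * r) = 1" by (simp add: complex_eq_iff)
  then obtain n :: int where "2 * pi * r = of_int n * (2 * pi)"
    by (auto simp: cos_one_2pi_int)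
  then have "r = of_int n" by simp
  then show "r \<in> \<int>" by simp
qed (auto elim!: Ints_cases simp: cis_multiple_2pi)

lemma Basis_phase: "(Basis :: 'n::finite phase set)
    = range (\<lambda>i. (axis i 1, 0)) \<union> range (\<lambda>i. (0, axis i 1))"
  by (auto simp: Basis_prod_def Basis_vec_def)

lemma ball_Basis_phase:
  "(\<forall>b\<in>Basis. P (z \<bullet> b)) \<longleftrightarrow> (\<forall>i. P (fst z $ i) \<and> P (snd z $ i))" for z :: "'n::finite phase"
  unfolding Basis_phase by (auto simp: ball_Un inner_prod_def inner_axis)

lemma integer_points_iff: "z \<in> integer_points \<longleftrightarrow> (\<forall>b\<in>Basis. z \<bullet> b \<in> \<int>)"
  using ball_Basis_phase[of "\<lambda>x. x \<in> \<int>" z] by (simp add: integer_points_def)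

lemma integer_points_zero: "0 \<in> integer_points"
  and integer_points_diff: "z \<in> integer_points \<Longrightarrow> w \<in> integer_points \<Longrightarrow> z - w \<in> integer_points"
  and Basis_integer_points: "b \<in> Basis \<Longrightarrow> b \<in> integer_points"
  by (auto simp: integer_points_iff inner_diff_left inner_Basis)

lemma lattice_basis_symplectic_Ints:
  assumes "lattice_basis B \<Lambda>"
  shows "(\<forall>l\<in>\<Lambda>. symplectic z l \<in> \<int>) \<longleftrightarrow> (\<forall>b\<in>Basis. symplectic z (B b) \<in> \<int>)"
proof
  assume *: "\<forall>b\<in>Basis. symplectic z (B b) \<in> \<int>"
  show "\<forall>l\<in>\<Lambda>. symplectic z l \<in> \<int>"
  proof
    fix l assume "l \<in> \<Lambda>"
    then obtain n where n: "n \<in> integer_points" "l = B n"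
      using assms by (auto simp: lattice_basis_def)
    have "B n = B (\<Sum>b\<in>Basis. (n \<bullet> b) *\<^sub>R b)"
      by (simp only: euclidean_representation)
    also have "\<dots> = (\<Sum>b\<in>Basis. (n \<bullet> b) *\<^sub>R B b)"
      using assms by (simp add: lattice_basis_def linear_sum linear_scale)
    finally have "symplectic z l = (\<Sum>b\<in>Basis. (n \<bullet> b) * symplectic z (B b))"
      using n by (simp add: symplectic_sum_right symplectic_scaleR_right)
    then show "symplectic z l \<in> \<int>"
      using * n by (auto simp: integer_points_iff intro!: Ints_sum Ints_mult)
  qed
qed (use assms Basis_integer_points in \<open>auto simp: lattice_basis_def\<close>)

lemma adjoint_lattice_iff: "z \<in> adjoint_lattice \<Lambda> \<longleftrightarrow> (\<forall>l\<in>\<Lambda>. symplectic z l \<in> \<int>)"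
  by (simp add: adjoint_lattice_def cis_2pi_eq_1_iff)

text \<open>Pairing with the generators of \<Lambda> is a linear map \<open>A\<close>, injective by
  nondegeneracy of the symplectic form, and the adjoint lattice is the preimage of the integer
  points. So the inverse of \<open>A\<close> is a basis map for it.\<close>

lemma adjoint_lattice_basis_exists:
  assumes B: "lattice_basis B \<Lambda>"
  shows "\<exists>C. lattice_basis C (adjoint_lattice \<Lambda>)"
proof -
  define A :: "'a phase \<Rightarrow> 'a phase" where "A z = (\<Sum>b\<in>Basis. symplectic z (B b) *\<^sub>R b)" for z
  have A: "A z \<bullet> b = symplectic z (B b)" if "b \<in> Basis" for z b
    using that by (simp add: A_def inner_sum_left inner_Basis if_distrib cong: if_cong)
  have linA: "linear A"
    by (rule linearI) (simp_all add: A_def symplectic_add_left symplectic_scaleR_left scaleR_add_left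
        sum.distrib scaleR_sum_right)
  have linB: "linear B" and surjB: "surj B"
    using B by (auto simp: lattice_basis_def bij_def)
  have "z = 0" if "A z = 0" for z
  proof (rule symplectic_nondegenerate)
    fix w
    obtain y where y: "w = B y" using surjB by (rule surjE)
    have "B y = B (\<Sum>b\<in>Basis. (y \<bullet> b) *\<^sub>R b)"
      by (simp only: euclidean_representation)
    also have "\<dots> = (\<Sum>b\<in>Basis. (y \<bullet> b) *\<^sub>R B b)"
      using linB by (simp add: linear_sum linear_scale)
    finally have "symplectic z w = (\<Sum>b\<in>Basis. (y \<bullet> b) * symplectic z (B b))"
      by (simp add: y symplectic_sum_right symplectic_scaleR_right)
    also have "\<dots> = (\<Sum>b\<in>Basis. (y \<bullet> b) * (A z \<bullet> b))"
      by (intro sum.cong) (simp_all add: A)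
    finally show "symplectic z w = 0" using that by simp
  qed
  then have "inj A" using linA by (simp add: linear_injective_0)
  then have bijA: "bij A"
    using linA linear_injective_imp_surjective[of A] by (simp add: bij_def)
  have "A -` integer_points = adjoint_lattice \<Lambda>"
    by (rule set_eqI) (simp add: adjoint_lattice_iff lattice_basis_symplectic_Ints[OF B] integer_points_iff A)
  then have "inv A ` integer_points = adjoint_lattice \<Lambda>"
    using bij_vimage_eq_inv_image[OF bijA, of integer_points] by simp
  then have "lattice_basis (inv A) (adjoint_lattice \<Lambda>)"
    using bij_imp_bij_inv[OF bijA] inj_linear_imp_inv_linear[OF linA bij_is_inj[OF bijA]]
    by (simp add: lattice_basis_def)
  then show ?thesis by blast
qed

section \<open>Integration over the fundamental cell\<close>

lemma integral_lborel_shift: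
  fixes f :: "'a::euclidean_space \<Rightarrow> 'b::{banach, second_countable_topology}"
  assumes [measurable]: "f \<in> borel_measurable borel"
  shows "(\<integral>z. f (a + z) \<partial>lborel) = (\<integral>z. f z \<partial>lborel)"
proof -
  have "(\<integral>z. f z \<partial>lborel) = (\<integral>z. f z \<partial>distr lborel borel ((+) a))"
    by (simp add: lborel_distr_plus)
  also have "\<dots> = (\<integral>z. f (a + z) \<partial>lborel)"
    by (subst integral_distr) auto
  finally show ?thesis by simp
qed

text \<open>By inner regularity, if \<open>r\<close> were positive on a non-null part of
  \<open>D\<close>, some compact \<open>K\<close> inside that part would have positive measure, and
  the integral of \<open>r\<close> over \<open>K\<close> would not vanish.\<close>

lemma AE_nonpos_if_compact_integrals_zero:
  fixes r :: "'a::euclidean_space \<Rightarrow> real"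
  assumes "finite_measure M" and sets: "sets M = sets borel" and r: "integrable M r"
    and D: "D \<in> sets borel" "AE z in M. z \<in> D"
    and zero: "\<And>K. compact K \<Longrightarrow> K \<subseteq> D \<Longrightarrow> (\<integral>z. indicator K z * r z \<partial>M) = 0"
  shows "AE z in M. r z \<le> 0"
proof -
  interpret finite_measure M by fact
  have [measurable]: "r \<in> borel_measurable M" using r by simp
  have [measurable]: "D \<in> sets M" using D sets by simp
  have space: "space M = UNIV" using sets_eq_imp_space_eq[OF sets] by simp
  define P where "P = {z \<in> space M. z \<in> D \<and> 0 < r z}"
  have P [measurable]: "P \<in> sets M" unfolding P_def by measurable
  have "emeasure M P = (SUP K \<in> {K. K \<subseteq> P \<and> compact K}. emeasure M K)"
    using sets P by (intro inner_regular) (auto simp: emeasure_eq_measure)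
  also have "\<dots> \<le> 0"
  proof (rule SUP_least, clarify)
    fix K assume K: "K \<subseteq> P" "compact K"
    then have [measurable]: "K \<in> sets M" using sets by (simp add: compact_imp_closed)
    have "AE z in M. indicator K z * r z = 0"
    proof (rule integral_nonneg_eq_0_iff_AE[THEN iffD1])
      show "integrable M (\<lambda>z. indicator K z * r z)"
        using integrable_real_mult_indicator[of K M r] r by (simp add: mult.commute)
      show "AE z in M. 0 \<le> indicator K z * r z"
        using K by (intro AE_I2) (auto simp: P_def indicator_def)
      show "(\<integral>z. indicator K z * r z \<partial>M) = 0"
        using K by (intro zero) (auto simp: P_def)
    qed
    then have "AE z in M. z \<notin> K"
      by eventually_elim (use K in \<open>auto simp: P_def indicator_def split: if_splits\<close>)
    then show "emeasure M K \<le> 0"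
      by (subst (asm) AE_iff_null_sets[symmetric]) auto
  qed
  finally have "AE z in M. z \<notin> P"
    using P by (subst AE_iff_null_sets[symmetric]) auto
  with D(2) show ?thesis
    by eventually_elim (auto simp: P_def space)
qed

text \<open>The adjoint basis \<open>C\<close> is a parameter because different bases give different
  cells; it is instantiated later with the one chosen inside
  \<open>fundamental_cell\<close>.\<close>

locale lattice_cell =
  fixes \<Lambda> :: "'n::finite phase set" and B C :: "'n phase \<Rightarrow> 'n phase"
  assumes basis: "lattice_basis B \<Lambda>" and adjoint_basis: "lattice_basis C (adjoint_lattice \<Lambda>)"
begin

definition cell :: "'n phase set" where
  "cell = C ` {z. \<forall>b\<in>Basis. 0 \<le> z \<bullet> b \<and> z \<bullet> b < 1}"

lemma linear_C: "linear C" and bij_C: "bij C" and linear_inv_C: "linear (inv C)"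
  using adjoint_basis
  by (auto simp: lattice_basis_def bij_def inj_linear_imp_inv_linear)

lemma inv_C_C [simp]: "inv C (C z) = z" and C_inv_C [simp]: "C (inv C z) = z"
  using bij_C by (auto simp: bij_def inj_imp_surj_inv surj_f_inv_f)

lemma cell_iff: "z \<in> cell \<longleftrightarrow> (\<forall>b\<in>Basis. 0 \<le> inv C z \<bullet> b \<and> inv C z \<bullet> b < 1)"
proof
  assume "\<forall>b\<in>Basis. 0 \<le> inv C z \<bullet> b \<and> inv C z \<bullet> b < 1"
  then show "z \<in> cell" unfolding cell_def by (intro image_eqI[of z C "inv C z"]) auto
qed (auto simp: cell_def)

lemma continuous_inv_C: "continuous_on A (inv C)"
  by (rule linear_continuous_on) (rule linear_conv_bounded_linear[THEN iffD1, OF linear_inv_C])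

lemma borel_measurable_inv_C [measurable]: "inv C \<in> borel_measurable borel"
  by (intro borel_measurable_continuous_onI continuous_inv_C)

lemma cell_measurable [measurable]: "cell \<in> sets borel"
proof -
  have "cell = {z \<in> space borel. \<forall>b\<in>Basis. 0 \<le> inv C z \<bullet> b \<and> inv C z \<bullet> b < 1}"
    by (auto simp: cell_iff)
  also have "\<dots> \<in> sets borel" by measurable
  finally show ?thesis .
qed

lemma bounded_cell: "bounded cell"
proof -
  have "{z :: 'n phase. \<forall>b\<in>Basis. 0 \<le> z \<bullet> b \<and> z \<bullet> b < 1} \<subseteq> cbox 0 One"
    by (auto simp: mem_box less_imp_le)
  then have "bounded {z :: 'n phase. \<forall>b\<in>Basis. 0 \<le> z \<bullet> b \<and> z \<bullet> b < 1}"
    using bounded_cbox bounded_subset by blast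
  then show ?thesis
    unfolding cell_def
    by (rule bounded_linear_image) (rule linear_conv_bounded_linear[THEN iffD1, OF linear_C])
qed

lemma emeasure_cell: "emeasure lborel cell \<noteq> 0" "emeasure lborel cell \<noteq> \<infinity>"
proof -
  show "emeasure lborel cell \<noteq> \<infinity>"
    using emeasure_bounded_finite[OF bounded_cell] by simp
  define U where "U = inv C -` box 0 One"
  have U: "open U" unfolding U_def
    by (rule open_vimage) (auto intro: continuous_inv_C)
  have "C ((1/2) *\<^sub>R One) \<in> U" by (simp add: U_def mem_box)
  then have "\<not> negligible U" using open_not_negligible[OF U] by blast
  have "U \<subseteq> cell" by (auto simp: U_def cell_iff mem_box less_imp_le)
  show "emeasure lborel cell \<noteq> 0"
  proof
    assume "emeasure lborel cell = 0"
    then have "cell \<in> null_sets lborel" by (intro null_setsI) auto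
    then have "cell \<in> null_sets lebesgue" by (rule null_sets_completionI)
    then have "negligible cell" by (simp add: negligible_iff_null_sets)
    with \<open>U \<subseteq> cell\<close> \<open>\<not> negligible U\<close> show False using negligible_subset by blast
  qed
qed

definition \<mu> :: "'n phase measure" where
  "\<mu> = uniform_measure lborel cell"

lemma sets_\<mu> [measurable_cong]: "sets \<mu> = sets borel"
  by (simp add: \<mu>_def)

lemma prob_space_\<mu>: "prob_space \<mu>"
  unfolding \<mu>_def using emeasure_cell by (rule prob_space_uniform_measure)

lemma AE_\<mu>: "AE z in \<mu>. z \<in> cell"
  unfolding \<mu>_def by (rule AE_uniform_measureI) auto

lemma integral_\<mu>:
  fixes f :: "'n phase \<Rightarrow> complex"
  assumes [measurable]: "f \<in> borel_measurable borel"
  shows "(\<integral>z. f z \<partial>\<mu>) = (\<integral>z. indicator cell z *\<^sub>R f z \<partial>lborel) /\<^sub>R measure lborel cell"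
proof -
  have m: "measure lborel cell > 0"
    using emeasure_cell by (simp add: measure_def enn2real_positive_iff less_top zero_less_iff_neq_zero)
  have "\<mu> = density lborel (\<lambda>z. ennreal (indicator cell z / measure lborel cell))"
    unfolding \<mu>_def uniform_measure_def using emeasure_cell m
    by (intro density_cong)
      (auto simp: emeasure_eq_ennreal_measure divide_ennreal[symmetric] ennreal_indicator indicator_def)
  then have "(\<integral>z. f z \<partial>\<mu>) = (\<integral>z. (indicator cell z / measure lborel cell) *\<^sub>R f z \<partial>lborel)"
    using m by (simp add: integral_density)
  also have "\<dots> = (\<integral>z. (indicator cell z *\<^sub>R f z) /\<^sub>R measure lborel cell \<partial>lborel)"
    by (simp add: divide_inverse mult.commute)
  also have "\<dots> = (\<integral>z. indicator cell z *\<^sub>R f z \<partial>lborel) /\<^sub>R measure lborel cell"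
    by (rule integral_scaleR_right)
  finally show ?thesis .
qed

text \<open>Translating by half a period of a nontrivial character changes its sign, whereas the integral
  of a periodic function over the cell is translation invariant: the part of the cell pushed out on
  one side reappears, shifted by a basis vector of the adjoint lattice, on the other.\<close>

lemma integral_character_cell:
  assumes l: "l \<in> \<Lambda>" "l \<noteq> 0"
  shows "(\<integral>z. sympl_char l z \<partial>\<mu>) = 0"
proof -
  define g where "g z = sympl_char l z" for z
  have [measurable]: "g \<in> borel_measurable borel"
    unfolding g_def by (intro borel_measurable_continuous_onI continuous_intros)
  let ?I = "\<lambda>A. \<integral>z. indicator A z *\<^sub>R g z \<partial>lborel"
  have "\<exists>b\<in>Basis. symplectic l (C b) \<noteq> 0"
  proof (rule ccontr)
    assume "\<not> ?thesis"
    then have *: "symplectic l (C b) = 0" if "b \<in> Basis" for b using that by blast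
    have "symplectic l w = 0" for w
    proof -
      have "C (inv C w) = C (\<Sum>b\<in>Basis. (inv C w \<bullet> b) *\<^sub>R b)"
        by (simp only: euclidean_representation)
      also have "\<dots> = (\<Sum>b\<in>Basis. (inv C w \<bullet> b) *\<^sub>R C b)"
        using linear_C by (simp add: linear_sum linear_scale)
      finally have "w = (\<Sum>b\<in>Basis. (inv C w \<bullet> b) *\<^sub>R C b)" by simp
      from arg_cong[OF this, of "symplectic l"] show ?thesis
        by (simp add: symplectic_sum_right symplectic_scaleR_right *)
    qed
    then show False using symplectic_nondegenerate l(2) by blast
  qed
  then obtain b where b: "b \<in> Basis" and nz: "symplectic l (C b) \<noteq> 0" by blast
  define n where "n = symplectic l (C b)"
  have "C b \<in> adjoint_lattice \<Lambda>"
    using adjoint_basis Basis_integer_points[OF b] by (auto simp: lattice_basis_def)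
  then have n: "n \<in> \<int>"
    using l(1) symplectic_commute[of l "C b"] by (simp add: adjoint_lattice_iff n_def)
  then have "\<bar>n\<bar> \<ge> 1" using nz Ints_nonzero_abs_ge1 by (simp add: n_def)
  \<comment> \<open>Moving by \<open>t\<close> along \<open>C b\<close> changes the phase by half a
    turn. As \<open>n\<close> is a nonzero integer, t \<le> 1/2, so the shift is shorter than the
    cell.\<close>
  define t where "t = 1 / (2 * \<bar>n\<bar>)"
  have t: "0 < t" "t < 1" using \<open>\<bar>n\<bar> \<ge> 1\<close> by (auto simp: t_def field_simps)
  define z0 where "z0 = t *\<^sub>R C b"
  have "n * t = 1/2 \<or> n * t = - (1/2)"
    using \<open>\<bar>n\<bar> \<ge> 1\<close> by (auto simp: t_def field_simps abs_if split: if_splits)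
  then have "2 * pi * (n * t) = pi \<or> 2 * pi * (n * t) = - pi" by auto
  moreover have "cis pi = - 1" "cis (- pi) = - 1" by (simp_all add: complex_eq_iff)
  ultimately have half: "cis (2 * pi * (n * t)) = - 1" by metis
  have g_z0: "g (z0 + z) = - g z" for z
    using half
    by (simp add: g_def z0_def symplectic_add_right symplectic_scaleR_right distrib_left
        cis_mult[symmetric] n_def[symmetric] mult.commute)
  have g_Cb: "g (z - C b) = g z" for z
  proof -
    have "sympl_char l (z - C b) * cis (2 * pi * n) = sympl_char l z"
      by (simp add: cis_mult symplectic_diff_right n_def algebra_simps)
    then show ?thesis using n by (simp add: g_def cis_2pi_eq_1_iff)
  qed
  define p where "p z = inv C z \<bullet> b" for z
  have [measurable]: "p \<in> borel_measurable borel" unfolding p_def by measurable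
  \<comment> \<open>\<open>D1\<close> is the part of the cell that remains inside after the shift by
    \<open>z0\<close>; \<open>D2\<close> is the part that leaves and returns on subtracting
    \<open>C b\<close>.\<close>
  define D1 where "D1 = cell \<inter> {z. p z < 1 - t}"
  define D2 where "D2 = cell \<inter> {z. \<not> p z < 1 - t}"
  have [measurable]: "D1 \<in> sets borel" "D2 \<in> sets borel" unfolding D1_def D2_def by measurable
  have coord: "inv C (y - z0) \<bullet> b' = inv C y \<bullet> b' - (if b' = b then t else 0)"
    "inv C (y - z0 + C b) \<bullet> b' = inv C y \<bullet> b' - (if b' = b then t - 1 else 0)"
    if "b' \<in> Basis" for y b'
    using that b linear_diff[OF linear_inv_C] linear_add[OF linear_inv_C] linear_scale[OF linear_inv_C]
    by (auto simp: z0_def inner_diff_left inner_add_left inner_Basis)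
  define rest where "rest z \<longleftrightarrow> (\<forall>b'\<in>Basis - {b}. 0 \<le> inv C z \<bullet> b' \<and> inv C z \<bullet> b' < 1)" for z
  have cell_rest: "z \<in> cell \<longleftrightarrow> rest z \<and> 0 \<le> p z \<and> p z < 1" for z
    using b unfolding cell_iff rest_def p_def by blast
  have rest: "rest (y - z0) = rest y" "rest (y - z0 + C b) = rest y" for y
    unfolding rest_def by (simp_all add: coord)
  have p: "p (y - z0) = p y - t" "p (y - z0 + C b) = p y - t + 1" for y
    unfolding p_def by (simp_all add: coord b)
  have D1_iff: "y - z0 \<in> D1 \<longleftrightarrow> y \<in> cell \<and> t \<le> p y" for y
    unfolding D1_def Int_iff mem_Collect_eq cell_rest rest p using t by auto
  have D2_iff: "y - z0 + C b \<in> D2 \<longleftrightarrow> y \<in> cell \<and> p y < t" for y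
    unfolding D2_def Int_iff mem_Collect_eq cell_rest rest p using t by auto
  have int: "integrable lborel (\<lambda>z. indicator A z *\<^sub>R g z)" if [measurable]: "A \<in> sets borel" "A \<subseteq> cell" for A
  proof (rule integrableI_bounded_set_indicator[of A lborel g 1])
    show "emeasure lborel A < \<infinity>"
      using bounded_subset[OF bounded_cell \<open>A \<subseteq> cell\<close>] by (rule emeasure_bounded_finite)
  qed (auto simp: g_def)
  have split: "?I cell = ?I D1 + ?I D2"
  proof -
    have "indicator cell z *\<^sub>R g z = indicator D1 z *\<^sub>R g z + indicator D2 z *\<^sub>R g z" for z
      by (auto simp: D1_def D2_def indicator_def)
    then show ?thesis
      using int[of D1] int[of D2] by (simp add: D1_def D2_def)
  qed
  have shift1: "(\<integral>y. indicator D1 (y - z0) *\<^sub>R g y \<partial>lborel) = - ?I D1"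
    using integral_lborel_shift[of "\<lambda>y. indicator D1 (y - z0) *\<^sub>R g y" z0]
    by (simp add: g_z0)
  have shift2: "(\<integral>y. indicator D2 (y - z0 + C b) *\<^sub>R g y \<partial>lborel) = - ?I D2"
  proof -
    have "g (z0 - C b + z) = - g z" for z
      using g_z0[of "z"] g_Cb[of "z0 + z"] by (simp add: algebra_simps)
    then show ?thesis
      using integral_lborel_shift[of "\<lambda>y. indicator D2 (y - z0 + C b) *\<^sub>R g y" "z0 - C b"] by simp
  qed
  have "indicator cell y *\<^sub>R g y
      = indicator D1 (y - z0) *\<^sub>R g y + indicator D2 (y - z0 + C b) *\<^sub>R g y" for y
    by (auto simp: indicator_def D1_iff D2_iff)
  moreover have "integrable lborel (\<lambda>y. indicator D1 (y - z0) *\<^sub>R g y)"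
  proof -
    have "(\<lambda>y. indicator D1 (y - z0) *\<^sub>R g y) = (\<lambda>y. indicator (cell \<inter> {y. t \<le> p y}) y *\<^sub>R g y)"
      by (auto simp: indicator_def D1_iff)
    then show ?thesis using int[of "cell \<inter> {y. t \<le> p y}"] by simp
  qed
  moreover have "integrable lborel (\<lambda>y. indicator D2 (y - z0 + C b) *\<^sub>R g y)"
  proof -
    have "(\<lambda>y. indicator D2 (y - z0 + C b) *\<^sub>R g y) = (\<lambda>y. indicator (cell \<inter> {y. p y < t}) y *\<^sub>R g y)"
      by (auto simp: indicator_def D2_iff)
    then show ?thesis using int[of "cell \<inter> {y. p y < t}"] by simp
  qed
  ultimately have "?I cell
      = (\<integral>y. indicator D1 (y - z0) *\<^sub>R g y \<partial>lborel) + (\<integral>y. indicator D2 (y - z0 + C b) *\<^sub>R g y \<partial>lborel)"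
    by simp
  also have "\<dots> = - ?I cell"
    unfolding shift1 shift2 split by simp
  finally have "?I cell = 0"
    by simp
  then have "(\<integral>z. g z \<partial>\<mu>) = 0"
    by (simp add: integral_\<mu>)
  then show ?thesis by (simp add: g_def[abs_def])
qed

end

section \<open>The characters of the dual group form an orthonormal basis\<close>

text \<open>The rules build finite sums of characters, so that a linear property checked on
  characters extends by induction. Closure under products is derived from closure of the lattice
  under addition.\<close>

inductive trig_poly :: "'n::finite phase set \<Rightarrow> ('n phase \<Rightarrow> complex) \<Rightarrow> bool" for \<Lambda> where
  char: "l \<in> \<Lambda> \<Longrightarrow> trig_poly \<Lambda> (\<lambda>z. a * sympl_char l z)"
| add: "trig_poly \<Lambda> u \<Longrightarrow> trig_poly \<Lambda> v \<Longrightarrow> trig_poly \<Lambda> (\<lambda>z. u z + v z)"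

context lattice_cell
begin

lemma zero_lattice: "0 \<in> \<Lambda>"
  and diff_lattice: "l \<in> \<Lambda> \<Longrightarrow> m \<in> \<Lambda> \<Longrightarrow> l - m \<in> \<Lambda>"
  and basis_lattice: "b \<in> Basis \<Longrightarrow> B b \<in> \<Lambda>"
proof -
  have B: "linear B" "\<Lambda> = B ` integer_points" using basis by (auto simp: lattice_basis_def)
  show "0 \<in> \<Lambda>"
    using image_eqI[of 0 B 0, OF _ integer_points_zero] B by (simp add: linear_0)
  show "b \<in> Basis \<Longrightarrow> B b \<in> \<Lambda>"
    using B Basis_integer_points by blast
  show "l - m \<in> \<Lambda>" if lm: "l \<in> \<Lambda>" "m \<in> \<Lambda>"
  proof -
    obtain x y where "x \<in> integer_points" "l = B x" "y \<in> integer_points" "m = B y"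
      using lm B(2) by blast
    then show ?thesis
      using image_eqI[of "l - m" B "x - y", OF _ integer_points_diff] B by (simp add: linear_diff)
  qed
qed

lemma uminus_lattice: "l \<in> \<Lambda> \<Longrightarrow> - l \<in> \<Lambda>"
  using diff_lattice[OF zero_lattice, of l] by simp

lemma add_lattice: "l \<in> \<Lambda> \<Longrightarrow> m \<in> \<Lambda> \<Longrightarrow> l + m \<in> \<Lambda>"
  using diff_lattice[of l "- m"] uminus_lattice by simp

lemma symplectic_uminus_left: "symplectic (- l) z = - symplectic l z"
  by (simp add: symplectic_def)

lemma trig_poly_const: "trig_poly \<Lambda> (\<lambda>z. a)"
  using trig_poly.char[OF zero_lattice, of a] by simp

lemma trig_poly_mult:
  assumes "trig_poly \<Lambda> u" "trig_poly \<Lambda> v"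
  shows "trig_poly \<Lambda> (\<lambda>z. u z * v z)"
  using assms
proof (induction u)
  case (char l a)
  show ?case using char(2)
  proof (induction v)
    case (char m b)
    have "trig_poly \<Lambda> (\<lambda>z. (a * b) * sympl_char (l + m) z)"
      by (intro trig_poly.char add_lattice char \<open>l \<in> \<Lambda>\<close>)
    then show ?case
      by (simp add: symplectic_add_left distrib_left cis_mult[symmetric] mult_ac)
  next
    case (add u v)
    then show ?case by (simp add: distrib_left trig_poly.add)
  qed
next
  case (add u u')
  then show ?case by (simp add: distrib_right trig_poly.add)
qed

lemma trig_poly_sum:
  assumes "\<And>i. i \<in> F \<Longrightarrow> trig_poly \<Lambda> (u i)"
  shows "trig_poly \<Lambda> (\<lambda>z. \<Sum>i\<in>F. u i z)"
  using assms
proof (induction F rule: infinite_finite_induct)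
  case (insert i F)
  then show ?case using trig_poly.add[of \<Lambda> "u i" "\<lambda>z. \<Sum>i\<in>F. u i z"] by simp
qed (use trig_poly_const[of 0] in auto)

lemma trig_poly_cos_sin:
  assumes l: "l \<in> \<Lambda>"
  shows "trig_poly \<Lambda> (\<lambda>z. of_real (cos (2 * pi * symplectic l z)))"
    and "trig_poly \<Lambda> (\<lambda>z. of_real (sin (2 * pi * symplectic l z)))"
proof -
  have "(\<lambda>z. complex_of_real (cos (2 * pi * symplectic l z)))
      = (\<lambda>z. (1/2) * sympl_char l z + (1/2) * sympl_char (- l) z)"
    by (auto simp: complex_eq_iff symplectic_uminus_left)
  then show "trig_poly \<Lambda> (\<lambda>z. of_real (cos (2 * pi * symplectic l z)))"
    using trig_poly.add[OF trig_poly.char[OF l, of "1/2"] trig_poly.char[OF uminus_lattice[OF l], of "1/2"]]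
    by simp
  have "(\<lambda>z. complex_of_real (sin (2 * pi * symplectic l z)))
      = (\<lambda>z. (- \<i>/2) * sympl_char l z + (\<i>/2) * sympl_char (- l) z)"
    by (auto simp: complex_eq_iff symplectic_uminus_left)
  then show "trig_poly \<Lambda> (\<lambda>z. of_real (sin (2 * pi * symplectic l z)))"
    using trig_poly.add[OF trig_poly.char[OF l, of "- \<i>/2"] trig_poly.char[OF uminus_lattice[OF l], of "\<i>/2"]]
    by simp
qed

text \<open>The dual group is embedded in a Euclidean space as a torus, so that uniform approximation by
  polynomials becomes approximation by trigonometric polynomials.\<close>

definition torus :: "'n phase \<Rightarrow> 'n phase \<times> 'n phase" where
  "torus z = ((\<Sum>b\<in>Basis. cos (2 * pi * symplectic (B b) z) *\<^sub>R b),
    (\<Sum>b\<in>Basis. sin (2 * pi * symplectic (B b) z) *\<^sub>R b))"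

lemma continuous_torus: "continuous_on A torus"
  unfolding torus_def by (intro continuous_intros)

text \<open>A crude bound; it provides one compact ball on which polynomials can approximate
  uniformly.\<close>

lemma norm_torus_le: "norm (torus z) \<le> 2 * DIM('n phase)"
proof -
  have le: "norm (\<Sum>b\<in>Basis. f b *\<^sub>R b) \<le> DIM('n phase)" if "\<And>b. \<bar>f b\<bar> \<le> 1" for f :: "'n phase \<Rightarrow> real"
  proof -
    have "norm (\<Sum>b\<in>Basis. f b *\<^sub>R b) \<le> (\<Sum>b\<in>(Basis :: 'n phase set). 1)"
      using that by (intro sum_norm_le) simp
    then show ?thesis by simp
  qed
  have "norm (torus z) \<le> norm (fst (torus z)) + norm (snd (torus z))"
    using norm_Pair_le[of "fst (torus z)" "snd (torus z)"] by simp
  also have "\<dots> \<le> real DIM('n phase) + real DIM('n phase)"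
    unfolding torus_def fst_conv snd_conv by (intro add_mono le) auto
  finally show ?thesis by simp
qed

text \<open>Equal torus coordinates mean equal characters at the generators, so the two points
  differ by an element of the adjoint lattice. In the coordinates of the cell that element is an
  integer vector with entries of modulus below 1, hence zero.\<close>

lemma inj_on_torus: "inj_on torus cell"
proof (rule inj_onI)
  fix z w assume z: "z \<in> cell" and w: "w \<in> cell" and eq: "torus z = torus w"
  have "symplectic (z - w) (B b) \<in> \<int>" if b: "b \<in> Basis" for b
  proof -
    have coord: "(\<Sum>b'\<in>Basis. f b' *\<^sub>R b') \<bullet> b = f b" for f :: "'n phase \<Rightarrow> real"
      using b by (simp add: inner_sum_left inner_Basis if_distrib cong: if_cong)
    have "fst (torus z) \<bullet> b = fst (torus w) \<bullet> b" "snd (torus z) \<bullet> b = snd (torus w) \<bullet> b"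
      using eq by simp_all
    then have "sympl_char (B b) z = sympl_char (B b) w"
      by (simp add: torus_def coord complex_eq_iff)
    then have "cis (2 * pi * symplectic (B b) z - 2 * pi * symplectic (B b) w) = 1"
      by (simp add: cis_divide[symmetric])
    then have "sympl_char (B b) (z - w) = 1"
      by (simp add: symplectic_diff_right right_diff_distrib)
    then have "symplectic (B b) (z - w) \<in> \<int>" by (simp add: cis_2pi_eq_1_iff)
    then show ?thesis
      using symplectic_commute[of "z - w" "B b"] by simp
  qed
  then have "z - w \<in> adjoint_lattice \<Lambda>"
    by (simp add: adjoint_lattice_iff lattice_basis_symplectic_Ints[OF basis])
  then obtain n where n: "n \<in> integer_points" "z - w = C n"
    using adjoint_basis by (auto simp: lattice_basis_def)
  then have "inv C z - inv C w = n"
    using linear_diff[OF linear_inv_C, of z w] by simp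
  have "n \<bullet> b = 0 \<bullet> b" if b: "b \<in> Basis" for b
  proof -
    have "n \<bullet> b \<in> \<int>" using n b by (simp add: integer_points_iff)
    moreover have "\<bar>n \<bullet> b\<bar> < 1"
      using z w b unfolding \<open>inv C z - inv C w = n\<close>[symmetric] cell_iff
      by (auto simp: inner_diff_left abs_less_iff) force+
    ultimately show ?thesis using Ints_nonzero_abs_less1 by auto
  qed
  then have "n = 0" by (rule euclidean_eqI)
  then show "z = w" using n(2) linear_0[OF linear_C] by simp
qed

text \<open>A linear functional of the torus coordinates is a combination of cosines and sines of
  generators; sums and products of trigonometric polynomials do the rest.\<close>

lemma trig_poly_real_polynomial:
  fixes p :: "'n phase \<times> 'n phase \<Rightarrow> real"
  assumes "real_polynomial_function p"
  shows "trig_poly \<Lambda> (\<lambda>z. of_real (p (torus z)))"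
  using assms
proof (induction p)
  case (linear p)
  interpret bounded_linear p by fact
  have "p (torus z) = (\<Sum>b\<in>Basis. cos (2 * pi * symplectic (B b) z) * p (b, 0))
      + (\<Sum>b\<in>Basis. sin (2 * pi * symplectic (B b) z) * p (0, b))" for z
  proof -
    have "torus z = (\<Sum>b\<in>Basis. cos (2 * pi * symplectic (B b) z) *\<^sub>R (b, 0))
        + (\<Sum>b\<in>Basis. sin (2 * pi * symplectic (B b) z) *\<^sub>R (0, b))"
      by (simp add: torus_def prod_eq_iff fst_sum snd_sum)
    then show ?thesis by (simp only: add sum scaleR real_scaleR_def)
  qed
  then show ?case
    by (simp only: of_real_add of_real_sum of_real_mult)
      (intro trig_poly.add trig_poly_sum trig_poly_mult trig_poly_const trig_poly_cos_sin basis_lattice)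
next
  case (const c)
  then show ?case by (rule trig_poly_const)
next
  case (add p q)
  then show ?case by (simp add: trig_poly.add)
next
  case (mult p q)
  then show ?case by (simp add: trig_poly_mult)
qed

section \<open>Totality: an integrable function orthogonal to all characters vanishes almost
  everywhere\<close>

context
  fixes g :: "'n phase \<Rightarrow> complex"
  assumes g: "integrable \<mu> g"
    and orth: "\<And>l. l \<in> \<Lambda> \<Longrightarrow> (\<integral>z. g z * sympl_char l z \<partial>\<mu>) = 0"
begin

lemma integrable_bounded_mult:
  assumes [measurable]: "u \<in> borel_measurable borel" and u: "\<And>z. cmod (u z) \<le> K"
  shows "integrable \<mu> (\<lambda>z. g z * u z)"
proof (rule Bochner_Integration.integrable_bound)
  have [measurable]: "g \<in> borel_measurable \<mu>" using g by simp
  show "(\<lambda>z. g z * u z) \<in> borel_measurable \<mu>" by measurable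
  show "integrable \<mu> (\<lambda>z. K * norm (g z))" using g by simp
  show "AE z in \<mu>. norm (g z * u z) \<le> norm (K * norm (g z))"
  proof (rule AE_I2)
    fix z
    have "norm (g z * u z) = cmod (u z) * norm (g z)" by (simp add: norm_mult)
    also have "\<dots> \<le> K * norm (g z)" using u by (intro mult_right_mono) auto
    also have "\<dots> \<le> norm (K * norm (g z))" by simp
    finally show "norm (g z * u z) \<le> norm (K * norm (g z))" .
  qed
qed

lemma integral_trig_poly:
  assumes "trig_poly \<Lambda> u"
  shows "integrable \<mu> (\<lambda>z. g z * u z) \<and> (\<integral>z. g z * u z \<partial>\<mu>) = 0"
  using assms
proof (induction u)
  case (char l a)
  have "integrable \<mu> (\<lambda>z. g z * (a * sympl_char l z))"
    by (rule integrable_bounded_mult[where K = "cmod a"])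
      (auto simp: norm_mult intro!: borel_measurable_continuous_onI continuous_intros)
  moreover have "(\<integral>z. g z * (a * sympl_char l z) \<partial>\<mu>)
      = (\<integral>z. a * (g z * sympl_char l z) \<partial>\<mu>)"
    by (simp add: mult_ac)
  ultimately show ?case using orth[OF char] by simp
next
  case (add u v)
  then show ?case by (simp add: distrib_left)
qed

text \<open>Stone-Weierstrass: a polynomial within \<open>e\<close> of \<open>h\<close> on the ball
  becomes a trigonometric polynomial, which integrates to zero against \<open>g\<close>. The error
  is at most \<open>e\<close> times the integral of \<open>norm (g z)\<close>.\<close>

lemma integral_continuous_torus:
  fixes h :: "'n phase \<times> 'n phase \<Rightarrow> real"
  assumes h: "continuous_on UNIV h"
  shows "(\<integral>z. g z * of_real (h (torus z)) \<partial>\<mu>) = 0"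
proof -
  let ?I = "\<integral>z. g z * of_real (h (torus z)) \<partial>\<mu>"
  define R where "R = 2 * real DIM('n phase)"
  have R: "torus z \<in> cball 0 R" for z using norm_torus_le by (simp add: R_def)
  have "compact (h ` cball 0 R)"
    by (intro compact_continuous_image continuous_on_subset[OF h]) auto
  then obtain K where K: "\<And>w. w \<in> cball 0 R \<Longrightarrow> \<bar>h w\<bar> \<le> K"
    using compact_imp_bounded bounded_iff by (metis imageI real_norm_def)
  have int_h: "integrable \<mu> (\<lambda>z. g z * of_real (h (torus z)))"
    by (rule integrable_bounded_mult[where K = K])
      (use K R in \<open>auto intro!: borel_measurable_continuous_onI continuous_intros
        continuous_on_compose2[OF h] continuous_torus\<close>)
  have le: "cmod ?I \<le> e * (\<integral>z. norm (g z) \<partial>\<mu>)" if "e > 0" for e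
  proof -
    obtain p where p: "real_polynomial_function p" and close: "\<And>w. w \<in> cball 0 R \<Longrightarrow> \<bar>h w - p w\<bar> < e"
      using Stone_Weierstrass_real_polynomial_function[of "cball 0 R" h e] \<open>e > 0\<close>
        continuous_on_subset[OF h] by auto
    note tp = integral_trig_poly[OF trig_poly_real_polynomial[OF p]]
    have int: "integrable \<mu> (\<lambda>z. g z * of_real (h (torus z)) - g z * of_real (p (torus z)))"
      using int_h tp by auto
    have "?I
        = (\<integral>z. g z * of_real (h (torus z)) - g z * of_real (p (torus z)) \<partial>\<mu>)"
      using int_h tp by simp
    also have "cmod \<dots> \<le> (\<integral>z. norm (g z * of_real (h (torus z)) - g z * of_real (p (torus z))) \<partial>\<mu>)"
      by (rule integral_norm_bound)
    also have "\<dots> \<le> (\<integral>z. e * norm (g z) \<partial>\<mu>)"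
    proof (rule integral_mono)
      show "norm (g z * of_real (h (torus z)) - g z * of_real (p (torus z))) \<le> e * norm (g z)" for z
      proof -
        have "norm (g z * of_real (h (torus z)) - g z * of_real (p (torus z)))
            = norm (g z) * \<bar>h (torus z) - p (torus z)\<bar>"
          by (simp add: right_diff_distrib[symmetric] norm_mult of_real_diff[symmetric] del: of_real_diff)
        also have "\<dots> \<le> norm (g z) * e"
          using close[OF R, of z] by (intro mult_left_mono) auto
        finally show ?thesis by (simp add: mult.commute)
      qed
    qed (use int g in auto)
    finally show ?thesis by simp
  qed
  have "cmod ?I \<le> 0"
  proof (rule field_le_epsilon)
    fix e :: real assume "e > 0"
    define I where "I = (\<integral>z. norm (g z) \<partial>\<mu>)"
    have I: "I \<ge> 0" by (simp add: I_def)
    \<comment> \<open>Adding 1 keeps the divisor positive even if \<open>g\<close> vanishes almost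
      everywhere.\<close>
    have "cmod ?I \<le> e / (I + 1) * I"
      unfolding I_def using \<open>e > 0\<close> I by (intro le) (simp add: I_def[symmetric])
    also have "\<dots> \<le> e"
      using \<open>e > 0\<close> I by (simp add: field_simps)
    finally show "cmod ?I \<le> 0 + e" by simp
  qed
  then show ?thesis by simp
qed

text \<open>On the cell, the indicator of a compact subset \<open>K\<close> is the pointwise limit of continuous
  functions of the torus coordinates, since \<open>torus\<close> is injective there.\<close>

lemma integral_compact:
  assumes K: "compact K" "K \<subseteq> cell"
  shows "(\<integral>z. indicator K z *\<^sub>R g z \<partial>\<mu>) = 0"
proof (cases "K = {}")
  case False
  define T where "T = torus ` K"
  have T: "closed T" "T \<noteq> {}"
    using False compact_continuous_image[OF continuous_torus K(1)] by (auto simp: T_def compact_imp_closed)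
  \<comment> \<open>A tent of height 1 on \<open>T\<close> that is zero from distance 1/n onwards.
    Off the closed set \<open>T\<close> the distance is positive, so the tents are eventually zero
    there.\<close>
  define h where "h n w = max 0 (1 - real n * infdist w T)" for n w
  have h_bound: "\<bar>h n w\<bar> \<le> 1" for n w
    using infdist_nonneg[of w T] by (auto simp: h_def)
  have h_cont: "continuous_on UNIV (h n)" for n
    unfolding h_def by (intro continuous_intros)
  have [measurable]: "g \<in> borel_measurable \<mu>" using g by simp
  have [measurable]: "K \<in> sets borel" using K by (simp add: compact_imp_closed)
  have [measurable]: "(\<lambda>z. h n (torus z)) \<in> borel_measurable borel" for n
    by (intro borel_measurable_continuous_onI continuous_on_compose2[OF h_cont] continuous_torus) auto
  have "(\<lambda>n. \<integral>z. g z * of_real (h n (torus z)) \<partial>\<mu>) \<longlonglongrightarrow> (\<integral>z. indicator K z *\<^sub>R g z \<partial>\<mu>)"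
  proof (rule integral_dominated_convergence[where w = "\<lambda>z. norm (g z)"])
    show "AE z in \<mu>. (\<lambda>n. g z * of_real (h n (torus z))) \<longlonglongrightarrow> indicator K z *\<^sub>R g z"
      using AE_\<mu>
    proof eventually_elim
      fix z assume z: "z \<in> cell"
      have "(\<lambda>n. h n (torus z)) \<longlonglongrightarrow> indicator K z"
      proof (cases "z \<in> K")
        case True
        then have "infdist (torus z) T = 0" using T by (simp add: T_def)
        then show ?thesis using True by (simp add: h_def)
      next
        case False
        have "torus z \<notin> T"
          using inj_on_torus z K(2) False by (auto simp: T_def inj_on_def subset_iff)
        then have d: "infdist (torus z) T > 0"
          using in_closed_iff_infdist_zero[OF T, of "torus z"] infdist_nonneg[of "torus z" T] by linarith
        then obtain N :: nat where N: "1 < real N * infdist (torus z) T"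
          using ex_less_of_nat_mult by blast
        have "\<forall>\<^sub>F n in sequentially. h n (torus z) = 0"
        proof (rule eventually_sequentiallyI[of N])
          fix n assume "N \<le> n"
          then have "real N * infdist (torus z) T \<le> real n * infdist (torus z) T"
            using d by (intro mult_right_mono) auto
          with N show "h n (torus z) = 0" by (simp add: h_def)
        qed
        then show ?thesis
          using False by (simp add: tendsto_eventually)
      qed
      then have "(\<lambda>n. g z * of_real (h n (torus z))) \<longlonglongrightarrow> g z * of_real (indicator K z)"
        by (intro tendsto_intros)
      then show "(\<lambda>n. g z * of_real (h n (torus z))) \<longlonglongrightarrow> indicator K z *\<^sub>R g z"
        by (simp add: scaleR_conv_of_real mult.commute)
    qed
    show "AE z in \<mu>. norm (g z * of_real (h n (torus z))) \<le> norm (g z)" for n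
      using h_bound[of n] by (intro AE_I2) (simp add: norm_mult mult_left_le)
  qed (use g in auto)
  then show ?thesis
    by (simp add: integral_continuous_torus[OF h_cont] LIMSEQ_const_iff)
qed simp

text \<open>Vanishing integrals over compact sets pass to real and imaginary parts with either sign,
  so all four functions are nonpositive almost everywhere.\<close>

lemma AE_eq_zero: "AE z in \<mu>. g z = 0"
proof -
  have le: "AE z in \<mu>. r z \<le> 0"
    if r: "integrable \<mu> r" and zero: "\<And>K. compact K \<Longrightarrow> K \<subseteq> cell \<Longrightarrow> (\<integral>z. indicator K z * r z \<partial>\<mu>) = 0"
    for r :: "'n phase \<Rightarrow> real"
    using prob_space.finite_measure[OF prob_space_\<mu>] sets_\<mu> r cell_measurable AE_\<mu> zero
    by (rule AE_nonpos_if_compact_integrals_zero)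
  have ReIm: "(\<integral>z. indicator K z * Re (g z) \<partial>\<mu>) = 0" "(\<integral>z. indicator K z * Im (g z) \<partial>\<mu>) = 0"
    if K: "compact K" "K \<subseteq> cell" for K
  proof -
    have [measurable]: "K \<in> sets \<mu>" using K by (simp add: sets_\<mu> compact_imp_closed)
    have int: "integrable \<mu> (\<lambda>z. indicator K z *\<^sub>R g z)"
      using g by (intro integrable_mult_indicator) auto
    have "(\<integral>z. Re (indicator K z *\<^sub>R g z) \<partial>\<mu>) = 0" "(\<integral>z. Im (indicator K z *\<^sub>R g z) \<partial>\<mu>) = 0"
      using integral_Re[OF int] integral_Im[OF int] integral_compact[OF K] by simp_all
    then show "(\<integral>z. indicator K z * Re (g z) \<partial>\<mu>) = 0" "(\<integral>z. indicator K z * Im (g z) \<partial>\<mu>) = 0"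
      by simp_all
  qed
  have "AE z in \<mu>. Re (g z) \<le> 0" by (rule le) (use g ReIm in auto)
  moreover have "AE z in \<mu>. - Re (g z) \<le> 0" by (rule le) (use g ReIm in auto)
  moreover have "AE z in \<mu>. Im (g z) \<le> 0" by (rule le) (use g ReIm in auto)
  moreover have "AE z in \<mu>. - Im (g z) \<le> 0" by (rule le) (use g ReIm in auto)
  ultimately have "AE z in \<mu>. Re (g z) \<le> 0 \<and> - Re (g z) \<le> 0 \<and> Im (g z) \<le> 0 \<and> - Im (g z) \<le> 0"
    by eventually_elim blast
  then show ?thesis
    by eventually_elim (simp add: complex_eq_iff)
qed

end

end

text \<open>\<open>C\<close> is taken to be the same choice that \<open>fundamental_cell\<close>
  makes; only then do results about the cell apply to \<open>dual_haar\<close>.\<close>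

lemma fundamental_cell_eq:
  fixes \<Lambda> :: "'n::finite phase set"
  assumes "full_rank_lattice \<Lambda>"
  obtains B C where "lattice_cell \<Lambda> B C" "lattice_cell.cell C = fundamental_cell (adjoint_lattice \<Lambda>)"
proof -
  obtain B where B: "lattice_basis B \<Lambda>" using assms by (auto simp: full_rank_lattice_def)
  define C where "C = (SOME C. lattice_basis C (adjoint_lattice \<Lambda>))"
  have "lattice_basis C (adjoint_lattice \<Lambda>)"
    unfolding C_def by (rule someI_ex[OF adjoint_lattice_basis_exists[OF B]])
  with B have cell: "lattice_cell \<Lambda> B C" by unfold_locales
  have "{z :: 'n phase. \<forall>i. fst z $ i \<in> {0..<1} \<and> snd z $ i \<in> {0..<1}}
      = {z. \<forall>b\<in>Basis. 0 \<le> z \<bullet> b \<and> z \<bullet> b < 1}"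
    using ball_Basis_phase[of "\<lambda>x. 0 \<le> x \<and> x < 1"] by auto
  then have "lattice_cell.cell C = fundamental_cell (adjoint_lattice \<Lambda>)"
    by (simp only: lattice_cell.cell_def[OF cell] fundamental_cell_def C_def[symmetric])
  with cell show thesis by (rule that)
qed

lemma space_dual_haar: "space (dual_haar \<Lambda>) = range (dual_class \<Lambda>)"
  by (simp add: dual_haar_def space_measure_of_conv)

lemma character_system_dual:
  fixes \<Lambda> :: "'n::finite phase set"
  assumes "full_rank_lattice \<Lambda>"
  shows "character_system (dual_haar \<Lambda>) \<Lambda> dual_char"
proof -
  obtain B C where "lattice_cell \<Lambda> B C" and cell: "lattice_cell.cell C = fundamental_cell (adjoint_lattice \<Lambda>)"
    by (rule fundamental_cell_eq[OF assms])
  then interpret lattice_cell \<Lambda> B C by simp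
  interpret \<mu>: prob_space \<mu> by (rule prob_space_\<mu>)
  \<comment> \<open>The target of the image measure matters only through its \<sigma>-algebra, so
    \<open>dual_haar\<close> itself can stand in that place; change of variables along
    \<open>dual_class\<close> then applies.\<close>
  have haar: "dual_haar \<Lambda> = distr \<mu> (dual_haar \<Lambda>) (dual_class \<Lambda>)"
    unfolding \<mu>_def cell by (subst dual_haar_def) (rule distr_cong, simp_all add: dual_haar_def)
  have class_measurable [measurable]: "dual_class \<Lambda> \<in> \<mu> \<rightarrow>\<^sub>M dual_haar \<Lambda>"
    using measurable_dual_class by (simp add: measurable_cong_sets[OF sets_\<mu> refl])
  have meas [measurable]: "dual_char l \<in> borel_measurable (dual_haar \<Lambda>)" if l: "l \<in> \<Lambda>" for l
  proof (rule measurableI)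
    fix U :: "complex set" assume [measurable]: "U \<in> sets borel"
    have [measurable]: "(\<lambda>z. sympl_char l z) \<in> borel_measurable borel"
      by (intro borel_measurable_continuous_onI continuous_intros)
    have "dual_class \<Lambda> -` (dual_char l -` U \<inter> range (dual_class \<Lambda>))
        = {z \<in> space borel. sympl_char l z \<in> U}"
      using dual_char_class[OF l] by auto
    also have "\<dots> \<in> sets borel" by measurable
    finally show "dual_char l -` U \<inter> space (dual_haar \<Lambda>) \<in> sets (dual_haar \<Lambda>)"
      by (simp add: sets_dual_haar space_dual_haar)
  qed simp
  have integral: "(\<integral>\<xi>. f \<xi> \<partial>dual_haar \<Lambda>) = (\<integral>z. f (dual_class \<Lambda> z) \<partial>\<mu>)"
    if "f \<in> borel_measurable (dual_haar \<Lambda>)" for f :: "'n phase set \<Rightarrow> complex"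
    using integral_distr[OF class_measurable that] haar by simp
  interpret haar: prob_space "dual_haar \<Lambda>"
    by (subst haar) (rule \<mu>.prob_space_distr[OF class_measurable])
  show ?thesis
  proof unfold_locales
    show "0 \<in> \<Lambda>" by (rule zero_lattice)
    show "l - m \<in> \<Lambda>" if "l \<in> \<Lambda>" "m \<in> \<Lambda>" for l m using that by (rule diff_lattice)
    show "dual_char l \<in> borel_measurable (dual_haar \<Lambda>)" if "l \<in> \<Lambda>" for l using that by (rule meas)
    show "dual_char (l + m) \<xi> = dual_char l \<xi> * dual_char m \<xi>"
      if "l \<in> \<Lambda>" "m \<in> \<Lambda>" "\<xi> \<in> space (dual_haar \<Lambda>)" for l m \<xi>
      by (simp add: dual_char_def symplectic_add_left distrib_left cis_mult)
    show "cmod (dual_char l \<xi>) = 1" if "l \<in> \<Lambda>" "\<xi> \<in> space (dual_haar \<Lambda>)" for l \<xi>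
      by (simp add: dual_char_def)
    show "(\<integral>\<xi>. dual_char l \<xi> \<partial>dual_haar \<Lambda>) = 0" if l: "l \<in> \<Lambda>" "l \<noteq> 0" for l
      by (simp add: integral[OF meas[OF l(1)]] dual_char_class[OF l(1)] integral_character_cell[OF l])
    fix f :: "'n phase set \<Rightarrow> complex"
    assume f [measurable]: "f \<in> borel_measurable (dual_haar \<Lambda>)"
      and sq: "integrable (dual_haar \<Lambda>) (\<lambda>\<xi>. (cmod (f \<xi>))\<^sup>2)"
      and orth: "\<And>l. l \<in> \<Lambda> \<Longrightarrow> (\<integral>\<xi>. f \<xi> * cnj (dual_char l \<xi>) \<partial>dual_haar \<Lambda>) = 0"
    \<comment> \<open>On a probability space the constant 1 is square integrable, so Cauchy-Schwarz
      makes \<open>f\<close> integrable, as \<open>AE_eq_zero\<close> requires.\<close>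
    have "integrable (dual_haar \<Lambda>) (\<lambda>\<xi>. f \<xi> * 1)"
      by (rule integral_cmod_sq_Cauchy_Schwarz(1)) (use sq in auto)
    then have "integrable \<mu> (\<lambda>z. f (dual_class \<Lambda> z))"
      using integrable_distr[OF class_measurable, of f] haar by simp
    moreover have "(\<integral>z. f (dual_class \<Lambda> z) * sympl_char l z \<partial>\<mu>) = 0" if l: "l \<in> \<Lambda>" for l
    proof -
      \<comment> \<open>The hypothesis pairs with conjugated characters; passing to
        \<open>- l\<close>, which is also in the lattice, removes the conjugation.\<close>
      have eq: "cnj (dual_char (- l) (dual_class \<Lambda> z)) = sympl_char l z" for z
        by (simp add: dual_char_class[OF uminus_lattice[OF l]] symplectic_uminus_left cis_cnj)
      have [measurable]: "(\<lambda>\<xi>. cnj (dual_char (- l) \<xi>)) \<in> borel_measurable (dual_haar \<Lambda>)"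
        by (intro borel_measurable_continuous_on[where f = cnj] continuous_intros meas uminus_lattice l)
      have "(\<integral>\<xi>. f \<xi> * cnj (dual_char (- l) \<xi>) \<partial>dual_haar \<Lambda>)
          = (\<integral>z. f (dual_class \<Lambda> z) * cnj (dual_char (- l) (dual_class \<Lambda> z)) \<partial>\<mu>)"
        by (rule integral) measurable
      then show ?thesis using orth[OF uminus_lattice[OF l]] by (simp add: eq)
    qed
    ultimately have "AE z in \<mu>. f (dual_class \<Lambda> z) = 0" by (rule AE_eq_zero)
    then have "AE \<xi> in distr \<mu> (dual_haar \<Lambda>) (dual_class \<Lambda>). f \<xi> = 0"
      by (subst AE_distr_iff) auto
    then show "AE \<xi> in dual_haar \<Lambda>. f \<xi> = 0" by (simp only: haar[symmetric])
  qed
qed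

section \<open>Multipliers\<close>

context character_system
begin

lemma coef_surj:
  assumes "(\<lambda>l. (cmod (c l))\<^sup>2) summable_on L"
  shows "\<exists>f. L2 f \<and> (\<forall>l\<in>L. coef f l = c l)"
proof -
  obtain G where "G \<in> borel_measurable M"
    and "gap_tendsto_0 c G"
    using Riesz_Fischer[OF assms] by blast
  note G = L2_limit[OF this]
  show ?thesis
    using G(1) coef_limit[OF G] by blast
qed

lemma coef_one: "l \<in> L \<Longrightarrow> coef (\<lambda>x. 1) l = (if l = 0 then 1 else 0)"
proof -
  assume l: "l \<in> L"
  have "coef (\<lambda>x. 1) l = J (ch 0) (ch l)"
    unfolding coef_def J_def by (intro Bochner_Integration.integral_cong) (simp_all add: char_zero)
  then show ?thesis using J_char[OF zero_L l] by auto
qed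

lemma coef_cong_AE:
  assumes "f \<in> borel_measurable M" "g \<in> borel_measurable M" "AE x in M. f x = g x" "l \<in> L"
  shows "coef f l = coef g l"
proof -
  have [measurable]: "f \<in> borel_measurable M" "g \<in> borel_measurable M" by fact+
  have [measurable]: "(\<lambda>x. cnj (ch l x)) \<in> borel_measurable M"
    using L2_cnj[OF L2_char[OF assms(4)]] by (simp add: L2_def)
  show ?thesis
    unfolding coef_def J_def by (rule integral_cong_AE) (measurable, use assms(3) in auto)
qed

lemma AE_not_in_if_integral_nonpos:
  fixes w :: "'a \<Rightarrow> real"
  assumes [measurable]: "E \<in> sets M" and int: "integrable M (\<lambda>x. indicator E x * w x)"
    and pos: "\<And>x. x \<in> E \<Longrightarrow> w x > 0" and le: "(\<integral>x. indicator E x * w x \<partial>M) \<le> 0"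
  shows "AE x in M. x \<notin> E"
proof -
  have nonneg: "AE x in M. 0 \<le> indicator E x * w x"
    using pos by (intro AE_I2) (auto simp: indicator_def less_imp_le)
  then have "0 \<le> (\<integral>x. indicator E x * w x \<partial>M)"
    by (rule integral_nonneg_AE)
  with le have "(\<integral>x. indicator E x * w x \<partial>M) = 0" by simp
  then have "AE x in M. indicator E x * w x = 0"
    using integral_nonneg_eq_0_iff_AE[OF int nonneg] by simp
  then show ?thesis
  proof eventually_elim
    fix x assume "indicator E x * w x = 0"
    then show "x \<notin> E" using pos[of x] by (auto simp: indicator_def split: if_splits)
  qed
qed

text \<open>The bound is imposed on \<open>E\<close> alone: \<theta> may be unbounded elsewhere, and
  the indicator cuts it off there.\<close>

lemma
  assumes E: "E \<in> sets M" and \<theta>: "\<theta> \<in> borel_measurable M"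
    and bd: "\<forall>x\<in>E. (cmod (\<theta> x))\<^sup>2 \<le> N"
  shows L2_indicator_mult: "L2 (indicator E)" "L2 (\<lambda>x. indicator E x * \<theta> x)"
    and integral_indicator_sq: "integrable M (\<lambda>x. indicator E x :: real)"
      "integrable M (\<lambda>x. indicator E x * (cmod (\<theta> x))\<^sup>2)"
      "sq_norm M (indicator E) = (\<integral>x. indicator E x \<partial>M)"
      "sq_norm M (\<lambda>x. indicator E x * \<theta> x) = (\<integral>x. indicator E x * (cmod (\<theta> x))\<^sup>2 \<partial>M)"
proof -
  have [measurable]: "E \<in> sets M" "\<theta> \<in> borel_measurable M" by fact+
  show "L2 (indicator E)"
    by (rule L2_bounded[where B = 1]) (auto simp: indicator_def)
  have "cmod (indicator E x * \<theta> x) \<le> sqrt (max 0 N)" for x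
    using bd by (auto simp: indicator_def intro!: real_le_rsqrt)
  then show L: "L2 (\<lambda>x. indicator E x * \<theta> x)"
    by (intro L2_bounded) auto
  have eq: "(cmod (indicator E x * \<theta> x))\<^sup>2 = indicator E x * (cmod (\<theta> x))\<^sup>2"
    "(cmod (indicator E x))\<^sup>2 = indicator E x" for x
    by (auto simp: indicator_def)
  show "integrable M (\<lambda>x. indicator E x :: real)"
    by (intro integrable_real_indicator) (auto simp: emeasure_eq_measure)
  show "integrable M (\<lambda>x. indicator E x * (cmod (\<theta> x))\<^sup>2)"
    using L unfolding L2_def eq by blast
  show "sq_norm M (indicator E) = (\<integral>x. indicator E x \<partial>M)"
    "sq_norm M (\<lambda>x. indicator E x * \<theta> x) = (\<integral>x. indicator E x * (cmod (\<theta> x))\<^sup>2 \<partial>M)"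
    unfolding eq by simp_all
qed

text \<open>Testing with the indicator of the set where the bound fails would show that set to be
  null, but \<theta> may be unbounded there. The set is therefore cut at level \<open>N\<close>, and
  the countable union over \<open>N\<close> recovers all of it.\<close>

lemma multiplier_upper_bound:
  assumes \<theta>: "\<theta> \<in> borel_measurable M"
    and le: "\<And>f. L2 f \<Longrightarrow> L2 (\<lambda>x. f x * \<theta> x) \<Longrightarrow>
      (sq_norm M (\<lambda>x. f x * \<theta> x)) \<le> a * sq_norm M f"
  shows "AE x in M. (cmod (\<theta> x))\<^sup>2 \<le> a"
proof -
  have [measurable]: "\<theta> \<in> borel_measurable M" by fact
  have "AE x in M. x \<notin> {x \<in> space M. a < (cmod (\<theta> x))\<^sup>2 \<and> (cmod (\<theta> x))\<^sup>2 \<le> real N}" for N :: nat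
  proof (rule AE_not_in_if_integral_nonpos[where w = "\<lambda>x. (cmod (\<theta> x))\<^sup>2 - a"])
    let ?E = "{x \<in> space M. a < (cmod (\<theta> x))\<^sup>2 \<and> (cmod (\<theta> x))\<^sup>2 \<le> real N}"
    show E: "?E \<in> sets M" by measurable
    have bd: "\<forall>x\<in>?E. (cmod (\<theta> x))\<^sup>2 \<le> real N" by simp
    note ind = L2_indicator_mult[OF E \<theta> bd] integral_indicator_sq[OF E \<theta> bd]
    have eq: "indicator ?E x * ((cmod (\<theta> x))\<^sup>2 - a) = indicator ?E x * (cmod (\<theta> x))\<^sup>2 - a * indicator ?E x" for x
      by (simp add: algebra_simps)
    show "integrable M (\<lambda>x. indicator ?E x * ((cmod (\<theta> x))\<^sup>2 - a))"
      unfolding eq using ind(3,4) by auto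
    show "(\<integral>x. indicator ?E x * ((cmod (\<theta> x))\<^sup>2 - a) \<partial>M) \<le> 0"
    proof -
      have "(\<integral>x. indicator ?E x * ((cmod (\<theta> x))\<^sup>2 - a) \<partial>M)
          = (\<integral>x. indicator ?E x * (cmod (\<theta> x))\<^sup>2 \<partial>M) - a * (\<integral>x. indicator ?E x \<partial>M)"
        unfolding eq using ind(3,4) by simp
      then show ?thesis
        using le[OF ind(1,2)] unfolding ind(5,6) by linarith
    qed
  qed auto
  then have "AE x in M. \<forall>N::nat. x \<notin> {x \<in> space M. a < (cmod (\<theta> x))\<^sup>2 \<and> (cmod (\<theta> x))\<^sup>2 \<le> real N}"
    by (intro AE_all_countable[THEN iffD2] allI)
  then show ?thesis
    using AE_space
  proof eventually_elim
    fix x assume "\<forall>N::nat. x \<notin> {x \<in> space M. a < (cmod (\<theta> x))\<^sup>2 \<and> (cmod (\<theta> x))\<^sup>2 \<le> real N}" "x \<in> space M"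
    then show "(cmod (\<theta> x))\<^sup>2 \<le> a"
      using real_arch_simple[of "(cmod (\<theta> x))\<^sup>2"] by force
  qed
qed

text \<open>On the set where the bound fails \<theta> is small, hence bounded, so its indicator is
  an admissible test function without any truncation.\<close>

lemma multiplier_lower_bound:
  assumes \<theta>: "\<theta> \<in> borel_measurable M" and b: "b > 0"
    and le: "\<And>f. L2 f \<Longrightarrow> L2 (\<lambda>x. f x * \<theta> x) \<Longrightarrow>
      (sq_norm M f) \<le> b * sq_norm M (\<lambda>x. f x * \<theta> x)"
  shows "AE x in M. 1 / b \<le> (cmod (\<theta> x))\<^sup>2"
proof -
  have [measurable]: "\<theta> \<in> borel_measurable M" by fact
  let ?E = "{x \<in> space M. (cmod (\<theta> x))\<^sup>2 < 1 / b}"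
  have "AE x in M. x \<notin> ?E"
  proof (rule AE_not_in_if_integral_nonpos[where w = "\<lambda>x. 1 - b * (cmod (\<theta> x))\<^sup>2"])
    show E: "?E \<in> sets M" by measurable
    have bd: "\<forall>x\<in>?E. (cmod (\<theta> x))\<^sup>2 \<le> 1 / b" by simp
    note ind = L2_indicator_mult[OF E \<theta> bd] integral_indicator_sq[OF E \<theta> bd]
    have eq: "indicator ?E x * (1 - b * (cmod (\<theta> x))\<^sup>2) = indicator ?E x - b * (indicator ?E x * (cmod (\<theta> x))\<^sup>2)" for x
      by (simp add: algebra_simps)
    show "integrable M (\<lambda>x. indicator ?E x * (1 - b * (cmod (\<theta> x))\<^sup>2))"
      unfolding eq using ind(3,4) by auto
    show "(\<integral>x. indicator ?E x * (1 - b * (cmod (\<theta> x))\<^sup>2) \<partial>M) \<le> 0"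
    proof -
      have "(\<integral>x. indicator ?E x * (1 - b * (cmod (\<theta> x))\<^sup>2) \<partial>M)
          = (\<integral>x. indicator ?E x \<partial>M) - b * (\<integral>x. indicator ?E x * (cmod (\<theta> x))\<^sup>2 \<partial>M)"
        unfolding eq using ind(3,4) by simp
      then show ?thesis
        using le[OF ind(1,2)] unfolding ind(5,6) by linarith
    qed
  qed (use b in \<open>auto simp: pos_less_divide_eq mult.commute\<close>)
  then show ?thesis
    using AE_space by eventually_elim auto
qed

end

section \<open>Essential bounds as almost-everywhere bounds\<close>

lemma essinf_le_AE: "AE x in M. essinf M f \<le> f x"
  using esssup_AE[of "\<lambda>x. - f x" M]
  by eventually_elim (simp add: essinf_def ereal_uminus_le_reorder)

lemma essential_bounds_iff:
  fixes g :: "'a \<Rightarrow> real"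
  assumes "prob_space M" and g [measurable]: "g \<in> borel_measurable M"
  shows "(0 < essinf M (\<lambda>x. ereal (g x)) \<and> essinf M (\<lambda>x. ereal (g x)) \<le> esssup M (\<lambda>x. ereal (g x)) \<and>
      esssup M (\<lambda>x. ereal (g x)) < \<infinity>) \<longleftrightarrow> (\<exists>m K. 0 < m \<and> (AE x in M. m \<le> g x \<and> g x \<le> K))"
    (is "?L \<longleftrightarrow> ?R")
proof
  interpret prob_space M by fact
  \<comment> \<open>Both sides are constants: an inequality between them that holds almost
    everywhere on a probability space simply holds.\<close>
  have mid: "essinf M (\<lambda>x. ereal (g x)) \<le> esssup M (\<lambda>x. ereal (g x))"
  proof -
    have "AE x in M. essinf M (\<lambda>x. ereal (g x)) \<le> esssup M (\<lambda>x. ereal (g x))"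
      using essinf_le_AE[of M "\<lambda>x. ereal (g x)"] esssup_AE[of "\<lambda>x. ereal (g x)" M]
      by eventually_elim (rule order_trans)
    then show ?thesis by simp
  qed
  show ?R if ?L
  proof -
    obtain m where m: "0 < ereal m" "ereal m < essinf M (\<lambda>x. ereal (g x))"
      using \<open>?L\<close> ereal_dense2[of 0] by (metis zero_ereal_def)
    obtain K where K: "esssup M (\<lambda>x. ereal (g x)) < ereal K"
      using \<open>?L\<close> ereal_dense2[of _ \<infinity>] by blast
    have "AE x in M. m \<le> g x \<and> g x \<le> K"
      using essinf_le_AE[of M "\<lambda>x. ereal (g x)"] esssup_AE[of "\<lambda>x. ereal (g x)" M]
    proof eventually_elim
      fix x assume "essinf M (\<lambda>x. ereal (g x)) \<le> ereal (g x)" "ereal (g x) \<le> esssup M (\<lambda>x. ereal (g x))"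
      then have "ereal m < ereal (g x)" "ereal (g x) < ereal K"
        using m(2) K by (blast intro: less_le_trans le_less_trans)+
      then show "m \<le> g x \<and> g x \<le> K" by simp
    qed
    with m show ?R by auto
  qed
  show ?L if ?R
  proof -
    obtain m K where m: "0 < m" and AE: "AE x in M. m \<le> g x \<and> g x \<le> K" using \<open>?R\<close> by blast
    have "esssup M (\<lambda>x. ereal (g x)) \<le> ereal K"
      by (rule esssup_I) (use AE in auto)
    moreover have "esssup M (\<lambda>x. - ereal (g x)) \<le> ereal (- m)"
      by (rule esssup_I) (use AE in auto)
    then have "- ereal (- m) \<le> essinf M (\<lambda>x. ereal (g x))"
      unfolding essinf_def by (simp only: ereal_minus_le_minus)
    then have "ereal m \<le> essinf M (\<lambda>x. ereal (g x))" by simp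
    moreover have "0 < ereal m" using m by simp
    ultimately have "0 < essinf M (\<lambda>x. ereal (g x))" by (meson less_le_trans)
    moreover have "esssup M (\<lambda>x. ereal (g x)) < \<infinity>"
      using \<open>esssup M (\<lambda>x. ereal (g x)) \<le> ereal K\<close> by (rule le_less_trans) simp
    ultimately show ?L using mid by blast
  qed
qed

section \<open>Reconstruction from samples\<close>

lemma Abs_hs_op_translate:
  "hilbert_schmidt A \<Longrightarrow> Abs_hs (op_translate l A) = hs_translate l (Abs_hs A)"
  by (rule hs_apply_inject[THEN iffD1]) (simp add: hs_translate.rep_eq hs_op_translate)

lemma hs_has_sum_translates_iff:
  assumes "hilbert_schmidt A"
  shows "hs_has_sum c (\<lambda>l. op_translate l A) \<Lambda> T \<longleftrightarrow>
    hilbert_schmidt T \<and> ((\<lambda>l. scaleC_hs (c l) (hs_translate l (Abs_hs A))) has_sum Abs_hs T) \<Lambda>"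
  by (simp add: hs_has_sum_iff hs_op_translate assms Abs_hs_op_translate)

lemma riesz_basis_translates_bounds:
  assumes "hilbert_schmidt A" and "riesz_basis V (\<lambda>l. op_translate l A) \<Lambda>"
  shows "\<exists>k K. k > 0 \<and> riesz_bounds k K (\<lambda>l. hs_translate l (Abs_hs A)) \<Lambda>"
  using riesz_basis_bounds[OF assms(2)] unfolding Abs_hs_op_translate[OF assms(1)] .

text \<open>Translating \<open>H\<close> by \<open>m\<close> shifts its coefficient sequence by
  \<open>m\<close>. A finite combination of translates of \<open>H\<close> therefore has as
  coefficients the convolution of the weights with \<open>h\<close>.\<close>

lemma sum_translates_has_sum:
  assumes L: "0 \<in> \<Lambda>" "\<And>l m. l \<in> \<Lambda> \<Longrightarrow> m \<in> \<Lambda> \<Longrightarrow> l - m \<in> \<Lambda>" and F: "finite F" "F \<subseteq> \<Lambda>"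
    and H: "((\<lambda>l. scaleC_hs (h l) (hs_translate l A)) has_sum H) \<Lambda>"
  shows "((\<lambda>l. scaleC_hs (\<Sum>m\<in>F. s m * h (l - m)) (hs_translate l A)) has_sum
    (\<Sum>m\<in>F. scaleC_hs (s m) (hs_translate m H))) \<Lambda>"
proof -
  have add: "l + m \<in> \<Lambda>" if "l \<in> \<Lambda>" "m \<in> \<Lambda>" for l m
    using L(2)[OF that(1) L(2)[OF L(1) that(2)]] by simp
  have one: "((\<lambda>l. scaleC_hs (s m * h (l - m)) (hs_translate l A)) has_sum scaleC_hs (s m) (hs_translate m H)) \<Lambda>"
    if m: "m \<in> \<Lambda>" for m
  proof -
    have "((\<lambda>l. scaleC_hs (s m) (hs_translate m (scaleC_hs (h l) (hs_translate l A))))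
        has_sum scaleC_hs (s m) (hs_translate m H)) \<Lambda>"
      using has_sum_bounded_linear[OF hs.bounded_linear_sc
          has_sum_bounded_linear[OF bounded_linear_hs_translate H]]
      by (simp add: o_def)
    then have "((\<lambda>l. scaleC_hs (s m * h l) (hs_translate (m + l) A)) has_sum scaleC_hs (s m) (hs_translate m H)) \<Lambda>"
      by (simp add: hs_translate_scaleC hs_translate_hs_translate hs.sc_sc)
    then show ?thesis
      by (rule has_sum_reindex_bij_witness[THEN iffD2, rotated -1, where j1 = "\<lambda>l. l - m" and i1 = "\<lambda>l. m + l"])
        (use m L add in auto)
  qed
  show ?thesis
    using F
  proof (induction F rule: finite_induct)
    case (insert m F)
    then show ?case
      using has_sum_add[OF one[of m]] by (simp add: hs.sc_add_left)
  qed (simp add: hs.sc_zero_left)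
qed

theorem theorem1:
  fixes \<Lambda> :: "'n::finite phase set" and S :: "'n operator" and q :: "'n phase \<Rightarrow> complex"
  assumes "full_rank_lattice \<Lambda>"
    and "hilbert_schmidt S"
    and "riesz_sequence (\<lambda>l. op_translate l S) \<Lambda>"
    and "q \<in> ell2 \<Lambda>"
  shows
    "(condition_R \<Lambda> q \<longrightarrow>
        (\<forall>c\<in>ell2 \<Lambda>. lattice_conv \<Lambda> c q \<in> ell2 \<Lambda>) \<and>
        (\<exists>!H. H \<in> V2 \<Lambda> S \<and>
          (\<forall>T\<in>V2 \<Lambda> S. \<forall>c\<in>ell2 \<Lambda>. hs_has_sum c (\<lambda>l. op_translate l S) \<Lambda> T \<longrightarrow>
             hs_has_sum (lattice_conv \<Lambda> c q) (\<lambda>l. op_translate l H) \<Lambda> T))) \<and>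
     ((\<exists>H\<in>V2 \<Lambda> S.
          riesz_basis (V2 \<Lambda> S) (\<lambda>l. op_translate l H) \<Lambda> \<and>
          (\<forall>T\<in>V2 \<Lambda> S. \<forall>c\<in>ell2 \<Lambda>. hs_has_sum c (\<lambda>l. op_translate l S) \<Lambda> T \<longrightarrow>
             hs_has_sum (lattice_conv \<Lambda> c q) (\<lambda>l. op_translate l H) \<Lambda> T)) \<longrightarrow>
        condition_R \<Lambda> q)"
proof -
  let ?M = "dual_haar \<Lambda>"
  interpret F: character_system "dual_haar \<Lambda>" \<Lambda> dual_char
    by (rule character_system_dual[OF assms(1)])
  define \<theta> where "\<theta> = symplectic_fourier \<Lambda> q"
  \<comment> \<open>The sequence q is square summable, so Riesz-Fischer provides a witness for the
    choice in \<open>symplectic_fourier\<close>.\<close>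
  have ex: "\<exists>G. G \<in> borel_measurable (dual_haar \<Lambda>) \<and>
      ((\<lambda>F. \<integral>\<^sup>+\<xi>. ennreal ((cmod ((\<Sum>l\<in>F. q l * dual_char l \<xi>) - G \<xi>))\<^sup>2) \<partial>dual_haar \<Lambda>) \<longlongrightarrow> 0)
        (finite_subsets_at_top \<Lambda>)"
    using F.Riesz_Fischer[of q] assms(4) by (simp add: ell2_def F.trig_def)
  have \<theta>_meas [measurable]: "\<theta> \<in> borel_measurable (dual_haar \<Lambda>)"
    and \<theta>_lim: "((\<lambda>F. L2_gap (dual_haar \<Lambda>) (F.trig q F) \<theta>) \<longlongrightarrow> 0)
      (finite_subsets_at_top \<Lambda>)"
    using someI_ex[OF ex] unfolding \<theta>_def symplectic_fourier_def F.trig_def by simp_all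
  note L2_\<theta> = F.L2_limit(1)[OF \<theta>_meas \<theta>_lim]
  have coef_\<theta>: "F.coef \<theta> l = q l" if "l \<in> \<Lambda>" for l
    using F.coef_limit[OF F.L2_limit[OF \<theta>_meas \<theta>_lim] that] .
  have R_iff: "condition_R \<Lambda> q \<longleftrightarrow>
      (\<exists>m K. 0 < m \<and> (AE \<xi> in ?M. m \<le> cmod (\<theta> \<xi>) \<and> cmod (\<theta> \<xi>) \<le> K))"
    unfolding condition_R_def \<theta>_def[symmetric]
    by (rule essential_bounds_iff[OF F.prob_space_axioms]) measurable
  \<comment> \<open>No bound on \<theta> enters, so the rule is available in both directions of the
    theorem.\<close>
  have conv: "lattice_conv \<Lambda> c q l = F.coef (\<lambda>\<xi>. f \<xi> * \<theta> \<xi>) l"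
    if f: "F.L2 f" and fc: "\<And>l. l \<in> \<Lambda> \<Longrightarrow> F.coef f l = c l" and l: "l \<in> \<Lambda>" for f c l
  proof -
    have "((\<lambda>m. c m * q (l - m)) has_sum F.coef (\<lambda>\<xi>. f \<xi> * \<theta> \<xi>) l) \<Lambda>"
      using F.coef_mult[OF f L2_\<theta> l]
      by (rule has_sum_cong[THEN iffD1, rotated]) (simp add: fc coef_\<theta> F.diff_L l)
    then show ?thesis unfolding lattice_conv_def by (rule infsumI)
  qed
  have obtain_f: "\<exists>f. F.L2 f \<and> (\<forall>l\<in>\<Lambda>. F.coef f l = c l)" if "c \<in> ell2 \<Lambda>" for c
    using F.coef_surj that by (simp add: ell2_def)
  have Parseval: "((\<lambda>l. (cmod (c l))\<^sup>2) has_sum (sq_norm ?M f)) \<Lambda>"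
    if "F.L2 f" "\<And>l. l \<in> \<Lambda> \<Longrightarrow> F.coef f l = c l" for f c
    using F.Parseval(1)[OF that(1)] by (rule has_sum_cong[THEN iffD1, rotated]) (simp add: that(2))
  define A where "A l = hs_translate l (Abs_hs S)" for l
  have S_iff: "hs_has_sum c (\<lambda>l. op_translate l S) \<Lambda> T \<longleftrightarrow>
      hilbert_schmidt T \<and> ((\<lambda>l. scaleC_hs (c l) (A l)) has_sum Abs_hs T) \<Lambda>" for c T
    unfolding A_def by (rule hs_has_sum_translates_iff[OF assms(2)])
  obtain k K where k: "k > 0" and bounds: "riesz_bounds k K A \<Lambda>"
    using riesz_basis_translates_bounds[OF assms(2) assms(3)[unfolded riesz_sequence_def]]
    unfolding A_def[abs_def, symmetric] by (elim exE conjE)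
  note lower = bounds[unfolded riesz_bounds_def, rule_format, THEN conjunct1]
    and upper = bounds[unfolded riesz_bounds_def, rule_format, THEN conjunct2]
  have synth: "((\<lambda>l. scaleC_hs (c l) (A l)) has_sum (\<Sum>\<^sub>\<infinity>l\<in>\<Lambda>. scaleC_hs (c l) (A l))) \<Lambda>"
    if "c \<in> ell2 \<Lambda>" for c
  proof -
    have "(\<lambda>l. (cmod (c l))\<^sup>2) summable_on \<Lambda>" using that by (simp add: ell2_def)
    then show ?thesis
      by (intro has_sum_infsum hs.series_upper_bound(1)[OF upper has_sum_infsum])
  qed
  have V2_synth: "hs_apply (\<Sum>\<^sub>\<infinity>l\<in>\<Lambda>. scaleC_hs (c l) (A l)) \<in> V2 \<Lambda> S"
    "hs_has_sum c (\<lambda>l. op_translate l S) \<Lambda> (hs_apply (\<Sum>\<^sub>\<infinity>l\<in>\<Lambda>. scaleC_hs (c l) (A l)))"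
    if "c \<in> ell2 \<Lambda>" for c
    using synth[OF that] that unfolding V2_def by (auto simp: S_iff hs_apply_inverse)
  have V2_hs: "hilbert_schmidt T" if "T \<in> V2 \<Lambda> S" for T
    using that by (auto simp: V2_def hs_has_sum_def)
  define recon where "recon H \<longleftrightarrow> (\<forall>T\<in>V2 \<Lambda> S. \<forall>c\<in>ell2 \<Lambda>.
      hs_has_sum c (\<lambda>l. op_translate l S) \<Lambda> T \<longrightarrow>
      hs_has_sum (lattice_conv \<Lambda> c q) (\<lambda>l. op_translate l H) \<Lambda> T)" for H
  show ?thesis
    unfolding recon_def[symmetric]
  proof (intro conjI impI)
    assume "condition_R \<Lambda> q"
    then obtain m K' where m: "m > 0" and AE: "AE \<xi> in ?M. m \<le> cmod (\<theta> \<xi>) \<and> cmod (\<theta> \<xi>) \<le> K'"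
      using R_iff by blast
    have L2_mult: "F.L2 (\<lambda>\<xi>. f \<xi> * \<theta> \<xi>)" if "F.L2 f" for f
      using that by (rule F.L2_bounded_mult[where B = K']) (use AE in auto)
    show "\<forall>c\<in>ell2 \<Lambda>. lattice_conv \<Lambda> c q \<in> ell2 \<Lambda>"
    proof
      fix c assume "c \<in> ell2 \<Lambda>"
      then obtain f where f: "F.L2 f" "\<And>l. l \<in> \<Lambda> \<Longrightarrow> F.coef f l = c l" using obtain_f by blast
      show "lattice_conv \<Lambda> c q \<in> ell2 \<Lambda>"
        using Parseval[OF L2_mult[OF f(1)], of "lattice_conv \<Lambda> c q"] conv[OF f]
        by (auto simp: ell2_def intro: has_sum_imp_summable)
    qed
    define \<eta> where "\<eta> \<xi> = inverse (\<theta> \<xi>)" for \<xi>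
    have \<eta>_meas [measurable]: "\<eta> \<in> borel_measurable (dual_haar \<Lambda>)" unfolding \<eta>_def by measurable
    have \<eta>_bd: "AE \<xi> in ?M. cmod (\<eta> \<xi>) \<le> inverse m"
      using AE by eventually_elim (use m in \<open>simp add: \<eta>_def norm_inverse le_imp_inverse_le\<close>)
    have L2_\<eta>: "F.L2 \<eta>" by (rule F.L2_bounded[OF \<eta>_meas \<eta>_bd])
    define h where "h = F.coef \<eta>"
    have h: "h \<in> ell2 \<Lambda>"
      using Parseval[OF L2_\<eta>, of h] by (auto simp: ell2_def h_def intro: has_sum_imp_summable)
    define H where "H = (\<Sum>\<^sub>\<infinity>l\<in>\<Lambda>. scaleC_hs (h l) (A l))"
    have H_sum: "((\<lambda>l. scaleC_hs (h l) (A l)) has_sum H) \<Lambda>"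
      unfolding H_def by (rule synth[OF h])
    have delta: "lattice_conv \<Lambda> h q l = (if l = 0 then 1 else 0)" if l: "l \<in> \<Lambda>" for l
    proof -
      have "lattice_conv \<Lambda> h q l = F.coef (\<lambda>\<xi>. \<eta> \<xi> * \<theta> \<xi>) l"
        by (rule conv[OF L2_\<eta> _ l]) (simp add: h_def)
      also have "\<dots> = F.coef (\<lambda>\<xi>. 1) l"
      proof (rule F.coef_cong_AE)
        show "AE \<xi> in ?M. \<eta> \<xi> * \<theta> \<xi> = 1"
          using AE
        proof eventually_elim
          fix \<xi> assume "m \<le> cmod (\<theta> \<xi>) \<and> cmod (\<theta> \<xi>) \<le> K'"
          then have "\<theta> \<xi> \<noteq> 0" using m by auto
          then show "\<eta> \<xi> * \<theta> \<xi> = 1" by (simp add: \<eta>_def)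
        qed
      qed (use l in measurable)
      finally show ?thesis using F.coef_one[OF l] by simp
    qed
    have reconstruct: "((\<lambda>l. scaleC_hs (lattice_conv \<Lambda> c q l) (hs_translate l H)) has_sum T) \<Lambda>"
      if c: "c \<in> ell2 \<Lambda>" and T: "((\<lambda>l. scaleC_hs (c l) (A l)) has_sum T) \<Lambda>" for c T
    proof -
      obtain f where f: "F.L2 f" "\<And>l. l \<in> \<Lambda> \<Longrightarrow> F.coef f l = c l" using obtain_f[OF c] by blast
      define s where "s = F.coef (\<lambda>\<xi>. f \<xi> * \<theta> \<xi>)"
      let ?d = "\<lambda>F \<xi>. F.trig s F \<xi> - f \<xi> * \<theta> \<xi>"
      have s: "lattice_conv \<Lambda> c q l = s l" if "l \<in> \<Lambda>" for l
        unfolding s_def by (rule conv[OF f that])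
      note f\<theta> = L2_mult[OF f(1)]
      define P where "P F = (\<Sum>m\<in>F. scaleC_hs (s m) (hs_translate m H))" for F
      have bound: "(norm (P F - T))\<^sup>2
          \<le> K * ((inverse m)\<^sup>2 * sq_norm ?M (?d F))"
        if F: "finite F" "F \<subseteq> \<Lambda>" for F
      proof -
        \<comment> \<open>The operator \<open>P F - T\<close> is the synthesis of the coefficients
          of \<open>e\<close>: combining translates of \<open>H\<close> multiplies by \<eta>, and
          \<open>T\<close> contributes \<open>f\<close>. Almost everywhere \<open>f\<close> is
          \<eta> times f \<theta>, so \<open>e\<close> is \<eta> times the Fourier truncation error
          of f \<theta>, and \<eta> is bounded by 1/m.\<close>
        define e where "e \<xi> = F.trig s F \<xi> * \<eta> \<xi> - f \<xi>" for \<xi>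
        note tF = F.L2_trig[OF F, of s]
        have t\<eta>: "F.L2 (\<lambda>\<xi>. F.trig s F \<xi> * \<eta> \<xi>)"
          by (rule F.L2_bounded_mult[OF tF \<eta>_meas \<eta>_bd])
        have e: "F.L2 e" unfolding e_def by (rule F.L2_diff[OF t\<eta> f(1)])
        have coef_e: "F.coef e l = (\<Sum>m\<in>F. s m * h (l - m)) - c l" if "l \<in> \<Lambda>" for l
          unfolding e_def h_def using that
          by (simp add: F.coef_diff[OF t\<eta> f(1)] F.coef_trig_mult[OF F L2_\<eta>] f(2))
        have neg: "((\<lambda>l. - scaleC_hs (c l) (A l)) has_sum - T) \<Lambda>"
          using T by (simp add: has_sum_uminus)
        have "((\<lambda>l. scaleC_hs (\<Sum>m\<in>F. s m * h (l - m)) (A l) - scaleC_hs (c l) (A l)) has_sum (P F - T)) \<Lambda>"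
          using has_sum_add[OF sum_translates_has_sum[OF F.zero_L F.diff_L F H_sum[unfolded A_def], of s] neg]
          by (simp add: P_def A_def)
        then have sum: "((\<lambda>l. scaleC_hs (F.coef e l) (A l)) has_sum (P F - T)) \<Lambda>"
          by (rule has_sum_cong[THEN iffD1, rotated]) (simp add: coef_e hs.sc_diff_left)
        have "(norm (P F - T))\<^sup>2 \<le> K * sq_norm ?M e"
          using hs.series_upper_bound(2)[OF upper F.Parseval(1)[OF e]] infsumI[OF sum] by simp
        also have "\<dots> \<le> K * (\<integral>\<xi>. (inverse m)\<^sup>2 * (cmod (?d F \<xi>))\<^sup>2 \<partial>dual_haar \<Lambda>)"
        proof (rule mult_left_mono)
          show "sq_norm ?M e
              \<le> (\<integral>\<xi>. (inverse m)\<^sup>2 * (cmod (?d F \<xi>))\<^sup>2 \<partial>dual_haar \<Lambda>)"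
          proof (rule integral_mono_AE)
            show "integrable (dual_haar \<Lambda>) (\<lambda>\<xi>. (cmod (e \<xi>))\<^sup>2)" using e by (simp add: F.L2_def)
            show "integrable (dual_haar \<Lambda>) (\<lambda>\<xi>. (inverse m)\<^sup>2 * (cmod (?d F \<xi>))\<^sup>2)"
              using F.L2_diff[OF tF f\<theta>] by (simp add: F.L2_def)
            show "AE \<xi> in ?M. (cmod (e \<xi>))\<^sup>2
                \<le> (inverse m)\<^sup>2 * (cmod (?d F \<xi>))\<^sup>2"
              using \<eta>_bd AE
            proof eventually_elim
              fix \<xi> assume bd: "cmod (\<eta> \<xi>) \<le> inverse m" "m \<le> cmod (\<theta> \<xi>) \<and> cmod (\<theta> \<xi>) \<le> K'"
              then have "\<theta> \<xi> \<noteq> 0" using m by auto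
              then have "e \<xi> = \<eta> \<xi> * (?d F \<xi>)"
                by (simp add: e_def \<eta>_def field_simps)
              then have "cmod (e \<xi>) \<le> inverse m * cmod (?d F \<xi>)"
                using bd by (simp add: norm_mult mult_right_mono)
              then have "(cmod (e \<xi>))\<^sup>2 \<le> (inverse m * cmod (?d F \<xi>))\<^sup>2"
                by (intro power_mono) auto
              then show "(cmod (e \<xi>))\<^sup>2 \<le> (inverse m)\<^sup>2 * (cmod (?d F \<xi>))\<^sup>2"
                by (simp only: power_mult_distrib)
            qed
          qed
          \<comment> \<open>The sign of \<open>K\<close> is not recorded in
            \<open>riesz_bounds\<close>; the one-term combination at the lattice point 0 forces it
            to be nonnegative.\<close>
          have "0 \<le> (norm (\<Sum>l\<in>{0}. scaleC_hs 1 (A l)))\<^sup>2" by simp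
          also have "\<dots> \<le> K" using upper[of "{0}" "\<lambda>l. 1"] F.zero_L by simp
          finally show "0 \<le> K" .
        qed
        finally show ?thesis by simp
      qed
      have "((\<lambda>F. K * ((inverse m)\<^sup>2 * sq_norm ?M (?d F)))
          \<longlongrightarrow> K * ((inverse m)\<^sup>2 * 0)) (finite_subsets_at_top \<Lambda>)"
        unfolding s_def by (intro tendsto_mult_left F.Parseval(2) f\<theta>)
      then have lim0: "((\<lambda>F. K * ((inverse m)\<^sup>2 * sq_norm ?M (?d F)))
          \<longlongrightarrow> 0) (finite_subsets_at_top \<Lambda>)"
        by simp
      have "((\<lambda>F. (norm (P F - T))\<^sup>2) \<longlongrightarrow> 0) (finite_subsets_at_top \<Lambda>)"
        by (rule tendsto_sandwich[OF _ _ tendsto_const lim0])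
          (auto intro!: eventually_finite_subsets_at_top_weakI bound)
      then have "((\<lambda>F. sqrt ((norm (P F - T))\<^sup>2)) \<longlongrightarrow> sqrt 0) (finite_subsets_at_top \<Lambda>)"
        by (rule tendsto_real_sqrt)
      then have "((\<lambda>F. P F - T) \<longlongrightarrow> 0) (finite_subsets_at_top \<Lambda>)"
        by (simp add: tendsto_norm_zero_iff)
      then have "((\<lambda>l. scaleC_hs (s l) (hs_translate l H)) has_sum T) \<Lambda>"
        unfolding has_sum_def P_def by (simp only: LIM_zero_iff)
      then show ?thesis
        by (rule has_sum_cong[THEN iffD1, rotated]) (simp add: s)
    qed
    show "\<exists>!H. H \<in> V2 \<Lambda> S \<and> recon H"
    proof (rule ex1I[of _ "hs_apply H"], intro conjI)
      show "hs_apply H \<in> V2 \<Lambda> S" unfolding H_def by (rule V2_synth(1)[OF h])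
      show "recon (hs_apply H)"
        unfolding recon_def using reconstruct by (simp add: S_iff hs_has_sum_translates_iff hs_apply_inverse)
    next
      fix H' assume H': "H' \<in> V2 \<Lambda> S \<and> recon H'"
      then have hs_H': "hilbert_schmidt H'" using V2_hs by blast
      have "hs_has_sum (lattice_conv \<Lambda> h q) (\<lambda>l. op_translate l H') \<Lambda> (hs_apply H)"
        using H' V2_synth[OF h] h unfolding H_def recon_def by blast
      then have "((\<lambda>l. scaleC_hs (lattice_conv \<Lambda> h q l) (hs_translate l (Abs_hs H'))) has_sum H) \<Lambda>"
        by (simp add: hs_has_sum_translates_iff[OF hs_H'] hs_apply_inverse)
      moreover have "((\<lambda>l. scaleC_hs (lattice_conv \<Lambda> h q l) (hs_translate l (Abs_hs H'))) has_sum Abs_hs H') \<Lambda>"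
        by (rule has_sum_finite_neutralI[of "{0}"])
          (auto simp: delta F.zero_L hs.sc_zero_left hs.sc_one hs_translate_zero)
      ultimately have "H = Abs_hs H'" by (rule has_sum_unique)
      then show "H' = hs_apply H" using hs_H' by simp
    qed
  next
    assume "\<exists>H\<in>V2 \<Lambda> S. riesz_basis (V2 \<Lambda> S) (\<lambda>l. op_translate l H) \<Lambda> \<and> recon H"
    then obtain H where H: "H \<in> V2 \<Lambda> S" "riesz_basis (V2 \<Lambda> S) (\<lambda>l. op_translate l H) \<Lambda>" and rec: "recon H"
      by blast
    have hs_H: "hilbert_schmidt H" by (rule V2_hs[OF H(1)])
    define A' where "A' l = hs_translate l (Abs_hs H)" for l
    obtain k' K' where k': "k' > 0" and bounds': "riesz_bounds k' K' A' \<Lambda>"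
      using riesz_basis_translates_bounds[OF hs_H H(2)]
      unfolding A'_def[abs_def, symmetric] by (elim exE conjE)
    note lower' = bounds'[unfolded riesz_bounds_def, rule_format, THEN conjunct1]
      and upper' = bounds'[unfolded riesz_bounds_def, rule_format, THEN conjunct2]
    \<comment> \<open>The operator \<open>T\<close> with coefficients \<open>c\<close> over the
      translates of \<open>S\<close> has coefficients \<open>s\<close> over those of
      \<open>H\<close>, so its norm links the two square sums. Square integrability of f \<theta> is
      a premise here because \<theta> is not yet known to be bounded.\<close>
    have compare: "k' * sq_norm ?M (\<lambda>\<xi>. f \<xi> * \<theta> \<xi>) \<le> K * sq_norm ?M f"
      "k * sq_norm ?M f \<le> K' * sq_norm ?M (\<lambda>\<xi>. f \<xi> * \<theta> \<xi>)"
      if f: "F.L2 f" and f\<theta>: "F.L2 (\<lambda>\<xi>. f \<xi> * \<theta> \<xi>)" for f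
    proof -
      define c where "c = F.coef f"
      define s where "s = lattice_conv \<Lambda> c q"
      have fc: "F.coef f l = c l" for l by (simp add: c_def)
      have c_sum: "((\<lambda>l. (cmod (c l))\<^sup>2) has_sum (sq_norm ?M f)) \<Lambda>"
        by (rule Parseval[OF f fc])
      have s_sum: "((\<lambda>l. (cmod (s l))\<^sup>2) has_sum (sq_norm ?M (\<lambda>\<xi>. f \<xi> * \<theta> \<xi>))) \<Lambda>"
        by (rule Parseval[OF f\<theta>]) (simp add: s_def conv[OF f fc])
      have c: "c \<in> ell2 \<Lambda>" using c_sum by (auto simp: ell2_def intro: has_sum_imp_summable)
      define T where "T = (\<Sum>\<^sub>\<infinity>l\<in>\<Lambda>. scaleC_hs (c l) (A l))"
      have T: "((\<lambda>l. scaleC_hs (c l) (A l)) has_sum T) \<Lambda>" unfolding T_def by (rule synth[OF c])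
      have "hs_has_sum s (\<lambda>l. op_translate l H) \<Lambda> (hs_apply T)"
        using rec V2_synth[OF c] c unfolding recon_def T_def s_def by blast
      then have T': "((\<lambda>l. scaleC_hs (s l) (A' l)) has_sum T) \<Lambda>"
        by (simp add: hs_has_sum_translates_iff[OF hs_H] hs_apply_inverse A'_def)
      have "k' * sq_norm ?M (\<lambda>\<xi>. f \<xi> * \<theta> \<xi>) \<le> (norm T)\<^sup>2"
        using hs.series_lower_bound[OF lower' k' T'] has_sum_unique[OF s_sum] by auto
      also have "\<dots> \<le> K * sq_norm ?M f"
        using hs.series_upper_bound(2)[OF upper c_sum] infsumI[OF T] by simp
      finally show "k' * sq_norm ?M (\<lambda>\<xi>. f \<xi> * \<theta> \<xi>) \<le> K * sq_norm ?M f" .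
      have "k * sq_norm ?M f \<le> (norm T)\<^sup>2"
        using hs.series_lower_bound[OF lower k T] has_sum_unique[OF c_sum] by auto
      also have "\<dots> \<le> K' * sq_norm ?M (\<lambda>\<xi>. f \<xi> * \<theta> \<xi>)"
        using hs.series_upper_bound(2)[OF upper' s_sum] infsumI[OF T'] by simp
      finally show "k * sq_norm ?M f \<le> K' * sq_norm ?M (\<lambda>\<xi>. f \<xi> * \<theta> \<xi>)" .
    qed
    have up: "AE \<xi> in ?M. (cmod (\<theta> \<xi>))\<^sup>2 \<le> K / k'"
      by (rule F.multiplier_upper_bound[OF \<theta>_meas])
        (use compare(1) k' in \<open>simp add: pos_le_divide_eq mult.commute\<close>)
    \<comment> \<open>Replacing \<open>K'\<close> by \<open>\<bar>K'\<bar> + 1\<close> makes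
      \<open>b\<close> positive whatever the sign of \<open>K'\<close>; the comparison survives
      because square norms are nonnegative.\<close>
    define b where "b = (\<bar>K'\<bar> + 1) / k"
    have b: "b > 0" using k by (simp add: b_def add_nonneg_pos)
    have low: "AE \<xi> in ?M. 1 / b \<le> (cmod (\<theta> \<xi>))\<^sup>2"
    proof (rule F.multiplier_lower_bound[OF \<theta>_meas b])
      fix f assume f: "F.L2 f" "F.L2 (\<lambda>\<xi>. f \<xi> * \<theta> \<xi>)"
      define I where "I = sq_norm ?M (\<lambda>\<xi>. f \<xi> * \<theta> \<xi>)"
      have "k * sq_norm ?M f \<le> K' * I"
        unfolding I_def by (rule compare(2)[OF f])
      also have "\<dots> \<le> (\<bar>K'\<bar> + 1) * I"
        by (intro mult_right_mono) (auto simp: I_def)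
      finally show "sq_norm ?M f \<le> b * sq_norm ?M (\<lambda>\<xi>. f \<xi> * \<theta> \<xi>)"
        using k unfolding I_def[symmetric] b_def by (simp add: pos_le_divide_eq mult.commute)
    qed
    have "AE \<xi> in ?M. sqrt (1 / b) \<le> cmod (\<theta> \<xi>) \<and> cmod (\<theta> \<xi>) \<le> sqrt (K / k')"
      using up low by eventually_elim (auto intro: real_le_lsqrt real_le_rsqrt)
    then show "condition_R \<Lambda> q"
      unfolding R_iff using b by (intro exI[of _ "sqrt (1 / b)"] exI[of _ "sqrt (K / k')"]) simp
  qed
qed

end
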